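(* Let $\pi_1:V_1\to X_1$ and $\pi_2:V_2\to X_2$ be two finite-dimensional diffeological vector pseudo-bundles, let $f:X_1\supset Y\to X_2$ be a smooth map that is a diffeomorphism with its image, and let $\tilde f:\pi_1^{-1}(Y)\to\pi_2^{-1}(f(Y))$ be a smooth lift of $f$ that is linear on each fibre. Suppose that there exists at least one pair of compatible pseudo-metrics on $V_1$ and $V_2$, and that the gluing-dual commutativity condition is satisfied, via a diffeomorphism $\psi_{\cup\leftrightarrow *}$. Then the map $$\mathcal{P}:\mathcal{G}(V_1,X_1)\times_{comp}\mathcal{G}(V_2,X_2)\to\mathcal{G}(V_1\cup_{\tilde f}V_2,X_1\cup_fX_2),\qquad\mathcal{P}(g_1,g_2)=\Psi_{\cup,*}\circ\bigl(g_2\cup_{(f^{-1},\tilde f^*\otimes\tilde f^* )}g_1\bigr)\circ\varphi_{X_1\leftrightarrow X_2},$$ is smooth.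
   Context: A diffeological space is a set with a collection of maps (plots) from open subsets of the $\mathbb{R}^n$'s, containing constant maps, closed under precomposition with usual smooth maps, and satisfying the sheaf condition. A map is smooth if it carries plots to plots; a diffeomorphism is a smooth bijection with smooth inverse. Subsets, quotients, products and disjoint unions carry the subset, quotient, product and disjoint union diffeologies. $C^\infty(X,Z)$ carries the functional diffeology: $p:U\to C^\infty(X,Z)$ is a plot iff for every plot $q:U'\to X$ the map $(u,u')\mapsto p(u)(q(u'))$ is a plot of $Z$. A diffeological vector pseudo-bundle is a smooth surjection $\pi:V\to X$ with real vector space structures on fibres such that fibrewise addition $V\times_XV\to V$, scalar multiplication $\mathbb{R}\times V\to V$ and the zero section are smooth. Gluing: $X_1\cup_fX_2=(X_1\sqcup X_2)/\sim$, $\sim$ generated by $y\sim f(y)$ for $y\in Y$, with the quotient diffeology; likewise $V_1\cup_{\tilde f}V_2$, and the induced projection $\pi_1\cup_{(\tilde f,f)}\pi_2:V_1\cup_{\tilde f}V_2\to X_1\cup_fX_2$ is a pseudo-bundle. Dual pseudo-bundle $\pi^*:V^*\to X$: $V^*=\bigcup_x(\pi^{-1}(x))^*$, with $(\pi^{-1}(x))^*$ the space of smooth linear maps $\pi^{-1}(x)\to\mathbb{R}$; $p:U\to V^*$ is a plot iff for every plot $q:U'\to V$ the map $(u,u')\mapsto p(u)(q(u'))$ on $\{\pi^*(p(u))=\pi(q(u'))\}\subset U\times U'$ is smooth for the subset diffeology. Tensor products of pseudo-bundles are fibrewise, with the smallest pseudo-bundle diffeology making $V\times_XV'\to V\otimes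 V'$ smooth. Elements of $V^*\otimes V^*$ are regarded as bilinear forms on fibres of $V$. Pseudo-metric on $\pi:V\to X$: a smooth section $g:X\to V^*\otimes V^*$ such that each $g(x)$ is symmetric, positive semi-definite, of rank $\dim((\pi^{-1}(x))^* )$. $\mathcal{G}(V,X)$ is the set of all pseudo-metrics, with the (subset diffeology of the) functional diffeology of $C^\infty(X,V^*\otimes V^* )$. Pseudo-metrics $g_1,g_2$ are compatible if $g_1(y)(v_1,v_2)=g_2(f(y))(\tilde f(v_1),\tilde f(v_2))$ for all $y\in Y$, $v_1,v_2\in\pi_1^{-1}(y)$. $\mathcal{G}(V_1,X_1)\times_{comp}\mathcal{G}(V_2,X_2)$ is the set of compatible pairs, with the subset diffeology from the product diffeology. The switch map $\varphi_{X_1\leftrightarrow X_2}:X_1\cup_fX_2\to X_2\cup_{f^{-1}}X_1$ is the diffeomorphism sending the class of each point of $X_1$ or $X_2$ to the class of the same point. $\tilde f^*$ sends $\ell\in(\pi_2^{-1}(f(y)))^*$ to $\ell\circ\tilde f|_{\pi_1^{-1}(y)}$, and $V_2^*\cup_{\tilde f^*}V_1^*$ is the gluing of $V_2^*$ to $V_1^*$ along $(\tilde f^*,f^{-1})$. The gluing-dual commutativity condition says that there is a (fibrewise linear) diffeomorphism $\psi_{\cup\leftrightarrow *}:(V_1\cup_{\tilde f}V_2)^*\to V_2^*\cup_{\tilde f^*}V_1^*$ covering $\varphi_{X_1\leftrightarrow X_2}$. $g_2\cup_{(f^{-1},\tilde f^*\otimes\tilde f^* )}g_1:X_2\cup_{f^{-1}}X_1\to(V_2^*\otimes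 V_2^* )\cup_{\tilde f^*\otimes\tilde f^*}(V_1^*\otimes V_1^* )$ sends the class of $x\in X_2\setminus f(Y)$ to the class of $g_2(x)$ and the class of $x\in X_1$ to the class of $g_1(x)$. $\Psi_{\cup,*}:(V_2^*\otimes V_2^* )\cup_{\tilde f^*\otimes\tilde f^*}(V_1^*\otimes V_1^* )\to(V_1\cup_{\tilde f}V_2)^*\otimes(V_1\cup_{\tilde f}V_2)^*$ is the canonical fibrewise identification of its domain with $(V_2^*\cup_{\tilde f^*}V_1^* )\otimes(V_2^*\cup_{\tilde f^*}V_1^* )$ (a diffeomorphism) followed by $\psi_{\cup\leftrightarrow *}^{-1}\otimes\psi_{\cup\leftrightarrow *}^{-1}$. It is known that under these assumptions $\mathcal{P}(g_1,g_2)$ is a pseudo-metric on the glued pseudo-bundle.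
   Formalization: Plots of the dual V* are additionally required to project to plots of X; by the evaluation condition alone, zero functionals over arbitrary base points form a plot, so π* would not be smooth and V*⊗V* would be undefined unless X is coarse. *)

theory Defs
  imports
    "HOL-Analysis.Analysis"
    "HOL-Algebra.Module"
    "HOL-Library.Function_Algebras"
begin

section \<open>Smooth maps between open subsets of the Euclidean spaces\<close>

text \<open>
  A point of $R^n$ is a function on the naturals vanishing at all indices from \<open>n\<close> on, so that
  \<open>n\<close> can be quantified over; the topology is the library's \<^const>\<open>Euclidean_space\<close>.
\<close>

type_synonym pt = "nat \<Rightarrow> real"

primrec Ck_real :: "nat \<Rightarrow> pt set \<Rightarrow> nat \<Rightarrow> (pt \<Rightarrow> real) \<Rightarrow> bool" where
  "Ck_real n U 0 h \<longleftrightarrow> continuous_map (subtopology (Euclidean_space n) U) euclideanreal h"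
| "Ck_real n U (Suc k) h \<longleftrightarrow>
     continuous_map (subtopology (Euclidean_space n) U) euclideanreal h \<and>
     (\<forall>i<n. \<exists>D. (\<forall>u\<in>U. ((\<lambda>t. h (u(i := t))) has_real_derivative D u) (at (u i)))
               \<and> Ck_real n U k D)"

definition smooth_real :: "nat \<Rightarrow> pt set \<Rightarrow> (pt \<Rightarrow> real) \<Rightarrow> bool" where
  "smooth_real n U h \<longleftrightarrow> (\<forall>k. Ck_real n U k h)"

definition smooth_eucl :: "nat \<Rightarrow> pt set \<Rightarrow> nat \<Rightarrow> pt set \<Rightarrow> (pt \<Rightarrow> pt) \<Rightarrow> bool" where
  "smooth_eucl m W n U h \<longleftrightarrow> h ` W \<subseteq> U \<and> (\<forall>j<n. smooth_real m W (\<lambda>w. h w j))"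

text \<open>The two components of a point of $R^{n+m} = R^n \times R^m$.\<close>

definition fst_part :: "nat \<Rightarrow> pt \<Rightarrow> pt" where
  "fst_part n w = (\<lambda>i. if i < n then w i else 0)"

definition snd_part :: "nat \<Rightarrow> pt \<Rightarrow> pt" where
  "snd_part n w = (\<lambda>i. w (n + i))"

definition dom_prod :: "nat \<Rightarrow> pt set \<Rightarrow> nat \<Rightarrow> pt set \<Rightarrow> pt set" where
  "dom_prod n U m U' =
     {w \<in> topspace (Euclidean_space (n + m)). fst_part n w \<in> U \<and> snd_part n w \<in> U'}"


section \<open>Diffeological spaces\<close>

text \<open>
  A plot $p : U \to X$ with $U$ open in $R^n$ is recorded as the triple \<open>(n, U, p)\<close>. Since \<open>p\<close> is
  a total function, the set of plots is required to be insensitive to the values outside \<open>U\<close>.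
\<close>

record 'a diff_space =
  points :: "'a set"
  plots :: "(nat \<times> pt set \<times> (pt \<Rightarrow> 'a)) set"

definition diffeological_space :: "'a diff_space \<Rightarrow> bool" where
  "diffeological_space X \<longleftrightarrow>
     (\<forall>n U p. (n, U, p) \<in> plots X \<longrightarrow> openin (Euclidean_space n) U \<and> p ` U \<subseteq> points X) \<and>
     (\<forall>n U p q. (n, U, p) \<in> plots X \<longrightarrow> (\<forall>u\<in>U. q u = p u) \<longrightarrow> (n, U, q) \<in> plots X) \<and>
     (\<forall>n U c. openin (Euclidean_space n) U \<longrightarrow> c \<in> points X \<longrightarrow> (n, U, \<lambda>_. c) \<in> plots X) \<and>
     (\<forall>n U p m W h. (n, U, p) \<in> plots X \<longrightarrow> openin (Euclidean_space m) W \<longrightarrow>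
         smooth_eucl m W n U h \<longrightarrow> (m, W, p \<circ> h) \<in> plots X) \<and>
     (\<forall>n U p. openin (Euclidean_space n) U \<longrightarrow>
         (\<forall>u\<in>U. \<exists>W. u \<in> W \<and> W \<subseteq> U \<and> openin (Euclidean_space n) W \<and> (n, W, p) \<in> plots X) \<longrightarrow>
         (n, U, p) \<in> plots X)"

definition smooth_map :: "'a diff_space \<Rightarrow> 'b diff_space \<Rightarrow> ('a \<Rightarrow> 'b) \<Rightarrow> bool" where
  "smooth_map X Z h \<longleftrightarrow>
     h ` points X \<subseteq> points Z \<and>
     (\<forall>n U p. (n, U, p) \<in> plots X \<longrightarrow> (n, U, h \<circ> p) \<in> plots Z)"

definition diffeomorphism :: "'a diff_space \<Rightarrow> 'b diff_space \<Rightarrow> ('a \<Rightarrow> 'b) \<Rightarrow> bool" where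
  "diffeomorphism X Z h \<longleftrightarrow>
     bij_betw h (points X) (points Z) \<and> smooth_map X Z h \<and>
     smooth_map Z X (inv_into (points X) h)"

definition eucl_diff :: "nat \<Rightarrow> pt diff_space" where
  "eucl_diff n = \<lparr>points = topspace (Euclidean_space n),
     plots = {(m, U, p). openin (Euclidean_space m) U \<and>
                         smooth_eucl m U n (topspace (Euclidean_space n)) p}\<rparr>"

definition real_diff :: "real diff_space" where
  "real_diff = \<lparr>points = UNIV,
     plots = {(n, U, p). openin (Euclidean_space n) U \<and> smooth_real n U p}\<rparr>"

definition sub_diff :: "'a diff_space \<Rightarrow> 'a set \<Rightarrow> 'a diff_space" where
  "sub_diff X S = \<lparr>points = points X \<inter> S, plots = {(n, U, p) \<in> plots X. p ` U \<subseteq> S}\<rparr>"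

definition prod_diff :: "'a diff_space \<Rightarrow> 'b diff_space \<Rightarrow> ('a \<times> 'b) diff_space" where
  "prod_diff X Z = \<lparr>points = points X \<times> points Z,
     plots = {(n, U, p). (n, U, fst \<circ> p) \<in> plots X \<and> (n, U, snd \<circ> p) \<in> plots Z}\<rparr>"

definition sum_diff :: "'a diff_space \<Rightarrow> 'b diff_space \<Rightarrow> ('a + 'b) diff_space" where
  "sum_diff X Z = \<lparr>points = points X <+> points Z,
     plots = {(n, U, p). openin (Euclidean_space n) U \<and>
       (\<forall>u\<in>U. \<exists>W. u \<in> W \<and> W \<subseteq> U \<and> openin (Euclidean_space n) W \<and>
          ((\<exists>q. (n, W, q) \<in> plots X \<and> (\<forall>w\<in>W. p w = Inl (q w))) \<or>
           (\<exists>q. (n, W, q) \<in> plots Z \<and> (\<forall>w\<in>W. p w = Inr (q w)))))}\<rparr>"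

definition quot_diff :: "'a diff_space \<Rightarrow> ('a \<times> 'a) set \<Rightarrow> 'a set diff_space" where
  "quot_diff X r = \<lparr>points = points X // r,
     plots = {(n, U, p). openin (Euclidean_space n) U \<and>
       (\<forall>u\<in>U. \<exists>W q. u \<in> W \<and> W \<subseteq> U \<and> openin (Euclidean_space n) W \<and>
          (n, W, q) \<in> plots X \<and> (\<forall>w\<in>W. p w = r `` {q w}))}\<rparr>"

text \<open>Maps on \<open>X\<close> are represented by extensional functions on \<open>points X\<close>.\<close>

definition fun_diff :: "'a diff_space \<Rightarrow> 'b diff_space \<Rightarrow> ('a \<Rightarrow> 'b) diff_space" where
  "fun_diff X Z =
     (let C = {h \<in> points X \<rightarrow>\<^sub>E points Z. smooth_map X Z h} in
      \<lparr>points = C,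
       plots = {(n, U, p). openin (Euclidean_space n) U \<and> p ` U \<subseteq> C \<and>
         (\<forall>m U' q. (m, U', q) \<in> plots X \<longrightarrow>
            (n + m, dom_prod n U m U', \<lambda>w. p (fst_part n w) (q (snd_part n w))) \<in> plots Z)}\<rparr>)"


section \<open>Diffeological vector pseudo-bundles\<close>

record ('v, 'x) pbundle =
  total :: "'v diff_space"
  base :: "'x diff_space"
  proj :: "'v \<Rightarrow> 'x"
  vadd :: "'v \<Rightarrow> 'v \<Rightarrow> 'v"
  vscale :: "real \<Rightarrow> 'v \<Rightarrow> 'v"
  vzero :: "'x \<Rightarrow> 'v"

definition fib :: "('v, 'x) pbundle \<Rightarrow> 'x \<Rightarrow> 'v set" where
  "fib E x = {v \<in> points (total E). proj E v = x}"

definition over :: "('v, 'x) pbundle \<Rightarrow> 'x set \<Rightarrow> 'v set" where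
  "over E S = {v \<in> points (total E). proj E v \<in> S}"

definition real_ring :: "real ring" where
  "real_ring = \<lparr>carrier = UNIV, monoid.mult = (*), one = 1, zero = 0, add = (+)\<rparr>"

text \<open>The multiplicative fields play no role in a module.\<close>

definition fibre_module :: "('v, 'x) pbundle \<Rightarrow> 'x \<Rightarrow> (real, 'v) module" where
  "fibre_module E x = \<lparr>carrier = fib E x, monoid.mult = undefined, one = undefined,
     zero = vzero E x, add = vadd E, smult = vscale E\<rparr>"

definition finite_dim :: "(real, 'v) module \<Rightarrow> bool" where
  "finite_dim M \<longleftrightarrow> (\<exists>B. finite B \<and> B \<subseteq> carrier M \<and>
     (\<forall>v\<in>carrier M. \<exists>c. v = finsum M (\<lambda>b. smult M (c b) b) B))"

definition fibre_prod ::
    "('v, 'x) pbundle \<Rightarrow> ('w, 'x) pbundle \<Rightarrow> ('v \<times> 'w) diff_space" where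
  "fibre_prod E F = sub_diff (prod_diff (total E) (total F)) {(v, w). proj E v = proj F w}"

definition pseudo_bundle :: "('v, 'x) pbundle \<Rightarrow> bool" where
  "pseudo_bundle E \<longleftrightarrow>
     diffeological_space (total E) \<and> diffeological_space (base E) \<and>
     smooth_map (total E) (base E) (proj E) \<and>
     proj E ` points (total E) = points (base E) \<and>
     (\<forall>x\<in>points (base E). Module.module real_ring (fibre_module E x)) \<and>
     smooth_map (fibre_prod E E) (total E) (\<lambda>(v, w). vadd E v w) \<and>
     smooth_map (prod_diff real_diff (total E)) (total E) (\<lambda>(c, v). vscale E c v) \<and>
     smooth_map (base E) (total E) (vzero E)"

definition finite_dim_pseudo_bundle :: "('v, 'x) pbundle \<Rightarrow> bool" where
  "finite_dim_pseudo_bundle E \<longleftrightarrow>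
     pseudo_bundle E \<and> (\<forall>x\<in>points (base E). finite_dim (fibre_module E x))"

definition fibrewise_linear ::
    "('v, 'x) pbundle \<Rightarrow> ('w, 'y) pbundle \<Rightarrow> 'x set \<Rightarrow> ('v \<Rightarrow> 'w) \<Rightarrow> bool" where
  "fibrewise_linear E F S h \<longleftrightarrow>
     (\<forall>x\<in>S. \<forall>v\<in>fib E x. \<forall>w\<in>fib E x. h (vadd E v w) = vadd F (h v) (h w)) \<and>
     (\<forall>x\<in>S. \<forall>c. \<forall>v\<in>fib E x. h (vscale E c v) = vscale F c (h v))"

definition smooth_linear_lift ::
    "('v, 'x) pbundle \<Rightarrow> ('w, 'y) pbundle \<Rightarrow> 'x set \<Rightarrow> ('x \<Rightarrow> 'y) \<Rightarrow> ('v \<Rightarrow> 'w) \<Rightarrow> bool" where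
  "smooth_linear_lift E F Y f h \<longleftrightarrow>
     smooth_map (sub_diff (total E) (over E Y)) (sub_diff (total F) (over F (f ` Y))) h \<and>
     (\<forall>v\<in>over E Y. proj F (h v) = f (proj E v)) \<and>
     fibrewise_linear E F Y h"


section \<open>Gluing\<close>

definition glue_rel ::
    "'a diff_space \<Rightarrow> 'b diff_space \<Rightarrow> 'a set \<Rightarrow> ('a \<Rightarrow> 'b) \<Rightarrow> (('a + 'b) \<times> ('a + 'b)) set" where
  "glue_rel X1 X2 Y f =
     (let R = {(Inl y, Inr (f y)) | y. y \<in> Y}; S = points X1 <+> points X2
      in (R \<union> R\<inverse>)\<^sup>* \<inter> (S \<times> S))"

definition glue ::
    "'a diff_space \<Rightarrow> 'b diff_space \<Rightarrow> 'a set \<Rightarrow> ('a \<Rightarrow> 'b) \<Rightarrow> ('a + 'b) set diff_space" where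
  "glue X1 X2 Y f = quot_diff (sum_diff X1 X2) (glue_rel X1 X2 Y f)"

definition glue_class ::
    "'a diff_space \<Rightarrow> 'b diff_space \<Rightarrow> 'a set \<Rightarrow> ('a \<Rightarrow> 'b) \<Rightarrow> 'a + 'b \<Rightarrow> ('a + 'b) set" where
  "glue_class X1 X2 Y f a = glue_rel X1 X2 Y f `` {a}"

fun sum_vadd :: "('v, 'x) pbundle \<Rightarrow> ('w, 'y) pbundle \<Rightarrow> 'v + 'w \<Rightarrow> 'v + 'w \<Rightarrow> 'v + 'w" where
  "sum_vadd E1 E2 (Inl v) (Inl w) = Inl (vadd E1 v w)"
| "sum_vadd E1 E2 (Inr v) (Inr w) = Inr (vadd E2 v w)"
| "sum_vadd E1 E2 _ _ = undefined"

text \<open>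
  The maps below are induced on classes from the disjoint union; \<^const>\<open>the_elem\<close> picks the
  common value taken on all representatives. Two classes are added through any representatives
  that lie in a common fibre of the disjoint union of the bundles.
\<close>

definition glue_bundle ::
    "('v, 'x) pbundle \<Rightarrow> ('w, 'y) pbundle \<Rightarrow> 'x set \<Rightarrow> ('x \<Rightarrow> 'y) \<Rightarrow> ('v \<Rightarrow> 'w) \<Rightarrow>
     (('v + 'w) set, ('x + 'y) set) pbundle" where
  "glue_bundle E1 E2 Y f h =
     (let clV = glue_class (total E1) (total E2) (over E1 Y) h;
          clX = glue_class (base E1) (base E2) Y f;
          pr = map_sum (proj E1) (proj E2)
      in \<lparr>total = glue (total E1) (total E2) (over E1 Y) h,
          base = glue (base E1) (base E2) Y f,
          proj = (\<lambda>A. the_elem ((\<lambda>a. clX (pr a)) ` A)),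
          vadd = (\<lambda>A B. the_elem {clV (sum_vadd E1 E2 a b) | a b. a \<in> A \<and> b \<in> B \<and> pr a = pr b}),
          vscale = (\<lambda>c A. the_elem ((\<lambda>a. clV (map_sum (vscale E1 c) (vscale E2 c) a)) ` A)),
          vzero = (\<lambda>A. the_elem ((\<lambda>a. clV (map_sum (vzero E1) (vzero E2) a)) ` A))\<rparr>)"

text \<open>\<open>X1 \<union>\<^sub>f X2 \<rightarrow> X2 \<union> X1\<close>, the latter glued along the inverse of \<open>f\<close>.\<close>

definition switch_map ::
    "'x diff_space \<Rightarrow> 'y diff_space \<Rightarrow> 'x set \<Rightarrow> ('x \<Rightarrow> 'y) \<Rightarrow> ('x + 'y) set \<Rightarrow> ('y + 'x) set" where
  "switch_map X1 X2 Y f A =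
     the_elem ((\<lambda>a. glue_class X2 X1 (f ` Y) (inv_into Y f) (case_sum Inr Inl a)) ` A)"

text \<open>
  The section of a glued bundle given by \<open>s2\<close> on all of the second base and by \<open>s1\<close> on the rest
  of the first base.
\<close>

definition glue_section ::
    "('v, 'x) pbundle \<Rightarrow> ('w, 'y) pbundle \<Rightarrow> 'x set \<Rightarrow> ('v \<Rightarrow> 'w) \<Rightarrow>
     ('x \<Rightarrow> 'v) \<Rightarrow> ('y \<Rightarrow> 'w) \<Rightarrow> ('x + 'y) set \<Rightarrow> ('v + 'w) set" where
  "glue_section E1 E2 Y h s1 s2 A =
     glue_class (total E1) (total E2) (over E1 Y) h
       (if \<exists>x. Inr x \<in> A then Inr (s2 (THE x. Inr x \<in> A)) else Inl (s1 (THE x. Inl x \<in> A)))"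


section \<open>Dual pseudo-bundle\<close>

instantiation "fun" :: (type, real_vector) real_vector
begin

definition scaleR_fun :: "real \<Rightarrow> ('a \<Rightarrow> 'b) \<Rightarrow> 'a \<Rightarrow> 'b" where
  "scaleR_fun c h = (\<lambda>x. c *\<^sub>R h x)"

instance
  by standard (simp_all add: scaleR_fun_def fun_eq_iff algebra_simps)

end

text \<open>Functionals on a fibre are extended by 0 outside it.\<close>

definition dual_fib :: "('v, 'x) pbundle \<Rightarrow> 'x \<Rightarrow> ('v \<Rightarrow> real) set" where
  "dual_fib E x = {l. (\<forall>v. v \<notin> fib E x \<longrightarrow> l v = 0) \<and>
     (\<forall>v\<in>fib E x. \<forall>w\<in>fib E x. l (vadd E v w) = l v + l w) \<and>
     (\<forall>c. \<forall>v\<in>fib E x. l (vscale E c v) = c * l v) \<and>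
     smooth_map (sub_diff (total E) (fib E x)) real_diff l}"

type_synonym ('v, 'x) dual_pt = "'x \<times> ('v \<Rightarrow> real)"

text \<open>
  An element of the dual is a functional together with its base point. A plot \<open>p\<close> of the dual is
  required to project to a plot of the base. The evaluation condition does not imply this (it is
  empty for a family of zero functionals over arbitrary points), and without it the projection of
  the dual would not be smooth, so the dual would not be a pseudo-bundle.
\<close>

definition dual :: "('v, 'x) pbundle \<Rightarrow> (('v, 'x) dual_pt, 'x) pbundle" where
  "dual E =
     (let T = Sigma (points (base E)) (dual_fib E) in
      \<lparr>total = \<lparr>points = T,
         plots = {(n, U, p). openin (Euclidean_space n) U \<and> p ` U \<subseteq> T \<and>
           (n, U, fst \<circ> p) \<in> plots (base E) \<and>
           (\<forall>m U' q. (m, U', q) \<in> plots (total E) \<longrightarrow>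
              smooth_map
                (sub_diff (eucl_diff (n + m))
                  {w \<in> dom_prod n U m U'. fst (p (fst_part n w)) = proj E (q (snd_part n w))})
                real_diff
                (\<lambda>w. snd (p (fst_part n w)) (q (snd_part n w))))}\<rparr>,
       base = base E,
       proj = fst,
       vadd = (\<lambda>(x, l) (y, l'). (x, l + l')),
       vscale = (\<lambda>c (x, l). (x, c *\<^sub>R l)),
       vzero = (\<lambda>x. (x, 0))\<rparr>)"

definition dual_map ::
    "('v, 'x) pbundle \<Rightarrow> 'x set \<Rightarrow> ('x \<Rightarrow> 'y) \<Rightarrow> ('v \<Rightarrow> 'w) \<Rightarrow>
     ('w, 'y) dual_pt \<Rightarrow> ('v, 'x) dual_pt" where
  "dual_map E1 Y f h = (\<lambda>(z, l). let y = inv_into Y f z in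
     (y, \<lambda>v. if v \<in> fib E1 y then l (h v) else 0))"


section \<open>Tensor product of pseudo-bundles\<close>

text \<open>
  The tensor product of vector spaces $A$ and $B$ is realised inside the dual of the space of
  bilinear forms on $A \times B$, as the span of the evaluations
  $a \otimes b = (\beta \mapsto \beta(a, b))$. Bilinear forms are extended by 0.
\<close>

definition bilin :: "('v, 'x) pbundle \<Rightarrow> ('w, 'x) pbundle \<Rightarrow> 'x \<Rightarrow> ('v \<Rightarrow> 'w \<Rightarrow> real) set" where
  "bilin E F x = {b. (\<forall>v w. v \<notin> fib E x \<or> w \<notin> fib F x \<longrightarrow> b v w = 0) \<and>
     (\<forall>v\<in>fib E x. \<forall>v'\<in>fib E x. \<forall>w\<in>fib F x. b (vadd E v v') w = b v w + b v' w) \<and>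
     (\<forall>v\<in>fib E x. \<forall>w\<in>fib F x. \<forall>w'\<in>fib F x. b v (vadd F w w') = b v w + b v w') \<and>
     (\<forall>c. \<forall>v\<in>fib E x. \<forall>w\<in>fib F x.
        b (vscale E c v) w = c * b v w \<and> b v (vscale F c w) = c * b v w)}"

type_synonym ('v, 'w) tens = "('v \<Rightarrow> 'w \<Rightarrow> real) \<Rightarrow> real"

definition pure_tensor ::
    "('v, 'x) pbundle \<Rightarrow> ('w, 'x) pbundle \<Rightarrow> 'x \<Rightarrow> 'v \<Rightarrow> 'w \<Rightarrow> ('v, 'w) tens" where
  "pure_tensor E F x v w = (\<lambda>b. if b \<in> bilin E F x then b v w else 0)"

definition tensor_fib :: "('v, 'x) pbundle \<Rightarrow> ('w, 'x) pbundle \<Rightarrow> 'x \<Rightarrow> ('v, 'w) tens set" where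
  "tensor_fib E F x = span {pure_tensor E F x v w | v w. v \<in> fib E x \<and> w \<in> fib F x}"

definition tensor_with ::
    "('v, 'x) pbundle \<Rightarrow> ('w, 'x) pbundle \<Rightarrow> (nat \<times> pt set \<times> (pt \<Rightarrow> 'x \<times> ('v, 'w) tens)) set \<Rightarrow>
     ('x \<times> ('v, 'w) tens, 'x) pbundle" where
  "tensor_with E F D =
     \<lparr>total = \<lparr>points = Sigma (points (base E)) (tensor_fib E F), plots = D\<rparr>,
      base = base E,
      proj = fst,
      vadd = (\<lambda>(x, t) (y, t'). (x, t + t')),
      vscale = (\<lambda>c (x, t). (x, c *\<^sub>R t)),
      vzero = (\<lambda>x. (x, 0))\<rparr>"

text \<open>
  The smallest pseudo-bundle diffeology making \<open>(v, w) \<mapsto> v \<otimes> w\<close> smooth, as the intersection of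
  all of them.
\<close>

definition tensor ::
    "('v, 'x) pbundle \<Rightarrow> ('w, 'x) pbundle \<Rightarrow> ('x \<times> ('v, 'w) tens, 'x) pbundle" where
  "tensor E F = tensor_with E F
     (\<Inter>{D. pseudo_bundle (tensor_with E F D) \<and>
          smooth_map (fibre_prod E F) (total (tensor_with E F D))
            (\<lambda>(v, w). (proj E v, pure_tensor E F (proj E v) v w))})"

text \<open>
  The tensor product \<open>h \<otimes> k\<close> of two fibrewise linear maps over \<open>\<phi>\<close>, sending \<open>v \<otimes> w\<close> to
  \<open>h v \<otimes> k w\<close>: a functional on bilinear forms is composed with the pullback of forms.
\<close>

definition tensor_map ::
    "('v, 'x) pbundle \<Rightarrow> ('w, 'x) pbundle \<Rightarrow> ('v', 'y) pbundle \<Rightarrow> ('w', 'y) pbundle \<Rightarrow>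
     ('x \<Rightarrow> 'y) \<Rightarrow> ('v \<Rightarrow> 'v') \<Rightarrow> ('w \<Rightarrow> 'w') \<Rightarrow> 'x \<times> ('v, 'w) tens \<Rightarrow> 'y \<times> ('v', 'w') tens" where
  "tensor_map E F E' F' \<phi> h k = (\<lambda>(x, t). (\<phi> x, \<lambda>b.
     if b \<in> bilin E' F' (\<phi> x)
     then t (\<lambda>v w. if v \<in> fib E x \<and> w \<in> fib F x then b (h v) (k w) else 0)
     else 0))"

abbreviation dual_sq ::
    "('v, 'x) pbundle \<Rightarrow> ('x \<times> (('v, 'x) dual_pt, ('v, 'x) dual_pt) tens, 'x) pbundle" where
  "dual_sq E \<equiv> tensor (dual E) (dual E)"

text \<open>
  An element of \<open>V\<^sup>* \<otimes> V\<^sup>*\<close> as a bilinear form on a fibre of \<open>V\<close>: the image of \<open>\<alpha> \<otimes> \<beta>\<close> is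
  \<open>(v, w) \<mapsto> \<alpha> v * \<beta> w\<close>.
\<close>

definition form_of ::
    "('v, 'x) pbundle \<Rightarrow> 'x \<times> (('v, 'x) dual_pt, ('v, 'x) dual_pt) tens \<Rightarrow> 'v \<Rightarrow> 'v \<Rightarrow> real" where
  "form_of E = (\<lambda>(x, t) v w. t (\<lambda>\<alpha> \<beta>.
     if \<alpha> \<in> fib (dual E) x \<and> \<beta> \<in> fib (dual E) x then snd \<alpha> v * snd \<beta> w else 0))"


section \<open>Pseudo-metrics\<close>

text \<open>The rank of a bilinear form \<open>b\<close> on \<open>S\<close> is the dimension of the image of \<open>v \<mapsto> b v\<close>.\<close>

definition form_rank :: "'v set \<Rightarrow> ('v \<Rightarrow> 'v \<Rightarrow> real) \<Rightarrow> nat" where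
  "form_rank S b = dim ((\<lambda>v w. if w \<in> S then b v w else 0) ` S)"

definition pseudo_metrics ::
    "('v, 'x) pbundle \<Rightarrow> ('x \<Rightarrow> 'x \<times> (('v, 'x) dual_pt, ('v, 'x) dual_pt) tens) set" where
  "pseudo_metrics E = {g \<in> points (fun_diff (base E) (total (dual_sq E))).
     \<forall>x\<in>points (base E).
       proj (dual_sq E) (g x) = x \<and>
       (\<forall>v\<in>fib E x. \<forall>w\<in>fib E x. form_of E (g x) v w = form_of E (g x) w v) \<and>
       (\<forall>v\<in>fib E x. form_of E (g x) v v \<ge> 0) \<and>
       form_rank (fib E x) (form_of E (g x)) = dim (dual_fib E x)}"

definition metric_diff ::
    "('v, 'x) pbundle \<Rightarrow> ('x \<Rightarrow> 'x \<times> (('v, 'x) dual_pt, ('v, 'x) dual_pt) tens) diff_space" where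
  "metric_diff E = sub_diff (fun_diff (base E) (total (dual_sq E))) (pseudo_metrics E)"

definition compatible where
  "compatible E1 E2 Y f h g1 g2 \<longleftrightarrow>
     (\<forall>y\<in>Y. \<forall>v\<in>fib E1 y. \<forall>w\<in>fib E1 y.
        form_of E1 (g1 y) v w = form_of E2 (g2 (f y)) (h v) (h w))"

definition comp_metric_diff where
  "comp_metric_diff E1 E2 Y f h =
     sub_diff (prod_diff (metric_diff E1) (metric_diff E2)) {(g1, g2). compatible E1 E2 Y f h g1 g2}"


section \<open>The induced map on pseudo-metrics\<close>

definition glued_duals ::
    "('v, 'x) pbundle \<Rightarrow> ('w, 'y) pbundle \<Rightarrow> 'x set \<Rightarrow> ('x \<Rightarrow> 'y) \<Rightarrow> ('v \<Rightarrow> 'w) \<Rightarrow>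
     ((('w, 'y) dual_pt + ('v, 'x) dual_pt) set, ('y + 'x) set) pbundle" where
  "glued_duals E1 E2 Y f h =
     glue_bundle (dual E2) (dual E1) (f ` Y) (inv_into Y f) (dual_map E1 Y f h)"

definition gluing_dual_commutativity where
  "gluing_dual_commutativity E1 E2 Y f h \<psi> \<longleftrightarrow>
     (let D = dual (glue_bundle E1 E2 Y f h); G = glued_duals E1 E2 Y f h in
        diffeomorphism (total D) (total G) \<psi> \<and>
        (\<forall>a\<in>points (total D).
           proj G (\<psi> a) = switch_map (base E1) (base E2) Y f (proj D a)) \<and>
        fibrewise_linear D G (points (base D)) \<psi>)"

definition dual_map_sq where
  "dual_map_sq E1 E2 Y f h =
     tensor_map (dual E2) (dual E2) (dual E1) (dual E1) (inv_into Y f)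
       (dual_map E1 Y f h) (dual_map E1 Y f h)"

text \<open>
  The canonical identification of \<open>(V2\<^sup>* \<otimes> V2\<^sup>*) \<union> (V1\<^sup>* \<otimes> V1\<^sup>*)\<close> with
  \<open>(V2\<^sup>* \<union> V1\<^sup>*) \<otimes> (V2\<^sup>* \<union> V1\<^sup>*)\<close>: on each summand it is \<open>i \<otimes> i\<close>, where \<open>i\<close> sends an element of
  \<open>V2\<^sup>*\<close> or \<open>V1\<^sup>*\<close> to its class.
\<close>

definition glue_tensor_id where
  "glue_tensor_id E1 E2 Y f h A =
     (let G = glued_duals E1 E2 Y f h;
          clX = glue_class (base E2) (base E1) (f ` Y) (inv_into Y f);
          clD = glue_class (total (dual E2)) (total (dual E1)) (over (dual E2) (f ` Y))
                  (dual_map E1 Y f h);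
          i2 = (\<lambda>a. clD (Inl a));
          i1 = (\<lambda>a. clD (Inr a))
      in the_elem (case_sum
           (tensor_map (dual E2) (dual E2) G G (\<lambda>x. clX (Inl x)) i2 i2)
           (tensor_map (dual E1) (dual E1) G G (\<lambda>x. clX (Inr x)) i1 i1) ` A))"

definition Psi_map where
  "Psi_map E1 E2 Y f h \<psi> =
     (let D = dual (glue_bundle E1 E2 Y f h); G = glued_duals E1 E2 Y f h;
          \<phi> = switch_map (base E1) (base E2) Y f;
          \<psi>inv = inv_into (points (total D)) \<psi>
      in tensor_map G G D D (inv_into (points (glue (base E1) (base E2) Y f)) \<phi>) \<psi>inv \<psi>inv
           \<circ> glue_tensor_id E1 E2 Y f h)"

definition P_map where
  "P_map E1 E2 Y f h \<psi> = (\<lambda>(g1, g2).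
     restrict
       (Psi_map E1 E2 Y f h \<psi>
        \<circ> glue_section (dual_sq E2) (dual_sq E1) (f ` Y) (dual_map_sq E1 E2 Y f h) g2 g1
        \<circ> switch_map (base E1) (base E2) Y f)
       (points (glue (base E1) (base E2) Y f)))"

end

theory Submission
  imports Defs
begin

text \<open>
  Near each parameter a plot of the glued base lifts to a plot of \<open>X\<^sub>1\<close> or of \<open>X\<^sub>2\<close>, so it suffices
  to understand \<open>\<P>(g\<^sub>1, g\<^sub>2)\<close> on each piece. Let \<open>k\<^sub>i\<close> be the canonical map of \<open>V\<^sub>i\<^sup>*\<close> to the glued dual
  followed by \<open>\<psi>\<inverse>\<close>; it is smooth and linear on fibres. Then \<open>\<P>(g\<^sub>1, g\<^sub>2)\<close> is
  \<open>(k\<^sub>i \<otimes> k\<^sub>i) \<circ> g\<^sub>i\<close> on the image of all of \<open>X\<^sub>i\<close>, for both \<open>i\<close> (\<open>P_map_\<kappa>1\<close>, \<open>P_map_\<kappa>2\<close>), and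
  a smooth family of pairs \<open>(g\<^sub>1, g\<^sub>2)\<close> is locally sent to a smooth family followed by a smooth map.

  Three facts support this. First, \<open>k \<otimes> k\<close> is smooth when \<open>k\<close> is (\<open>smooth_map_tensor_sq_map\<close>): a
  pseudo-bundle diffeology on the target square pulls back to one on the source square, and the
  tensor diffeology is the smallest of these. Second, the two descriptions agree over \<open>Y\<close>. By its
  construction \<open>\<P>(g\<^sub>1, g\<^sub>2)\<close> uses only \<open>g\<^sub>1\<close> there, whereas compatibility speaks of values on pairs
  of vectors; since fibres are finite-dimensional, an element of \<open>V\<^sup>* \<otimes> V\<^sup>*\<close> is determined by the
  bilinear form that it induces (\<open>form_of_inject\<close>), so compatibility means that
  \<open>f\<^sup>* \<otimes> f\<^sup>*\<close> carries \<open>g\<^sub>2\<close> to \<open>g\<^sub>1\<close> over \<open>Y\<close>, where \<open>f\<^sup>*\<close> is the dual of the lift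
  (\<open>compatible_tensor\<close>). Third, \<open>\<P>(g\<^sub>1, g\<^sub>2)\<close> is a pseudo-metric. As \<open>\<psi>\<close> is an arbitrary
  isomorphism, the form on a glued fibre need not be the one of \<open>g\<^sub>1\<close> or \<open>g\<^sub>2\<close>; but symmetry,
  positivity and full rank are transported by every linear isomorphism of dual fibres
  (\<open>fibre_metric_transport\<close>).
\<close>


section \<open>Smooth functions on open sets\<close>

lemma Ck_real_continuous:
  "Ck_real n U k a \<Longrightarrow> continuous_map (subtopology (Euclidean_space n) U) euclideanreal a"
  by (cases k) simp_all

lemma Ck_real_add:
  "Ck_real n U k a \<Longrightarrow> Ck_real n U k b \<Longrightarrow> Ck_real n U k (\<lambda>u. a u + b u)"
proof (induction k arbitrary: a b)
  case 0
  then show ?case by (simp add: continuous_map_add)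
next
  case (Suc k)
  have "\<exists>D. (\<forall>u\<in>U. ((\<lambda>t. a (u(i := t)) + b (u(i := t))) has_real_derivative D u) (at (u i)))
               \<and> Ck_real n U k D" if "i < n" for i
  proof -
    from Suc.prems(1) that obtain Da where
      "\<forall>u\<in>U. ((\<lambda>t. a (u(i := t))) has_real_derivative Da u) (at (u i))" "Ck_real n U k Da"
      by auto
    moreover from Suc.prems(2) that obtain Db where
      "\<forall>u\<in>U. ((\<lambda>t. b (u(i := t))) has_real_derivative Db u) (at (u i))" "Ck_real n U k Db"
      by auto
    ultimately show ?thesis
      by (intro exI[of _ "\<lambda>u. Da u + Db u"]) (auto intro!: Suc.IH DERIV_add)
  qed
  with Suc.prems show ?case by (simp add: continuous_map_add)
qed

lemma Ck_real_cmult: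
  "Ck_real n U k a \<Longrightarrow> Ck_real n U k (\<lambda>u. c * a u)"
proof (induction k arbitrary: a)
  case 0
  then show ?case by (simp add: continuous_map_real_mult_left)
next
  case (Suc k)
  have "\<exists>D. (\<forall>u\<in>U. ((\<lambda>t. c * a (u(i := t))) has_real_derivative D u) (at (u i)))
               \<and> Ck_real n U k D" if "i < n" for i
  proof -
    from Suc.prems that obtain Da where
      "\<forall>u\<in>U. ((\<lambda>t. a (u(i := t))) has_real_derivative Da u) (at (u i))" "Ck_real n U k Da"
      by auto
    then show ?thesis
      by (intro exI[of _ "\<lambda>u. c * Da u"]) (auto intro!: Suc.IH DERIV_cmult)
  qed
  with Suc.prems show ?case by (simp add: continuous_map_real_mult_left)
qed

lemma Ck_real_zero: "Ck_real n U k (\<lambda>_. 0)"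
  by (induction k) (auto intro!: exI[of _ "\<lambda>_. 0"])

lemma continuous_map_fun_upd_Euclidean:
  assumes "u \<in> topspace (Euclidean_space n)" "i < n"
  shows "continuous_map euclideanreal (Euclidean_space n) (\<lambda>t. u(i := t))"
proof -
  have "continuous_map euclideanreal (powertop_real UNIV) (\<lambda>t. u(i := t))"
    by (subst continuous_map_componentwise_UNIV) (auto simp: fun_upd_def)
  then show ?thesis
    using assms by (auto simp: Euclidean_space_def continuous_map_in_subtopology)
qed

text \<open>
  Partial derivatives at a point see only values along a coordinate line near it, and such a line
  stays in \<open>U\<close> for a while because \<open>U\<close> is open.
\<close>

lemma Ck_real_cong:
  assumes U: "openin (Euclidean_space n) U" and ab: "\<And>u. u \<in> U \<Longrightarrow> a u = b u"
    and a: "Ck_real n U k a"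
  shows "Ck_real n U k b"
proof -
  have cont: "continuous_map (subtopology (Euclidean_space n) U) euclideanreal b"
    using Ck_real_continuous[OF a] by (rule continuous_map_eq) (use ab in auto)
  have der: "((\<lambda>t. b (u(i := t))) has_real_derivative d) (at (u i))"
    if u: "u \<in> U" "i < n" and d: "((\<lambda>t. a (u(i := t))) has_real_derivative d) (at (u i))" for u i d
  proof -
    have "u \<in> topspace (Euclidean_space n)" using U u openin_subset by blast
    then have "openin euclideanreal {t \<in> topspace euclideanreal. u(i := t) \<in> U}"
      by (intro openin_continuous_map_preimage[OF continuous_map_fun_upd_Euclidean U] u)
    then have "open {t. u(i := t) \<in> U}" by simp
    from has_field_derivative_transform_within_open[OF d this] show ?thesis
      using u ab by auto
  qed
  show ?thesis
  proof (cases k)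
    case 0
    with cont show ?thesis by simp
  next
    case (Suc k')
    with a cont der show ?thesis by simp meson
  qed
qed

lemma smooth_real_zero: "smooth_real n U (\<lambda>_. 0)"
  by (simp add: smooth_real_def Ck_real_zero)

lemma smooth_real_add:
  "smooth_real n U a \<Longrightarrow> smooth_real n U b \<Longrightarrow> smooth_real n U (\<lambda>u. a u + b u)"
  by (simp add: smooth_real_def Ck_real_add)

lemma smooth_real_cmult: "smooth_real n U a \<Longrightarrow> smooth_real n U (\<lambda>u. c * a u)"
  by (simp add: smooth_real_def Ck_real_cmult)

lemma smooth_real_cong:
  "openin (Euclidean_space n) U \<Longrightarrow> (\<And>u. u \<in> U \<Longrightarrow> a u = b u) \<Longrightarrow> smooth_real n U a
    \<Longrightarrow> smooth_real n U b"
  unfolding smooth_real_def by (metis Ck_real_cong)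


section \<open>Diffeologies\<close>

lemma
  assumes "diffeological_space X" "(n, U, p) \<in> plots X"
  shows plot_openin: "openin (Euclidean_space n) U" and plot_points: "p ` U \<subseteq> points X"
proof -
  have "\<forall>n U p. (n, U, p) \<in> plots X \<longrightarrow> openin (Euclidean_space n) U \<and> p ` U \<subseteq> points X"
    using assms(1) unfolding diffeological_space_def by (elim conjE)
  with assms(2) show "openin (Euclidean_space n) U" "p ` U \<subseteq> points X" by blast+
qed

lemma plot_cong:
  assumes "diffeological_space X" "(n, U, p) \<in> plots X" "\<And>u. u \<in> U \<Longrightarrow> q u = p u"
  shows "(n, U, q) \<in> plots X"
proof -
  have "\<forall>n U p q. (n, U, p) \<in> plots X \<longrightarrow> (\<forall>u\<in>U. q u = p u) \<longrightarrow> (n, U, q) \<in> plots X"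
    using assms(1) unfolding diffeological_space_def by (elim conjE)
  with assms(2,3) show ?thesis by blast
qed

lemma plot_const:
  assumes "diffeological_space X" "openin (Euclidean_space n) U" "c \<in> points X"
  shows "(n, U, \<lambda>_. c) \<in> plots X"
proof -
  have "\<forall>n U c. openin (Euclidean_space n) U \<longrightarrow> c \<in> points X \<longrightarrow> (n, U, \<lambda>_. c) \<in> plots X"
    using assms(1) unfolding diffeological_space_def by (elim conjE)
  with assms(2,3) show ?thesis by blast
qed

lemma plot_comp:
  assumes "diffeological_space X" "(n, U, p) \<in> plots X" "openin (Euclidean_space m) W"
    "smooth_eucl m W n U k"
  shows "(m, W, p \<circ> k) \<in> plots X"
proof -
  have "\<forall>n U p m W h. (n, U, p) \<in> plots X \<longrightarrow> openin (Euclidean_space m) W \<longrightarrow>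
         smooth_eucl m W n U h \<longrightarrow> (m, W, p \<circ> h) \<in> plots X"
    using assms(1) unfolding diffeological_space_def by (elim conjE)
  with assms(2-4) show ?thesis by blast
qed

lemma plot_local:
  assumes "diffeological_space X" "openin (Euclidean_space n) U"
    "\<And>u. u \<in> U \<Longrightarrow> \<exists>W. u \<in> W \<and> W \<subseteq> U \<and> openin (Euclidean_space n) W \<and> (n, W, p) \<in> plots X"
  shows "(n, U, p) \<in> plots X"
proof -
  have "\<forall>n U p. openin (Euclidean_space n) U \<longrightarrow>
         (\<forall>u\<in>U. \<exists>W. u \<in> W \<and> W \<subseteq> U \<and> openin (Euclidean_space n) W \<and> (n, W, p) \<in> plots X) \<longrightarrow>
         (n, U, p) \<in> plots X"
    using assms(1) unfolding diffeological_space_def by (elim conjE)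
  with assms(2,3) show ?thesis by simp
qed

lemma diffeological_spaceI:
  assumes "\<And>n U p. (n, U, p) \<in> plots X \<Longrightarrow> openin (Euclidean_space n) U"
    and "\<And>n U p. (n, U, p) \<in> plots X \<Longrightarrow> p ` U \<subseteq> points X"
    and "\<And>n U p q. (n, U, p) \<in> plots X \<Longrightarrow> (\<And>u. u \<in> U \<Longrightarrow> q u = p u) \<Longrightarrow> (n, U, q) \<in> plots X"
    and "\<And>n U c. openin (Euclidean_space n) U \<Longrightarrow> c \<in> points X \<Longrightarrow> (n, U, \<lambda>_. c) \<in> plots X"
    and "\<And>n U p m W k. (n, U, p) \<in> plots X \<Longrightarrow> openin (Euclidean_space m) W
      \<Longrightarrow> smooth_eucl m W n U k \<Longrightarrow> (m, W, p \<circ> k) \<in> plots X"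
    and "\<And>n U p. openin (Euclidean_space n) U
      \<Longrightarrow> (\<And>u. u \<in> U \<Longrightarrow> \<exists>W. u \<in> W \<and> W \<subseteq> U \<and> openin (Euclidean_space n) W \<and> (n, W, p) \<in> plots X)
      \<Longrightarrow> (n, U, p) \<in> plots X"
  shows "diffeological_space X"
  unfolding diffeological_space_def
  by (intro conjI allI impI) (rule assms; simp; fail)+

text \<open>
  Unfolding the quotient and the disjoint union diffeology in turn shrinks the neighbourhood twice.
  Smoothness on a glued space is reduced to its two pieces through this lemma.
\<close>

lemma glue_plot_lift:
  assumes "(n, U, p) \<in> plots (glue X1 X2 Y f)" "u \<in> U"
  obtains W q where "u \<in> W" "W \<subseteq> U" "openin (Euclidean_space n) W" "(n, W, q) \<in> plots X1"
      "\<And>w. w \<in> W \<Longrightarrow> p w = glue_class X1 X2 Y f (Inl (q w))"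
  | W q where "u \<in> W" "W \<subseteq> U" "openin (Euclidean_space n) W" "(n, W, q) \<in> plots X2"
      "\<And>w. w \<in> W \<Longrightarrow> p w = glue_class X1 X2 Y f (Inr (q w))"
proof -
  have "\<forall>u\<in>U. \<exists>W q. u \<in> W \<and> W \<subseteq> U \<and> openin (Euclidean_space n) W \<and>
      (n, W, q) \<in> plots (sum_diff X1 X2) \<and> (\<forall>w\<in>W. p w = glue_class X1 X2 Y f (q w))"
    using assms(1) by (simp add: glue_def quot_diff_def glue_class_def)
  from bspec[OF this assms(2)] obtain W q where W: "u \<in> W" "W \<subseteq> U"
    "(n, W, q) \<in> plots (sum_diff X1 X2)" "\<forall>w\<in>W. p w = glue_class X1 X2 Y f (q w)"
    by (elim exE conjE)
  have "\<forall>u\<in>W. \<exists>V. u \<in> V \<and> V \<subseteq> W \<and> openin (Euclidean_space n) V \<and>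
          ((\<exists>s. (n, V, s) \<in> plots X1 \<and> (\<forall>w\<in>V. q w = Inl (s w))) \<or>
           (\<exists>s. (n, V, s) \<in> plots X2 \<and> (\<forall>w\<in>V. q w = Inr (s w))))"
    using W(3) by (simp add: sum_diff_def)
  from bspec[OF this W(1)] obtain V where V: "u \<in> V" "V \<subseteq> W" "openin (Euclidean_space n) V" and
      cases: "(\<exists>s. (n, V, s) \<in> plots X1 \<and> (\<forall>w\<in>V. q w = Inl (s w))) \<or>
           (\<exists>s. (n, V, s) \<in> plots X2 \<and> (\<forall>w\<in>V. q w = Inr (s w)))"
    by (elim exE conjE)
  from cases show ?thesis
  proof (elim disjE exE conjE)
    fix s assume "(n, V, s) \<in> plots X1" "\<forall>w\<in>V. q w = Inl (s w)"
    with V W show ?thesis by (intro that(1)[of V s]) auto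
  next
    fix s assume "(n, V, s) \<in> plots X2" "\<forall>w\<in>V. q w = Inr (s w)"
    with V W show ?thesis by (intro that(2)[of V s]) auto
  qed
qed

lemma smooth_map_glue_Inl:
  assumes "\<And>n U p. (n, U, p) \<in> plots X1 \<Longrightarrow> openin (Euclidean_space n) U"
  shows "smooth_map X1 (glue X1 X2 Y f) (\<lambda>x. glue_class X1 X2 Y f (Inl x))"
  unfolding smooth_map_def
proof (intro conjI allI impI)
  show "(\<lambda>x. glue_class X1 X2 Y f (Inl x)) ` points X1 \<subseteq> points (glue X1 X2 Y f)"
    by (auto simp: glue_def quot_diff_def sum_diff_def glue_class_def quotient_def)
  fix n U p assume p: "(n, U, p) \<in> plots X1"
  then have U: "openin (Euclidean_space n) U" by (rule assms)
  have "\<exists>s. (n, U, s) \<in> plots X1 \<and> (\<forall>w\<in>U. (Inl \<circ> p) w = Inl (s w))"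
    using p by (intro exI[of _ p]) simp
  then have "(n, U, Inl \<circ> p) \<in> plots (sum_diff X1 X2)"
    using U unfolding sum_diff_def
    by (simp only: diff_space.simps mem_Collect_eq prod.case) (intro conjI ballI exI[of _ U]; blast)
  with U show "(n, U, (\<lambda>x. glue_class X1 X2 Y f (Inl x)) \<circ> p) \<in> plots (glue X1 X2 Y f)"
    unfolding glue_def quot_diff_def glue_class_def
    by (simp only: diff_space.simps mem_Collect_eq prod.case)
      (intro conjI ballI exI[of _ U] exI[of _ "Inl \<circ> p"]; simp)
qed

lemma smooth_map_glue_Inr:
  assumes "\<And>n U p. (n, U, p) \<in> plots X2 \<Longrightarrow> openin (Euclidean_space n) U"
  shows "smooth_map X2 (glue X1 X2 Y f) (\<lambda>x. glue_class X1 X2 Y f (Inr x))"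
  unfolding smooth_map_def
proof (intro conjI allI impI)
  show "(\<lambda>x. glue_class X1 X2 Y f (Inr x)) ` points X2 \<subseteq> points (glue X1 X2 Y f)"
    by (auto simp: glue_def quot_diff_def sum_diff_def glue_class_def quotient_def)
  fix n U p assume p: "(n, U, p) \<in> plots X2"
  then have U: "openin (Euclidean_space n) U" by (rule assms)
  have "\<exists>s. (n, U, s) \<in> plots X2 \<and> (\<forall>w\<in>U. (Inr \<circ> p) w = Inr (s w))"
    using p by (intro exI[of _ p]) simp
  then have "(n, U, Inr \<circ> p) \<in> plots (sum_diff X1 X2)"
    using U unfolding sum_diff_def
    by (simp only: diff_space.simps mem_Collect_eq prod.case) (intro conjI ballI exI[of _ U]; blast)
  with U show "(n, U, (\<lambda>x. glue_class X1 X2 Y f (Inr x)) \<circ> p) \<in> plots (glue X1 X2 Y f)"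
    unfolding glue_def quot_diff_def glue_class_def
    by (simp only: diff_space.simps mem_Collect_eq prod.case)
      (intro conjI ballI exI[of _ U] exI[of _ "Inr \<circ> p"]; simp)
qed

section \<open>Fibres of glued bundles\<close>

text \<open>
  A normal form for the generated equivalence: a point that can be moved to the second space is
  moved there.
\<close>

definition glue_rep :: "'a set \<Rightarrow> ('a \<Rightarrow> 'b) \<Rightarrow> 'a + 'b \<Rightarrow> 'a + 'b" where
  "glue_rep Y f = case_sum (\<lambda>y. if y \<in> Y then Inr (f y) else Inl y) Inr"

lemma glue_rep_simps [simp]:
  "glue_rep Y f (Inr z) = Inr z"
  "y \<in> Y \<Longrightarrow> glue_rep Y f (Inl y) = Inr (f y)"
  "y \<notin> Y \<Longrightarrow> glue_rep Y f (Inl y) = Inl y"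
  by (simp_all add: glue_rep_def)

text \<open>
  Every generating step preserves the normal form, and every point is at most one step away from
  its normal form.
\<close>

lemma glue_rel_eq:
  fixes X1 :: "'a diff_space" and X2 :: "'b diff_space"
  shows "glue_rel X1 X2 Y f =
     {(a, b). a \<in> points X1 <+> points X2 \<and> b \<in> points X1 <+> points X2 \<and>
        glue_rep Y f a = glue_rep Y f b}"
proof -
  define R :: "(('a + 'b) \<times> ('a + 'b)) set" where "R = {(Inl y, Inr (f y)) | y. y \<in> Y}"
  define T where "T = (R \<union> R\<inverse>)\<^sup>*"
  have inv: "glue_rep Y f a = glue_rep Y f b" if "(a, b) \<in> T" for a b
    using that unfolding T_def
    by (induction rule: rtrancl_induct) (auto simp: R_def)
  have to_rep: "(a, glue_rep Y f a) \<in> T \<and> (glue_rep Y f a, a) \<in> T" for a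
  proof (cases "\<exists>y\<in>Y. a = Inl y")
    case True
    then obtain y where "y \<in> Y" "a = Inl y" by blast
    then have "(a, glue_rep Y f a) \<in> R" by (auto simp: R_def)
    then show ?thesis by (auto simp: T_def)
  next
    case False
    then have "glue_rep Y f a = a" by (cases a) auto
    then show ?thesis by (simp add: T_def)
  qed
  have "(a, b) \<in> T" if "glue_rep Y f a = glue_rep Y f b" for a b
    using to_rep[of a] to_rep[of b] that unfolding T_def by (metis rtrancl_trans)
  with inv have "(a, b) \<in> T \<longleftrightarrow> glue_rep Y f a = glue_rep Y f b" for a b by blast
  then show ?thesis
    unfolding glue_rel_def Let_def R_def[symmetric] T_def[symmetric] by blast
qed

lemma glue_class_eq:
  "a \<in> points X1 <+> points X2 \<Longrightarrow>
    glue_class X1 X2 Y f a = {b \<in> points X1 <+> points X2. glue_rep Y f b = glue_rep Y f a}"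
  by (simp add: glue_class_def glue_rel_eq Image_singleton eq_commute[of "glue_rep Y f a"])

lemma glue_class_eq_iff:
  assumes "a \<in> points X1 <+> points X2" "b \<in> points X1 <+> points X2"
  shows "glue_class X1 X2 Y f a = glue_class X1 X2 Y f b \<longleftrightarrow> glue_rep Y f a = glue_rep Y f b"
proof
  assume "glue_class X1 X2 Y f a = glue_class X1 X2 Y f b"
  moreover have "a \<in> glue_class X1 X2 Y f a" using assms(1) by (simp add: glue_class_eq)
  ultimately show "glue_rep Y f a = glue_rep Y f b"
    by (simp add: glue_class_eq[OF assms(2)])
qed (use assms in \<open>simp add: glue_class_eq\<close>)

lemma points_glue: "points (glue X1 X2 Y f) = glue_class X1 X2 Y f ` (points X1 <+> points X2)"
  by (auto simp: glue_def quot_diff_def sum_diff_def glue_class_def quotient_def)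

lemma the_elem_image_glue_class:
  assumes a: "a \<in> points X1 <+> points X2"
    and F: "\<And>b. b \<in> points X1 <+> points X2 \<Longrightarrow> glue_rep Y f b = glue_rep Y f a \<Longrightarrow> F b = F a"
  shows "the_elem (F ` glue_class X1 X2 Y f a) = F a"
proof -
  have "a \<in> glue_class X1 X2 Y f a" using a by (simp add: glue_class_eq)
  moreover have "F b = F a" if "b \<in> glue_class X1 X2 Y f a" for b
    using that F[of b] by (simp add: glue_class_eq[OF a])
  ultimately have "F ` glue_class X1 X2 Y f a = {F a}" by blast
  then show ?thesis by simp
qed

definition closed_fibre :: "('v, 'x) pbundle \<Rightarrow> 'x \<Rightarrow> bool" where
  "closed_fibre E x \<longleftrightarrow> fib E x \<noteq> {} \<and>
     (\<forall>v\<in>fib E x. \<forall>w\<in>fib E x. vadd E v w \<in> fib E x) \<and>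
     (\<forall>c. \<forall>v\<in>fib E x. vscale E c v \<in> fib E x)"

definition fibre_linear ::
    "('v, 'x) pbundle \<Rightarrow> 'x \<Rightarrow> ('w, 'y) pbundle \<Rightarrow> 'y \<Rightarrow> ('v \<Rightarrow> 'w) \<Rightarrow> bool" where
  "fibre_linear E x F y k \<longleftrightarrow> k ` fib E x \<subseteq> fib F y \<and>
     (\<forall>v\<in>fib E x. \<forall>w\<in>fib E x. k (vadd E v w) = vadd F (k v) (k w)) \<and>
     (\<forall>c. \<forall>v\<in>fib E x. k (vscale E c v) = vscale F c (k v))"

lemma fibre_linear_comp:
  "fibre_linear E x F y k \<Longrightarrow> fibre_linear F y G z k' \<Longrightarrow> fibre_linear E x G z (k' \<circ> k)"
  unfolding fibre_linear_def by (auto simp: image_subset_iff)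

lemma fibre_linear_inverse:
  assumes k: "fibre_linear E x F y k" and E: "closed_fibre E x"
    and surj: "k ` fib E x = fib F y" and inv: "\<And>v. v \<in> fib E x \<Longrightarrow> k' (k v) = v"
  shows "fibre_linear F y E x k'"
proof -
  have add: "k' (vadd F v w) = vadd E (k' v) (k' w)" if vw: "v \<in> fib F y" "w \<in> fib F y" for v w
  proof -
    obtain a b where ab: "a \<in> fib E x" "b \<in> fib E x" "v = k a" "w = k b"
      using vw surj by (metis imageE)
    then have "vadd F v w = k (vadd E a b)" using k by (simp add: fibre_linear_def)
    moreover have "vadd E a b \<in> fib E x" using ab E by (simp add: closed_fibre_def)
    ultimately show ?thesis using ab inv by simp
  qed
  have scale: "k' (vscale F c v) = vscale E c (k' v)" if v: "v \<in> fib F y" for c v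
  proof -
    obtain a where a: "a \<in> fib E x" "v = k a"
      using v surj by (metis imageE)
    then have "vscale F c v = k (vscale E c a)" using k by (simp add: fibre_linear_def)
    moreover have "vscale E c a \<in> fib E x" using a E by (simp add: closed_fibre_def)
    ultimately show ?thesis using a inv by simp
  qed
  have "k' ` fib F y \<subseteq> fib E x" unfolding surj[symmetric] using inv by auto
  with add scale show ?thesis by (simp add: fibre_linear_def)
qed

locale gluing =
  fixes E1 :: "('v, 'x) pbundle" and E2 :: "('w, 'y) pbundle"
    and Y :: "'x set" and f :: "'x \<Rightarrow> 'y" and h :: "'v \<Rightarrow> 'w"
  assumes proj1: "proj E1 ` points (total E1) \<subseteq> points (base E1)"
    and proj2: "proj E2 ` points (total E2) \<subseteq> points (base E2)"
    and Y_base: "Y \<subseteq> points (base E1)" and f_base: "f ` Y \<subseteq> points (base E2)"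
    and f_inj: "inj_on f Y"
    and fibre1: "\<And>x. x \<in> points (base E1) \<Longrightarrow> closed_fibre E1 x"
    and fibre2: "\<And>x. x \<in> points (base E2) \<Longrightarrow> closed_fibre E2 x"
    and lift: "\<And>y. y \<in> Y \<Longrightarrow> fibre_linear E1 y E2 (f y) h"
begin

abbreviation "G \<equiv> glue_bundle E1 E2 Y f h"
abbreviation "clX \<equiv> glue_class (base E1) (base E2) Y f"
abbreviation "clV \<equiv> glue_class (total E1) (total E2) (over E1 Y) h"
abbreviation "pr \<equiv> map_sum (proj E1) (proj E2)"
abbreviation "SV \<equiv> points (total E1) <+> points (total E2)"
abbreviation "SX \<equiv> points (base E1) <+> points (base E2)"

lemma total_G: "total G = glue (total E1) (total E2) (over E1 Y) h"
  and base_G: "base G = glue (base E1) (base E2) Y f"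
  by (simp_all add: glue_bundle_def Let_def)

lemma pr_SV: "a \<in> SV \<Longrightarrow> pr a \<in> SX"
  using proj1 proj2 by auto

lemma glue_rep_pr:
  assumes "a \<in> SV"
  shows "glue_rep Y f (pr a) = pr (glue_rep (over E1 Y) h a)"
proof (cases a)
  case (Inl v)
  show ?thesis
  proof (cases "proj E1 v \<in> Y")
    case True
    with assms Inl lift[of "proj E1 v"] have "h v \<in> fib E2 (f (proj E1 v))"
      by (auto simp: fibre_linear_def fib_def)
    with True Inl assms show ?thesis by (auto simp: over_def fib_def)
  next
    case False
    then show ?thesis using Inl by (simp add: over_def)
  qed
qed simp

lemma proj_G: "a \<in> SV \<Longrightarrow> proj G (clV a) = clX (pr a)"
  using the_elem_image_glue_class[of a "total E1" "total E2" "over E1 Y" h "\<lambda>a. clX (pr a)"]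
  by (simp add: glue_bundle_def Let_def glue_class_eq_iff pr_SV glue_rep_pr)

lemma fib_G: "x \<in> SX \<Longrightarrow> fib G (clX x) = clV ` {a \<in> SV. pr (glue_rep (over E1 Y) h a) = glue_rep Y f x}"
proof -
  assume x: "x \<in> SX"
  have "fib G (clX x) = clV ` {a \<in> SV. proj G (clV a) = clX x}"
    unfolding fib_def total_G points_glue by blast
  also have "{a \<in> SV. proj G (clV a) = clX x} =
      {a \<in> SV. pr (glue_rep (over E1 Y) h a) = glue_rep Y f x}"
    by (rule Collect_cong, rule conj_cong[OF refl])
      (simp only: proj_G glue_class_eq_iff[OF pr_SV x] glue_rep_pr)
  finally show ?thesis .
qed

lemma clX_glue: "y \<in> Y \<Longrightarrow> clX (Inl y) = clX (Inr (f y))"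
  using Y_base f_base by (subst glue_class_eq_iff) auto

lemma clV_glue:
  assumes "y \<in> Y" "v \<in> fib E1 y"
  shows "clV (Inl v) = clV (Inr (h v))"
proof -
  have "h v \<in> fib E2 (f y)" using lift[OF assms(1)] assms(2) by (auto simp: fibre_linear_def)
  with assms show ?thesis by (subst glue_class_eq_iff) (auto simp: fib_def over_def)
qed

text \<open>
  A class over the second base may have representatives in the first bundle, over \<open>Y\<close>; the lift
  moves these to the second bundle.
\<close>

lemma fib_G_Inr:
  assumes "x \<in> points (base E2)"
  shows "fib G (clX (Inr x)) = (\<lambda>w. clV (Inr w)) ` fib E2 x"
proof -
  have "clV a \<in> (\<lambda>w. clV (Inr w)) ` fib E2 x"
    if a: "a \<in> SV" and rep: "pr (glue_rep (over E1 Y) h a) = Inr x" for a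
  proof (cases a)
    case (Inl v)
    with rep have v: "v \<in> over E1 Y" by (cases "v \<in> over E1 Y") auto
    then have "clV a = clV (Inr (h v))"
      using Inl by (intro trans[OF _ clV_glue[of "proj E1 v"]]) (auto simp: over_def fib_def)
    moreover have "h v \<in> fib E2 x"
      using v rep Inl lift[of "proj E1 v"] by (auto simp: over_def fib_def fibre_linear_def)
    ultimately show ?thesis by blast
  next
    case (Inr w)
    with a rep show ?thesis by (auto simp: fib_def)
  qed
  then have "fib G (clX (Inr x)) \<subseteq> (\<lambda>w. clV (Inr w)) ` fib E2 x"
    using assms by (subst fib_G) auto
  moreover have "(\<lambda>w. clV (Inr w)) ` fib E2 x \<subseteq> fib G (clX (Inr x))"
    using assms by (subst fib_G) (auto simp: fib_def intro!: imageI)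
  ultimately show ?thesis by blast
qed

text \<open>
  Away from \<open>Y\<close> no vector of the second bundle lies over the class of \<open>x\<close>, and no vector of the
  first one is identified with another.
\<close>

lemma fib_G_Inl:
  assumes "x \<in> points (base E1)" "x \<notin> Y"
  shows "fib G (clX (Inl x)) = (\<lambda>w. clV (Inl w)) ` fib E1 x"
proof -
  have "\<exists>v\<in>fib E1 x. a = Inl v"
    if a: "a \<in> SV" and rep: "pr (glue_rep (over E1 Y) h a) = Inl x" for a
  proof (cases a)
    case (Inl v)
    with rep have "v \<notin> over E1 Y" by (cases "v \<in> over E1 Y") auto
    with Inl a rep show ?thesis by (auto simp: fib_def)
  next
    case (Inr w)
    with rep show ?thesis by simp
  qed
  moreover have "fib G (clX (Inl x)) = clV ` {a \<in> SV. pr (glue_rep (over E1 Y) h a) = Inl x}"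
    using assms by (subst fib_G) auto
  ultimately have "fib G (clX (Inl x)) \<subseteq> (\<lambda>w. clV (Inl w)) ` fib E1 x"
    by blast
  moreover have "(\<lambda>w. clV (Inl w)) ` fib E1 x \<subseteq> fib G (clX (Inl x))"
  proof -
    have "v \<notin> over E1 Y" if "v \<in> fib E1 x" for v
      using that assms by (auto simp: fib_def over_def)
    then show ?thesis
      using assms by (subst fib_G) (auto simp: fib_def intro!: imageI)
  qed
  ultimately show ?thesis by blast
qed

lemma inj_clV_Inr: "inj_on (\<lambda>w. clV (Inr w)) (points (total E2))"
proof (rule inj_onI)
  fix v w assume "v \<in> points (total E2)" "w \<in> points (total E2)" "clV (Inr v) = clV (Inr w)"
  then show "v = w" by (subst (asm) glue_class_eq_iff) auto
qed

lemma inj_clV_Inl: "inj_on (\<lambda>w. clV (Inl w)) (points (total E1) - over E1 Y)"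
proof (rule inj_onI)
  fix v w assume "v \<in> points (total E1) - over E1 Y" "w \<in> points (total E1) - over E1 Y"
    "clV (Inl v) = clV (Inl w)"
  then show "v = w" by (subst (asm) glue_class_eq_iff) auto
qed

text \<open>
  Two representatives of the given classes with a common base point lie in the same summand. The
  only choice is whether to add in the second bundle or in a fibre of the first one over \<open>Y\<close>, and
  the lift is additive on the latter.
\<close>

lemma vadd_G:
  assumes a: "a \<in> SV" and b: "b \<in> SV" and ab: "pr a = pr b"
  shows "vadd G (clV a) (clV b) = clV (sum_vadd E1 E2 a b)"
proof -
  let ?s = "sum_vadd E1 E2"
  have norm: "clV (?s c d) = clV (?s (glue_rep (over E1 Y) h c) (glue_rep (over E1 Y) h d))"
    if c: "c \<in> SV" "d \<in> SV" "pr c = pr d" for c d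
  proof (cases c)
    case (Inl v)
    with c obtain w where d: "d = Inl w" by (cases d) auto
    show ?thesis
    proof (cases "proj E1 v \<in> Y")
      case True
      let ?y = "proj E1 v"
      from c Inl d have vw: "v \<in> fib E1 ?y" "w \<in> fib E1 ?y" by (auto simp: fib_def)
      then have "vadd E1 v w \<in> fib E1 ?y"
        using fibre1[of ?y] True Y_base by (auto simp: closed_fibre_def)
      then have "clV (Inl (vadd E1 v w)) = clV (Inr (h (vadd E1 v w)))"
        by (rule clV_glue[OF True])
      also have "h (vadd E1 v w) = vadd E2 (h v) (h w)"
        using lift[OF True] vw by (auto simp: fibre_linear_def)
      finally have "clV (Inl (vadd E1 v w)) = clV (Inr (vadd E2 (h v) (h w)))" .
      moreover have "v \<in> over E1 Y" "w \<in> over E1 Y" using vw True by (simp_all add: fib_def over_def)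
      ultimately show ?thesis by (simp add: Inl d)
    next
      case False
      then show ?thesis using c Inl d by (auto simp: over_def)
    qed
  next
    case (Inr v)
    with c obtain w where d: "d = Inr w" by (cases d) auto
    with Inr show ?thesis by simp
  qed
  have mem: "a \<in> clV a" "b \<in> clV b" using a b by (simp_all add: glue_class_eq)
  have "{clV (?s c d) | c d. c \<in> clV a \<and> d \<in> clV b \<and> pr c = pr d} = {clV (?s a b)}"
    (is "?S = _")
  proof
    show "{clV (?s a b)} \<subseteq> ?S" using mem ab by blast
    show "?S \<subseteq> {clV (?s a b)}"
    proof
      fix A assume "A \<in> ?S"
      then obtain c d where A: "A = clV (?s c d)" and cd: "c \<in> clV a" "d \<in> clV b" "pr c = pr d"
        by blast
      have c: "c \<in> SV \<and> glue_rep (over E1 Y) h c = glue_rep (over E1 Y) h a"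
        using cd(1) unfolding glue_class_eq[OF a] by simp
      have d: "d \<in> SV \<and> glue_rep (over E1 Y) h d = glue_rep (over E1 Y) h b"
        using cd(2) unfolding glue_class_eq[OF b] by simp
      have "clV (?s c d) = clV (?s a b)"
        using norm[OF conjunct1[OF c] conjunct1[OF d] cd(3)] norm[OF a b ab] c d by metis
      with A show "A \<in> {clV (?s a b)}" by simp
    qed
  qed
  then show ?thesis by (simp add: glue_bundle_def Let_def)
qed

lemma vscale_G:
  assumes a: "a \<in> SV"
  shows "vscale G c (clV a) = clV (map_sum (vscale E1 c) (vscale E2 c) a)"
proof -
  let ?s = "map_sum (vscale E1 c) (vscale E2 c)"
  have norm: "clV (?s b) = clV (?s (glue_rep (over E1 Y) h b))" if b: "b \<in> SV" for b
  proof (cases "\<exists>v\<in>over E1 Y. b = Inl v")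
    case True
    then obtain v where v: "v \<in> over E1 Y" "b = Inl v" by blast
    let ?y = "proj E1 v"
    from v have y: "?y \<in> Y" and vf: "v \<in> fib E1 ?y" by (auto simp: over_def fib_def)
    then have "vscale E1 c v \<in> fib E1 ?y"
      using fibre1[of ?y] Y_base by (auto simp: closed_fibre_def)
    then have "clV (Inl (vscale E1 c v)) = clV (Inr (h (vscale E1 c v)))"
      by (rule clV_glue[OF y])
    also have "h (vscale E1 c v) = vscale E2 c (h v)"
      using lift[OF y] vf by (auto simp: fibre_linear_def)
    finally show ?thesis using v by simp
  next
    case False
    then have "glue_rep (over E1 Y) h b = b" by (cases b) auto
    then show ?thesis by simp
  qed
  show ?thesis
    using the_elem_image_glue_class[OF a, of "over E1 Y" h "\<lambda>b. clV (?s b)"] norm a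
    by (simp add: glue_bundle_def Let_def)
qed

lemma fibre_linear_Inr:
  assumes x: "x \<in> points (base E2)"
  shows "fibre_linear E2 x G (clX (Inr x)) (\<lambda>w. clV (Inr w))"
proof -
  have "clV (Inr w) \<in> fib G (clX (Inr x))" if "w \<in> fib E2 x" for w
    using that fib_G_Inr[OF x] by blast
  moreover have "clV (Inr (vadd E2 v w)) = vadd G (clV (Inr v)) (clV (Inr w))"
    if "v \<in> fib E2 x" "w \<in> fib E2 x" for v w
    using that by (subst vadd_G) (auto simp: fib_def)
  moreover have "clV (Inr (vscale E2 c w)) = vscale G c (clV (Inr w))" if "w \<in> fib E2 x" for c w
    using that by (subst vscale_G) (auto simp: fib_def)
  ultimately show ?thesis by (auto simp: fibre_linear_def)
qed

lemma fibre_linear_Inl: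
  assumes x: "x \<in> points (base E1)"
  shows "fibre_linear E1 x G (clX (Inl x)) (\<lambda>w. clV (Inl w))"
proof -
  have "clV (Inl w) \<in> fib G (clX (Inl x))" if "w \<in> fib E1 x" for w
    using that x by (auto simp: fib_def total_G points_glue proj_G[OF InlI])
  moreover have "clV (Inl (vadd E1 v w)) = vadd G (clV (Inl v)) (clV (Inl w))"
    if "v \<in> fib E1 x" "w \<in> fib E1 x" for v w
    using that by (subst vadd_G) (auto simp: fib_def)
  moreover have "clV (Inl (vscale E1 c w)) = vscale G c (clV (Inl w))" if "w \<in> fib E1 x" for c w
    using that by (subst vscale_G) (auto simp: fib_def)
  ultimately show ?thesis by (auto simp: fibre_linear_def)
qed

end

section \<open>Linear algebra in dual fibres\<close>

definition fibre_functional :: "('v, 'x) pbundle \<Rightarrow> 'x \<Rightarrow> ('v \<Rightarrow> real) \<Rightarrow> bool" where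
  "fibre_functional E x l \<longleftrightarrow>
     (\<forall>v\<in>fib E x. \<forall>w\<in>fib E x. l (vadd E v w) = l v + l w) \<and>
     (\<forall>c. \<forall>v\<in>fib E x. l (vscale E c v) = c * l v)"

text \<open>
  Finite dimension in the only form used below: linear functionals are controlled by their values
  at finitely many vectors. Unlike a spanning set, this transfers along surjections without
  speaking of linear combinations.
\<close>

definition finitely_determined :: "('v, 'x) pbundle \<Rightarrow> 'x \<Rightarrow> bool" where
  "finitely_determined E x \<longleftrightarrow> (\<exists>B. finite B \<and> B \<subseteq> fib E x \<and>
     (\<forall>l. fibre_functional E x l \<longrightarrow> (\<forall>b\<in>B. l b = 0) \<longrightarrow> (\<forall>v\<in>fib E x. l v = 0)))"

lemma fibre_module_simps [simp]:
  "carrier (fibre_module E x) = fib E x" "zero (fibre_module E x) = vzero E x"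
  "add (fibre_module E x) = vadd E" "smult (fibre_module E x) = vscale E"
  by (simp_all add: fibre_module_def)

lemma closed_fibre_module:
  assumes "Module.module real_ring (fibre_module E x)"
  shows "closed_fibre E x"
proof -
  interpret M: Module.module real_ring "fibre_module E x" by fact
  have "vzero E x \<in> fib E x" using M.zero_closed by simp
  moreover have "vadd E v w \<in> fib E x" if "v \<in> fib E x" "w \<in> fib E x" for v w
    using M.add.m_closed that by simp
  moreover have "vscale E c v \<in> fib E x" if "v \<in> fib E x" for c v
    using M.smult_closed[of c v] that by (simp add: real_ring_def)
  ultimately show ?thesis unfolding closed_fibre_def by blast
qed

lemma finitely_determined_finite_dim:
  assumes "Module.module real_ring (fibre_module E x)" and "finite_dim (fibre_module E x)"
  shows "finitely_determined E x"
proof -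
  interpret M: Module.module real_ring "fibre_module E x" by fact
  have scl: "vscale E c v \<in> fib E x" if "v \<in> fib E x" for c v
    using M.smult_closed[of c v] that by (simp add: real_ring_def)
  obtain B where B: "finite B" "B \<subseteq> fib E x"
    and span: "\<And>v. v \<in> fib E x \<Longrightarrow>
      \<exists>c. v = finsum (fibre_module E x) (\<lambda>b. vscale E (c b) b) B"
    using assms(2) unfolding finite_dim_def by auto
  have "l v = 0" if l: "fibre_functional E x l" and lB: "\<forall>b\<in>B. l b = 0" and v: "v \<in> fib E x" for l v
  proof -
    have fs: "finsum (fibre_module E x) (\<lambda>b. vscale E (c b) b) C \<in> fib E x \<and>
        l (finsum (fibre_module E x) (\<lambda>b. vscale E (c b) b) C) = 0" if "finite C" "C \<subseteq> B" for c C
      using that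
    proof (induction C)
      case empty
      have z: "vzero E x \<in> fib E x" using M.zero_closed by simp
      have "vadd E (vzero E x) (vzero E x) = vzero E x" using M.l_zero[of "vzero E x"] z by simp
      then have "l (vzero E x) = l (vzero E x) + l (vzero E x)"
        using l z unfolding fibre_functional_def by metis
      with z show ?case by simp
    next
      case (insert b C)
      let ?s = "finsum (fibre_module E x) (\<lambda>b. vscale E (c b) b) C"
      have b: "b \<in> fib E x" using insert.prems B by blast
      have "finsum (fibre_module E x) (\<lambda>b. vscale E (c b) b) (insert b C) = vadd E (vscale E (c b) b) ?s"
        using M.finsum_insert[OF insert.hyps(1,2), of "\<lambda>b. vscale E (c b) b"] insert.prems B scl
        by (auto simp: Pi_def)
      moreover have "vadd E (vscale E (c b) b) ?s \<in> fib E x"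
        using M.add.m_closed[of "vscale E (c b) b" ?s] insert scl[OF b] by simp
      moreover have "l (vadd E (vscale E (c b) b) ?s) = l (vscale E (c b) b) + l ?s"
        using l insert scl[OF b] unfolding fibre_functional_def by blast
      moreover have "l (vscale E (c b) b) = 0"
        using l b insert.prems lB unfolding fibre_functional_def by simp
      ultimately show ?case using insert by simp
    qed
    from span[OF v] fs[OF B(1) subset_refl] show ?thesis by metis
  qed
  with B show ?thesis unfolding finitely_determined_def by blast
qed

lemma closed_fibre_image:
  assumes "fibre_linear E x F y k" "k ` fib E x = fib F y" "closed_fibre E x"
  shows "closed_fibre F y"
  using assms(1,3) unfolding closed_fibre_def fibre_linear_def assms(2)[symmetric]
  by (auto simp: image_iff) metis+

lemma finitely_determined_image:
  assumes k: "fibre_linear E x F y k" and surj: "k ` fib E x = fib F y"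
    and E: "finitely_determined E x"
  shows "finitely_determined F y"
proof -
  obtain B where B: "finite B" "B \<subseteq> fib E x" and det: "\<And>l. fibre_functional E x l \<Longrightarrow>
      \<forall>b\<in>B. l b = 0 \<Longrightarrow> \<forall>v\<in>fib E x. l v = 0"
    using E unfolding finitely_determined_def by blast
  have "\<forall>v\<in>fib F y. l v = 0" if l: "fibre_functional F y l" "\<forall>b\<in>k ` B. l b = 0" for l
  proof -
    have "fibre_functional E x (l \<circ> k)"
      using l(1) k unfolding fibre_functional_def fibre_linear_def by (auto simp: image_subset_iff)
    from det[OF this] l(2) have "\<forall>v\<in>fib E x. l (k v) = 0" by simp
    then show ?thesis unfolding surj[symmetric] by blast
  qed
  moreover have "finite (k ` B)" "k ` B \<subseteq> fib F y" using B surj by auto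
  ultimately show ?thesis unfolding finitely_determined_def by blast
qed

lemma dual_simps [simp]:
  "points (total (dual E)) = Sigma (points (base E)) (dual_fib E)"
  "base (dual E) = base E" "proj (dual E) = fst"
  "vadd (dual E) (x, l) (y, l') = (x, l + l')"
  "vscale (dual E) c (x, l) = (x, c *\<^sub>R l)"
  by (simp_all add: dual_def Let_def)

lemma snd_vadd_dual [simp]: "snd (vadd (dual E) a b) = snd a + snd b"
  and snd_vscale_dual [simp]: "snd (vscale (dual E) c a) = c *\<^sub>R snd a"
  by (cases a; cases b; simp) (cases a; simp)

lemma dual_plotD:
  assumes "(n, U, p) \<in> plots (total (dual E))"
  shows "openin (Euclidean_space n) U" "p ` U \<subseteq> Sigma (points (base E)) (dual_fib E)"
    "(n, U, fst \<circ> p) \<in> plots (base E)"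
  using assms by (simp_all add: dual_def Let_def)

lemma smooth_map_proj_dual: "smooth_map (total (dual E)) (base E) fst"
  unfolding smooth_map_def using dual_plotD(3) by fastforce

lemma fib_dual: "x \<in> points (base E) \<Longrightarrow> fib (dual E) x = Pair x ` dual_fib E x"
  by (auto simp: fib_def)

lemma dual_fib_functional: "l \<in> dual_fib E x \<Longrightarrow> fibre_functional E x l"
  and dual_fib_outside: "l \<in> dual_fib E x \<Longrightarrow> v \<notin> fib E x \<Longrightarrow> l v = 0"
  by (simp_all add: dual_fib_def fibre_functional_def)

abbreviation open_plots :: "'a diff_space \<Rightarrow> bool" where
  "open_plots X \<equiv> \<forall>n U p. (n, U, p) \<in> plots X \<longrightarrow> openin (Euclidean_space n) U"

lemma subspace_dual_fib:
  assumes "open_plots (total E)"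
  shows "subspace (dual_fib E x)"
proof (rule subspaceI)
  have "(n, U, (\<lambda>_. 0) \<circ> p) \<in> plots real_diff" if "(n, U, p) \<in> plots (sub_diff (total E) (fib E x))"
    for n U p
    using that assms by (auto simp: sub_diff_def real_diff_def o_def smooth_real_zero)
  then show "0 \<in> dual_fib E x"
    by (simp add: dual_fib_def smooth_map_def zero_fun_def real_diff_def)
next
  fix a b assume a: "a \<in> dual_fib E x" and b: "b \<in> dual_fib E x"
  have "(n, U, (a + b) \<circ> p) \<in> plots real_diff" if "(n, U, p) \<in> plots (sub_diff (total E) (fib E x))"
    for n U p
    using that a b smooth_real_add[of n U "a \<circ> p" "b \<circ> p"]
    by (auto simp: dual_fib_def smooth_map_def real_diff_def o_def)
  with a b show "a + b \<in> dual_fib E x"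
    by (simp add: dual_fib_def smooth_map_def algebra_simps) (simp add: real_diff_def)
next
  fix c :: real and a assume a: "a \<in> dual_fib E x"
  have "(n, U, (c *\<^sub>R a) \<circ> p) \<in> plots real_diff" if "(n, U, p) \<in> plots (sub_diff (total E) (fib E x))"
    for n U p
    using that a smooth_real_cmult[of n U "a \<circ> p" c]
    by (auto simp: dual_fib_def smooth_map_def real_diff_def o_def scaleR_fun_def)
  with a show "c *\<^sub>R a \<in> dual_fib E x"
    by (simp add: dual_fib_def smooth_map_def algebra_simps scaleR_fun_def) (simp add: real_diff_def)
qed

lemma closed_fibre_dual:
  assumes "open_plots (total E)" "x \<in> points (base E)"
  shows "closed_fibre (dual E) x"
proof -
  note sub = subspace_dual_fib[OF assms(1), of x]
  have "(x, 0) \<in> fib (dual E) x" using subspace_0[OF sub] by (simp add: fib_dual[OF assms(2)])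
  then show ?thesis
    using subspace_add[OF sub] subspace_scale[OF sub]
    unfolding closed_fibre_def fib_dual[OF assms(2)] by auto
qed

text \<open>
  In a minimal finite set of vectors that separates functionals, each vector is detected by a
  functional vanishing on the others; rescaled, these functionals are a dual basis.
\<close>

lemma dual_fib_coordinates:
  assumes op: "open_plots (total E)" and det: "finitely_determined E x"
  obtains B w where "finite B" "B \<subseteq> fib E x" "\<And>u. u \<in> B \<Longrightarrow> w u \<in> dual_fib E x"
    "\<And>l. l \<in> dual_fib E x \<Longrightarrow> l = (\<Sum>u\<in>B. l u *\<^sub>R w u)"
proof -
  note sub = subspace_dual_fib[OF op, of x]
  define sep where "sep B \<longleftrightarrow> (\<forall>l\<in>dual_fib E x. (\<forall>b\<in>B. l b = 0) \<longrightarrow> l = 0)" for B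
  have "l = 0" if "l \<in> dual_fib E x" "\<forall>v\<in>fib E x. l v = 0" for l
    using that by (auto simp: fun_eq_iff dual_fib_def)
  then obtain B0 where B0: "finite B0" "B0 \<subseteq> fib E x" "sep B0"
    using det dual_fib_functional unfolding finitely_determined_def sep_def by metis
  have "\<exists>B w. finite B \<and> B \<subseteq> fib E x \<and> (\<forall>u\<in>B. w u \<in> dual_fib E x) \<and>
      (\<forall>l\<in>dual_fib E x. l = (\<Sum>u\<in>B. l u *\<^sub>R w u))"
    using B0
  proof (induction rule: finite_psubset_induct)
    case (psubset B)
    show ?case
    proof (cases "\<exists>u\<in>B. sep (B - {u})")
      case True
      then obtain u where "u \<in> B" "sep (B - {u})" by blast
      then show ?thesis using psubset.IH[of "B - {u}"] psubset.prems by blast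
    next
      case False
      then have "\<forall>u\<in>B. \<exists>l\<in>dual_fib E x. (\<forall>b\<in>B - {u}. l b = 0) \<and> l u \<noteq> 0"
        using psubset.prems(2) unfolding sep_def by (metis DiffI singletonD)
      then obtain a where a: "\<And>u. u \<in> B \<Longrightarrow> a u \<in> dual_fib E x"
        "\<And>u b. u \<in> B \<Longrightarrow> b \<in> B - {u} \<Longrightarrow> a u b = 0" "\<And>u. u \<in> B \<Longrightarrow> a u u \<noteq> 0"
        by metis
      define w where "w u = (1 / a u u) *\<^sub>R a u" for u
      have w: "w u \<in> dual_fib E x" if "u \<in> B" for u
        unfolding w_def by (intro subspace_scale[OF sub] a that)
      have wb: "w u b = (if u = b then 1 else 0)" if "u \<in> B" "b \<in> B" for u b
        using a(2)[of u b] a(3)[of u] that by (auto simp: w_def scaleR_fun_def)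
      have coord: "l = (\<Sum>u\<in>B. l u *\<^sub>R w u)" if l: "l \<in> dual_fib E x" for l
      proof -
        let ?s = "\<Sum>u\<in>B. l u *\<^sub>R w u"
        have "?s \<in> dual_fib E x" by (intro subspace_sum[OF sub] subspace_scale[OF sub] w)
        then have "l - ?s \<in> dual_fib E x" using l by (intro subspace_diff[OF sub])
        moreover have "(l - ?s) b = 0" if b: "b \<in> B" for b
        proof -
          have "?s b = (\<Sum>u\<in>B. l u * w u b)"
            using psubset.hyps by (induction B) (auto simp: scaleR_fun_def)
          also have "\<dots> = (\<Sum>u\<in>B. if u = b then l b else 0)"
            by (rule sum.cong) (auto simp: wb b)
          also have "\<dots> = l b" using psubset.hyps b by simp
          finally show ?thesis by simp
        qed
        ultimately show ?thesis using psubset.prems(2) unfolding sep_def by force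
      qed
      show ?thesis
      proof (intro exI[of _ B] exI[of _ w] conjI ballI)
        show "finite B" "B \<subseteq> fib E x" by fact+
      qed (fact w coord)+
    qed
  qed
  then show ?thesis using that by blast
qed

lemma sum_fun_apply: "(\<Sum>i\<in>I. f i) v = (\<Sum>i\<in>I. f i v)"
  by (induction I rule: infinite_finite_induct) auto

lemma linear_on_subspace_sum:
  fixes L :: "'a::real_vector \<Rightarrow> real"
  assumes S: "subspace S" and add: "\<And>a b. a \<in> S \<Longrightarrow> b \<in> S \<Longrightarrow> L (a + b) = L a + L b"
    and scale: "\<And>c a. a \<in> S \<Longrightarrow> L (c *\<^sub>R a) = c * L a" and w: "\<And>i. i \<in> I \<Longrightarrow> w i \<in> S"
  shows "L (\<Sum>i\<in>I. c i *\<^sub>R w i) = (\<Sum>i\<in>I. c i * L (w i))"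
proof -
  have zero: "L 0 = 0" using scale[OF subspace_0[OF S], of 0] by simp
  show ?thesis
    using w
  proof (induction I rule: infinite_finite_induct)
    case (insert i I)
    have "c i *\<^sub>R w i \<in> S" "(\<Sum>i\<in>I. c i *\<^sub>R w i) \<in> S"
      using insert.prems by (auto intro!: subspace_scale[OF S] subspace_sum[OF S])
    moreover have "L (\<Sum>i\<in>I. c i *\<^sub>R w i) = (\<Sum>i\<in>I. c i * L (w i))" "w i \<in> S"
      using insert.IH insert.prems by blast+
    ultimately show ?case using insert.hyps by (simp add: add scale)
  qed (simp_all add: zero)
qed

text \<open>
  With dual basis \<open>w\<close> of the vectors in \<open>B\<close>, a functional \<open>L\<close> on the dual fibre is evaluation at the
  combination of the \<open>u \<in> B\<close> with coefficients \<open>L (w u)\<close>. A fibre thus maps onto the algebraic dual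
  of its dual.
\<close>

lemma dual_functional_evaluation:
  assumes cl: "closed_fibre E x" and op: "open_plots (total E)" and det: "finitely_determined E x"
    and add: "\<And>a b. a \<in> dual_fib E x \<Longrightarrow> b \<in> dual_fib E x \<Longrightarrow> L (a + b) = L a + L b"
    and scale: "\<And>c a. a \<in> dual_fib E x \<Longrightarrow> L (c *\<^sub>R a) = c * L a"
  obtains v where "v \<in> fib E x" "\<And>l. l \<in> dual_fib E x \<Longrightarrow> L l = l v"
proof -
  note sub = subspace_dual_fib[OF op, of x]
  obtain B w where B: "finite B" "B \<subseteq> fib E x" and w: "\<And>u. u \<in> B \<Longrightarrow> w u \<in> dual_fib E x"
    and eq: "\<And>l. l \<in> dual_fib E x \<Longrightarrow> l = (\<Sum>u\<in>B. l u *\<^sub>R w u)"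
    by (rule dual_fib_coordinates[OF op det]) blast
  have comb: "\<exists>v\<in>fib E x. \<forall>l\<in>dual_fib E x. l v = (\<Sum>u\<in>C. L (w u) * l u)" if "finite C" "C \<subseteq> B" for C
    using that
  proof (induction C)
    case empty
    \<comment> \<open>any multiple by zero serves as the empty combination\<close>
    obtain v where "v \<in> fib E x" using cl by (auto simp: closed_fibre_def)
    then have "vscale E 0 v \<in> fib E x" "\<forall>l\<in>dual_fib E x. l (vscale E 0 v) = 0"
      using cl by (auto simp: closed_fibre_def dual_fib_def)
    then show ?case by auto
  next
    case (insert u C)
    then obtain v where v: "v \<in> fib E x" "\<forall>l\<in>dual_fib E x. l v = (\<Sum>u\<in>C. L (w u) * l u)" by blast
    have u: "u \<in> fib E x" "vscale E (L (w u)) u \<in> fib E x"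
      using insert.prems B cl by (auto simp: closed_fibre_def)
    then have "vadd E (vscale E (L (w u)) u) v \<in> fib E x"
      using v cl by (auto simp: closed_fibre_def)
    moreover have "\<forall>l\<in>dual_fib E x. l (vadd E (vscale E (L (w u)) u) v) = (\<Sum>u\<in>insert u C. L (w u) * l u)"
      using u v insert.hyps by (auto simp: dual_fib_def)
    ultimately show ?case by blast
  qed
  obtain v where v: "v \<in> fib E x" "\<forall>l\<in>dual_fib E x. l v = (\<Sum>u\<in>B. L (w u) * l u)"
    using comb[OF B(1) subset_refl] by blast
  have "L l = l v" if l: "l \<in> dual_fib E x" for l
  proof -
    have "L l = L (\<Sum>u\<in>B. l u *\<^sub>R w u)" using eq[OF l] by simp
    also have "\<dots> = (\<Sum>u\<in>B. l u * L (w u))" by (rule linear_on_subspace_sum[OF sub add scale w])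
    finally show ?thesis using v l by (simp add: mult.commute)
  qed
  with v that show ?thesis by blast
qed


section \<open>Tensors as bilinear forms\<close>

lemma subspace_bilin: "subspace (bilin E F x)"
  by (rule subspaceI) (auto simp: bilin_def scaleR_fun_def algebra_simps)

lemma
  fixes E :: "('v, 'x) pbundle" and F :: "('w, 'x) pbundle"
  assumes t: "t \<in> tensor_fib E F x"
  shows tensor_fib_outside: "b \<notin> bilin E F x \<Longrightarrow> t b = 0"
    and tensor_fib_add: "b \<in> bilin E F x \<Longrightarrow> b' \<in> bilin E F x \<Longrightarrow> t (b + b') = t b + t b'"
    and tensor_fib_scale: "b \<in> bilin E F x \<Longrightarrow> t (c *\<^sub>R b) = c * t b"
proof -
  define P where "P t \<longleftrightarrow> (\<forall>b. b \<notin> bilin E F x \<longrightarrow> t b = 0) \<and>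
    (\<forall>b\<in>bilin E F x. \<forall>b'\<in>bilin E F x. t (b + b') = t b + t b') \<and>
    (\<forall>c. \<forall>b\<in>bilin E F x. t (c *\<^sub>R b) = c * t b)" for t :: "('v, 'w) tens"
  have "P t"
    using t unfolding tensor_fib_def
  proof (rule span_induct)
    show "subspace (Collect P)"
      by (rule subspaceI) (auto simp: P_def algebra_simps scaleR_fun_def[where ?'a = "'v \<Rightarrow> 'w \<Rightarrow> real"])
    fix u assume "u \<in> {pure_tensor E F x v w |v w. v \<in> fib E x \<and> w \<in> fib F x}"
    then obtain v w where u: "u = pure_tensor E F x v w" by blast
    have "u (b + b') = u b + u b'" if "b \<in> bilin E F x" "b' \<in> bilin E F x" for b b'
      using that subspace_add[OF subspace_bilin that] by (simp add: u pure_tensor_def)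
    moreover have "u (c *\<^sub>R b) = c * u b" if "b \<in> bilin E F x" for c b
    proof -
      have "(c *\<^sub>R b) v w = c * b v w" by (simp add: scaleR_fun_def)
      then show ?thesis
        using that subspace_scale[OF subspace_bilin that, of c] by (simp add: u pure_tensor_def)
    qed
    ultimately show "P u" by (simp add: P_def) (simp add: u pure_tensor_def)
  qed
  then show "b \<notin> bilin E F x \<Longrightarrow> t b = 0"
    "b \<in> bilin E F x \<Longrightarrow> b' \<in> bilin E F x \<Longrightarrow> t (b + b') = t b + t b'"
    "b \<in> bilin E F x \<Longrightarrow> t (c *\<^sub>R b) = c * t b"
    unfolding P_def by blast+
qed

lemma tensor_fib_sum:
  assumes t: "t \<in> tensor_fib E F x" and b: "\<And>i. i \<in> I \<Longrightarrow> b i \<in> bilin E F x"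
  shows "t (\<Sum>i\<in>I. c i *\<^sub>R b i) = (\<Sum>i\<in>I. c i * t (b i))"
  by (rule linear_on_subspace_sum[OF subspace_bilin tensor_fib_add[OF t] tensor_fib_scale[OF t] b])

text \<open>
  The image of \<open>v \<otimes> w\<close> among the bilinear forms on the dual fibre.
\<close>

definition eval_form ::
    "('v, 'x) pbundle \<Rightarrow> 'x \<Rightarrow> 'v \<Rightarrow> 'v \<Rightarrow> ('v, 'x) dual_pt \<Rightarrow> ('v, 'x) dual_pt \<Rightarrow> real" where
  "eval_form E x v w = (\<lambda>\<alpha> \<beta>.
     if \<alpha> \<in> fib (dual E) x \<and> \<beta> \<in> fib (dual E) x then snd \<alpha> v * snd \<beta> w else 0)"

lemma form_of_eq: "form_of E (x, t) v w = t (eval_form E x v w)"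
  by (simp add: form_of_def eval_form_def)

lemma eval_form_bilin:
  "closed_fibre (dual E) x \<Longrightarrow> eval_form E x v w \<in> bilin (dual E) (dual E) x"
  by (auto simp: bilin_def eval_form_def closed_fibre_def scaleR_fun_def algebra_simps)

text \<open>
  In terms of a dual basis \<open>w\<close> of vectors in \<open>B\<close>, every bilinear form on the dual fibre is a
  combination of products of evaluations at points of \<open>B\<close>, and the values of a tensor on such
  products are the values of its form.
\<close>

lemma form_of_inject:
  fixes E :: "('v, 'x) pbundle"
  assumes x: "x \<in> points (base E)" and op: "open_plots (total E)" and det: "finitely_determined E x"
    and t: "t \<in> tensor_fib (dual E) (dual E) x" and t': "t' \<in> tensor_fib (dual E) (dual E) x"
    and eq: "\<And>v w. v \<in> fib E x \<Longrightarrow> w \<in> fib E x \<Longrightarrow> form_of E (x, t) v w = form_of E (x, t') v w"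
  shows "t = t'"
proof
  fix b
  note cl = closed_fibre_dual[OF op x]
  note sub = subspace_dual_fib[OF op, of x]
  show "t b = t' b"
  proof (cases "b \<in> bilin (dual E) (dual E) x")
    case False
    then show ?thesis using tensor_fib_outside[OF t] tensor_fib_outside[OF t'] by simp
  next
    case b: True
    obtain B w where B: "finite B" "B \<subseteq> fib E x" and w: "\<And>u. u \<in> B \<Longrightarrow> w u \<in> dual_fib E x"
      and coord: "\<And>l. l \<in> dual_fib E x \<Longrightarrow> l = (\<Sum>u\<in>B. l u *\<^sub>R w u)"
      by (rule dual_fib_coordinates[OF op det]) blast
    have b1: "b (x, \<Sum>u\<in>B. c u *\<^sub>R w u) \<beta> = (\<Sum>u\<in>B. c u * b (x, w u) \<beta>)"
      if \<beta>: "\<beta> \<in> fib (dual E) x" for c \<beta>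
    proof (rule linear_on_subspace_sum[OF sub _ _ w])
      fix l l' :: "'v \<Rightarrow> real" and c :: real assume l: "l \<in> dual_fib E x"
      have "b (vscale (dual E) c (x, l)) \<beta> = c * b (x, l) \<beta>"
        using b \<beta> l unfolding bilin_def fib_dual[OF x] by blast
      then show "b (x, c *\<^sub>R l) \<beta> = c * b (x, l) \<beta>" by simp
      assume "l' \<in> dual_fib E x"
      then have "b (vadd (dual E) (x, l) (x, l')) \<beta> = b (x, l) \<beta> + b (x, l') \<beta>"
        using b \<beta> l unfolding bilin_def fib_dual[OF x] by blast
      then show "b (x, l + l') \<beta> = b (x, l) \<beta> + b (x, l') \<beta>" by simp
    qed
    have b2: "b \<alpha> (x, \<Sum>u\<in>B. c u *\<^sub>R w u) = (\<Sum>u\<in>B. c u * b \<alpha> (x, w u))"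
      if \<alpha>: "\<alpha> \<in> fib (dual E) x" for c \<alpha>
    proof (rule linear_on_subspace_sum[OF sub _ _ w])
      fix l l' :: "'v \<Rightarrow> real" and c :: real assume l: "l \<in> dual_fib E x"
      have "b \<alpha> (vscale (dual E) c (x, l)) = c * b \<alpha> (x, l)"
        using b \<alpha> l unfolding bilin_def fib_dual[OF x] by blast
      then show "b \<alpha> (x, c *\<^sub>R l) = c * b \<alpha> (x, l)" by simp
      assume "l' \<in> dual_fib E x"
      then have "b \<alpha> (vadd (dual E) (x, l) (x, l')) = b \<alpha> (x, l) + b \<alpha> (x, l')"
        using b \<alpha> l unfolding bilin_def fib_dual[OF x] by blast
      then show "b \<alpha> (x, l + l') = b \<alpha> (x, l) + b \<alpha> (x, l')" by simp
    qed
    define k where "k p = b (x, w (fst p)) (x, w (snd p))" for p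
    define e where "e p = eval_form E x (fst p) (snd p)" for p
    have "b \<alpha> \<beta> = (\<Sum>p\<in>B \<times> B. k p *\<^sub>R e p) \<alpha> \<beta>" for \<alpha> \<beta>
    proof (cases "\<alpha> \<in> fib (dual E) x \<and> \<beta> \<in> fib (dual E) x")
      case True
      then obtain a a' where a: "a \<in> dual_fib E x" "\<alpha> = (x, a)" "a' \<in> dual_fib E x" "\<beta> = (x, a')"
        unfolding fib_dual[OF x] by blast
      have "b \<alpha> \<beta> = b (x, \<Sum>u\<in>B. a u *\<^sub>R w u) \<beta>"
        using coord[OF a(1)] a(2) by simp
      also have "\<dots> = (\<Sum>u\<in>B. a u * b (x, w u) \<beta>)"
        using True by (intro b1) simp
      also have "\<dots> = (\<Sum>u\<in>B. a u * (\<Sum>u'\<in>B. a' u' * b (x, w u) (x, w u')))"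
      proof (rule sum.cong[OF refl])
        fix u assume "u \<in> B"
        then have "(x, w u) \<in> fib (dual E) x" using w by (simp add: fib_dual[OF x])
        then have "b (x, w u) (x, \<Sum>u'\<in>B. a' u' *\<^sub>R w u') = (\<Sum>u'\<in>B. a' u' * b (x, w u) (x, w u'))"
          by (rule b2)
        then show "a u * b (x, w u) \<beta> = a u * (\<Sum>u'\<in>B. a' u' * b (x, w u) (x, w u'))"
          using coord[OF a(3)] a(4) by simp
      qed
      also have "\<dots> = (\<Sum>p\<in>B \<times> B. k p * (a (fst p) * a' (snd p)))"
        by (simp add: sum.cartesian_product case_prod_unfold sum_distrib_left k_def mult_ac)
      also have "\<dots> = (\<Sum>p\<in>B \<times> B. k p *\<^sub>R e p) \<alpha> \<beta>"
        using True by (simp add: sum_fun_apply scaleR_fun_def e_def eval_form_def a)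
      finally show ?thesis .
    next
      case False
      with b have "b \<alpha> \<beta> = 0" unfolding bilin_def mem_Collect_eq by blast
      with False show ?thesis by (auto simp add: sum_fun_apply scaleR_fun_def e_def eval_form_def)
    qed
    then have b_eq: "b = (\<Sum>p\<in>B \<times> B. k p *\<^sub>R e p)" by blast
    have e: "e p \<in> bilin (dual E) (dual E) x" for p
      unfolding e_def by (rule eval_form_bilin[OF cl])
    have "t (e p) = t' (e p)" if "p \<in> B \<times> B" for p
    proof -
      have "fst p \<in> fib E x" "snd p \<in> fib E x" using that B(2) by auto
      from eq[OF this] show ?thesis by (simp add: e_def form_of_eq)
    qed
    then show ?thesis
      unfolding b_eq using B e by (simp add: tensor_fib_sum[OF t] tensor_fib_sum[OF t'])
  qed
qed

text \<open>
  For a pure tensor \<open>\<alpha> \<otimes> \<beta>\<close> the functional is a multiple of the smooth functional \<open>\<beta>\<close>, and smooth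
  functionals form a subspace.
\<close>

lemma form_of_dual_fib:
  assumes x: "x \<in> points (base E)" and op: "open_plots (total E)"
    and t: "t \<in> tensor_fib (dual E) (dual E) x"
  shows "(\<lambda>w. if w \<in> fib E x then form_of E (x, t) v w else 0) \<in> dual_fib E x"
proof -
  note cl = closed_fibre_dual[OF op x]
  note sub = subspace_dual_fib[OF op, of x]
  let ?r = "\<lambda>t w. if w \<in> fib E x then t (eval_form E x v w) else (0::real)"
  have "?r t \<in> dual_fib E x"
    using t unfolding tensor_fib_def
  proof (rule span_induct)
    have add: "?r (a + b) = ?r a + ?r b" and scale: "?r (c *\<^sub>R a) = c *\<^sub>R ?r a"
      and zero: "?r 0 = 0" for a b c
      by (auto simp: fun_eq_iff scaleR_fun_def)
    show "subspace {t. ?r t \<in> dual_fib E x}"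
      by (rule subspaceI)
        (simp_all only: mem_Collect_eq add scale zero subspace_0[OF sub] subspace_add[OF sub]
          subspace_scale[OF sub])
  next
    fix u assume "u \<in> {pure_tensor (dual E) (dual E) x a b |a b. a \<in> fib (dual E) x \<and> b \<in> fib (dual E) x}"
    then obtain a b where u: "u = pure_tensor (dual E) (dual E) x a b"
      and ab: "a \<in> fib (dual E) x" "b \<in> fib (dual E) x"
      by blast
    then have sb: "snd b \<in> dual_fib E x" by (auto simp: fib_dual[OF x])
    have "u (eval_form E x v w) = eval_form E x v w a b" for w
      using eval_form_bilin[OF cl, of v w] by (simp add: u pure_tensor_def)
    then have "u (eval_form E x v w) = snd a v * snd b w" for w
      using ab by (simp add: eval_form_def)
    then have "?r u = snd a v *\<^sub>R snd b"
      using dual_fib_outside[OF sb] by (auto simp: fun_eq_iff scaleR_fun_def)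
    then show "?r u \<in> dual_fib E x" by (simp only: subspace_scale[OF sub sb])
  qed
  then show ?thesis by (simp add: form_of_eq cong: if_cong)
qed

section \<open>Functoriality of the tensor square\<close>

abbreviation pullback_form ::
    "('v, 'x) pbundle \<Rightarrow> 'x \<Rightarrow> ('v \<Rightarrow> 'w) \<Rightarrow> ('w \<Rightarrow> 'w \<Rightarrow> real) \<Rightarrow> 'v \<Rightarrow> 'v \<Rightarrow> real" where
  "pullback_form A x k b \<equiv> (\<lambda>v w. if v \<in> fib A x \<and> w \<in> fib A x then b (k v) (k w) else 0)"

abbreviation tensor_sq_map where
  "tensor_sq_map A B \<kappa> k \<equiv> tensor_map A A B B \<kappa> k k"

lemma tensor_sq_map_eq:
  "tensor_sq_map A B \<kappa> k (x, t) =
     (\<kappa> x, \<lambda>b. if b \<in> bilin B B (\<kappa> x) then t (pullback_form A x k b) else 0)"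
  by (simp add: tensor_map_def)

lemma pullback_form_bilin:
  assumes "closed_fibre A x" "fibre_linear A x B y k" "b \<in> bilin B B y"
  shows "pullback_form A x k b \<in> bilin A A x"
  using assms unfolding closed_fibre_def fibre_linear_def bilin_def
  by (auto simp: image_subset_iff)

lemma tensor_sq_map_pure:
  assumes "closed_fibre A x" "fibre_linear A x B (\<kappa> x) k" "v \<in> fib A x" "w \<in> fib A x"
  shows "tensor_sq_map A B \<kappa> k (x, pure_tensor A A x v w) = (\<kappa> x, pure_tensor B B (\<kappa> x) (k v) (k w))"
  using assms(3,4) pullback_form_bilin[OF assms(1,2)]
  by (auto simp: tensor_sq_map_eq pure_tensor_def fun_eq_iff)

lemma tensor_sq_map_add:
  "tensor_sq_map A B \<kappa> k (x, t + t') =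
     (\<kappa> x, snd (tensor_sq_map A B \<kappa> k (x, t)) + snd (tensor_sq_map A B \<kappa> k (x, t')))"
  and tensor_sq_map_scale:
  "tensor_sq_map A B \<kappa> k (x, c *\<^sub>R t) = (\<kappa> x, c *\<^sub>R snd (tensor_sq_map A B \<kappa> k (x, t)))"
  and tensor_sq_map_zero: "tensor_sq_map A B \<kappa> k (x, 0) = (\<kappa> x, 0)"
  and fst_tensor_sq_map: "fst (tensor_sq_map A B \<kappa> k (x, t)) = \<kappa> x"
  by (auto simp: tensor_sq_map_eq fun_eq_iff scaleR_fun_def)

lemma subspace_tensor_fib: "subspace (tensor_fib E F x)"
  unfolding tensor_fib_def by (rule subspace_span)

lemma tensor_sq_map_tensor_fib:
  assumes "closed_fibre A x" "fibre_linear A x B (\<kappa> x) k" and t: "t \<in> tensor_fib A A x"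
  shows "snd (tensor_sq_map A B \<kappa> k (x, t)) \<in> tensor_fib B B (\<kappa> x)"
  using t unfolding tensor_fib_def[of A]
proof (rule span_induct)
  show "subspace {t. snd (tensor_sq_map A B \<kappa> k (x, t)) \<in> tensor_fib B B (\<kappa> x)}"
    by (rule subspaceI)
      (simp_all add: tensor_sq_map_add tensor_sq_map_scale tensor_sq_map_zero
        subspace_0[OF subspace_tensor_fib] subspace_add[OF subspace_tensor_fib]
        subspace_scale[OF subspace_tensor_fib])
  fix u assume "u \<in> {pure_tensor A A x v w |v w. v \<in> fib A x \<and> w \<in> fib A x}"
  then obtain v w where u: "u = pure_tensor A A x v w" "v \<in> fib A x" "w \<in> fib A x" by blast
  then have "k v \<in> fib B (\<kappa> x)" "k w \<in> fib B (\<kappa> x)"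
    using assms(2) by (auto simp: fibre_linear_def)
  then have "pure_tensor B B (\<kappa> x) (k v) (k w) \<in> tensor_fib B B (\<kappa> x)"
    unfolding tensor_fib_def by (blast intro: span_base)
  then show "snd (tensor_sq_map A B \<kappa> k (x, u)) \<in> tensor_fib B B (\<kappa> x)"
    using tensor_sq_map_pure[of A x B \<kappa> k v w] assms(1,2) u by simp
qed

text \<open>
  Pulling a bilinear form back in two steps is pulling it back along the composite; the only thing
  to see is that the intermediate form is not cut off, being bilinear.
\<close>

lemma tensor_sq_map_comp:
  assumes "closed_fibre B (\<kappa> x)" "fibre_linear A x B (\<kappa> x) k"
    "fibre_linear B (\<kappa> x) C (\<kappa>' (\<kappa> x)) k'"
  shows "tensor_sq_map B C \<kappa>' k' (tensor_sq_map A B \<kappa> k (x, t)) =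
    tensor_sq_map A C (\<kappa>' \<circ> \<kappa>) (k' \<circ> k) (x, t)"
proof -
  have "pullback_form A x k (pullback_form B (\<kappa> x) k' b) = pullback_form A x (k' \<circ> k) b" for b
    using assms(2) by (auto simp: fun_eq_iff fibre_linear_def image_subset_iff)
  then show ?thesis
    using pullback_form_bilin[OF assms(1,3)] by (auto simp: tensor_sq_map_eq fun_eq_iff)
qed

lemma tensor_sq_map_cong:
  assumes "\<kappa>' x = \<kappa> x" "\<And>v. v \<in> fib A x \<Longrightarrow> k' v = k v"
  shows "tensor_sq_map A B \<kappa>' k' (x, t) = tensor_sq_map A B \<kappa> k (x, t)"
proof -
  have "pullback_form A x k' b = pullback_form A x k b" for b
    using assms(2) by (auto simp: fun_eq_iff)
  then show ?thesis using assms(1) by (simp only: tensor_sq_map_eq)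
qed

lemma tensor_with_simps [simp]:
  "points (total (tensor_with E F D)) = Sigma (points (base E)) (tensor_fib E F)"
  "plots (total (tensor_with E F D)) = D"
  "base (tensor_with E F D) = base E" "proj (tensor_with E F D) = fst"
  "vadd (tensor_with E F D) a b = (fst a, snd a + snd b)"
  "vscale (tensor_with E F D) c a = (fst a, c *\<^sub>R snd a)"
  "vzero (tensor_with E F D) x = (x, 0)"
  by (simp_all add: tensor_with_def case_prod_unfold)

definition tensor_diffeologies where
  "tensor_diffeologies E F = {D. pseudo_bundle (tensor_with E F D) \<and>
          smooth_map (fibre_prod E F) (total (tensor_with E F D))
            (\<lambda>(v, w). (proj E v, pure_tensor E F (proj E v) v w))}"

lemma tensor_simps [simp]:
  "points (total (tensor E F)) = Sigma (points (base E)) (tensor_fib E F)"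
  "plots (total (tensor E F)) = \<Inter> (tensor_diffeologies E F)"
  "base (tensor E F) = base E" "proj (tensor E F) = fst"
  by (simp_all add: tensor_def tensor_diffeologies_def)

lemma diffeological_tensor_with:
  "D \<in> tensor_diffeologies E F \<Longrightarrow> diffeological_space (total (tensor_with E F D))"
  by (simp add: tensor_diffeologies_def pseudo_bundle_def)

lemma module_tensor_fibre:
  assumes "x \<in> points (base E)"
  shows "Module.module real_ring (fibre_module (tensor_with E F D) x)"
proof -
  note sub = subspace_tensor_fib[of E F x]
  have fib: "fib (tensor_with E F D) x = Pair x ` tensor_fib E F x"
    using assms by (auto simp: fib_def)
  have "cring real_ring"
  proof (rule cringI)
    show "abelian_group real_ring"
    proof (rule abelian_groupI)
      show "\<exists>y\<in>carrier real_ring. y \<oplus>\<^bsub>real_ring\<^esub> x = \<zero>\<^bsub>real_ring\<^esub>" for x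
        by (intro bexI[of _ "- x"]) (simp_all add: real_ring_def)
    qed (simp_all add: real_ring_def)
    show "comm_monoid real_ring"
      by (rule comm_monoidI) (simp_all add: real_ring_def)
  qed (simp add: real_ring_def algebra_simps)
  moreover have "abelian_group (fibre_module (tensor_with E F D) x)"
  proof (rule abelian_groupI)
    fix v assume "v \<in> carrier (fibre_module (tensor_with E F D) x)"
    then obtain t where "t \<in> tensor_fib E F x" "v = (x, t)" by (auto simp: fib)
    then show "\<exists>y\<in>carrier (fibre_module (tensor_with E F D) x).
        y \<oplus>\<^bsub>fibre_module (tensor_with E F D) x\<^esub> v = \<zero>\<^bsub>fibre_module (tensor_with E F D) x\<^esub>"
      using subspace_neg[OF sub] by (intro bexI[of _ "(x, - t)"]) (simp_all add: fib)
  qed (auto simp: fib subspace_0[OF sub] subspace_add[OF sub] add_ac)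
  ultimately show ?thesis
    by (rule moduleI) (auto simp: fib real_ring_def subspace_scale[OF sub] algebra_simps)
qed

text \<open>
  The diffeologies of the target square pull back: declaring smooth those families in the source
  square whose image is smooth gives a pseudo-bundle diffeology that makes the tensor product
  smooth, so it contains the smallest one.
\<close>

lemma smooth_map_tensor_sq_map:
  assumes baseA: "diffeological_space (base A)"
    and ptsA: "\<And>n U p. (n, U, p) \<in> plots (total A) \<Longrightarrow> p ` U \<subseteq> points (total A)"
    and projA: "smooth_map (total A) (base A) (proj A)"
    and k: "smooth_map (total A) (total B) k" and \<kappa>: "smooth_map (base A) (base B) \<kappa>"
    and fibA: "\<And>x. x \<in> points (base A) \<Longrightarrow> closed_fibre A x"
    and lin: "\<And>x. x \<in> points (base A) \<Longrightarrow> fibre_linear A x B (\<kappa> x) k"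
  shows "smooth_map (total (tensor A A)) (total (tensor B B)) (tensor_sq_map A B \<kappa> k)"
proof -
  define f where "f = tensor_sq_map A B \<kappa> k"
  define S where "S = Sigma (points (base A)) (tensor_fib A A)"
  have S: "a \<in> S \<longleftrightarrow> fst a \<in> points (base A) \<and> snd a \<in> tensor_fib A A (fst a)" for a
    by (cases a) (simp add: S_def)
  have f_fst: "fst (f a) = \<kappa> (fst a)" for a
    by (cases a) (simp add: f_def fst_tensor_sq_map)
  have f_add: "f (fst a, snd a + snd b) = (fst (f a), snd (f a) + snd (f b))"
    if "fst a = fst b" for a b
    using that by (cases a; cases b) (simp add: f_def tensor_sq_map_add fst_tensor_sq_map)
  have f_scale: "f (fst a, c *\<^sub>R snd a) = (fst (f a), c *\<^sub>R snd (f a))" for a c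
    by (cases a) (simp add: f_def tensor_sq_map_scale fst_tensor_sq_map)
  have f_zero: "f (x, 0) = (\<kappa> x, 0)" for x
    by (simp add: f_def tensor_sq_map_zero)
  have \<kappa>_pts: "\<kappa> x \<in> points (base B)" if "x \<in> points (base A)" for x
    using \<kappa> that unfolding smooth_map_def by blast
  have f_pts: "f a \<in> Sigma (points (base B)) (tensor_fib B B)" if a: "a \<in> S" for a
  proof -
    have "snd (f (fst a, snd a)) \<in> tensor_fib B B (\<kappa> (fst a))"
      unfolding f_def using a by (intro tensor_sq_map_tensor_fib fibA lin) (simp_all add: S)
    moreover have "\<kappa> (fst a) \<in> points (base B)" using a \<kappa>_pts by (simp add: S)
    ultimately show ?thesis
      using f_fst[of a] by (metis mem_Sigma_iff prod.collapse)
  qed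
  have S_add: "(fst a, snd a + snd b) \<in> S" if "a \<in> S" "b \<in> S" "fst a = fst b" for a b
    using that by (simp add: S subspace_add[OF subspace_tensor_fib])
  have S_scale: "(fst a, c *\<^sub>R snd a) \<in> S" if "a \<in> S" for a c
    using that by (simp add: S subspace_scale[OF subspace_tensor_fib])
  have S_zero: "(x, 0) \<in> S" if "x \<in> points (base A)" for x
    using that by (simp add: S subspace_0[OF subspace_tensor_fib])
  have pullback: "{(n, U, p). p ` U \<subseteq> S \<and> (n, U, fst \<circ> p) \<in> plots (base A) \<and> (n, U, f \<circ> p) \<in> D}
      \<in> tensor_diffeologies A A"
    if D: "D \<in> tensor_diffeologies B B" for D
  proof -
    define D' where "D' = {(n, U, p). p ` U \<subseteq> S \<and> (n, U, fst \<circ> p) \<in> plots (base A) \<and> (n, U, f \<circ> p) \<in> D}"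
    define TA where "TA = tensor_with A A D'"
    define TB where "TB = tensor_with B B D"
    have TA: "points (total TA) = S" "plots (total TA) = D'" "base TA = base A" "proj TA = fst"
      "\<And>a b. vadd TA a b = (fst a, snd a + snd b)" "\<And>c a. vscale TA c a = (fst a, c *\<^sub>R snd a)"
      "\<And>x. vzero TA x = (x, 0)"
      by (simp_all add: TA_def S_def)
    have TB: "points (total TB) = Sigma (points (base B)) (tensor_fib B B)"
      "plots (total TB) = D" "base TB = base B" "proj TB = fst"
      "\<And>a b. vadd TB a b = (fst a, snd a + snd b)" "\<And>c a. vscale TB c a = (fst a, c *\<^sub>R snd a)"
      "\<And>x. vzero TB x = (x, 0)"
      by (simp_all add: TB_def)
    have pbB: "pseudo_bundle TB"
      and pureB: "smooth_map (fibre_prod B B) (total TB)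
            (\<lambda>(v, w). (proj B v, pure_tensor B B (proj B v) v w))"
      using D unfolding tensor_diffeologies_def TB_def by blast+
    have dB: "diffeological_space (total TB)"
      and addB: "smooth_map (fibre_prod TB TB) (total TB) (\<lambda>(v, w). vadd TB v w)"
      and scaleB: "smooth_map (prod_diff real_diff (total TB)) (total TB) (\<lambda>(c, v). vscale TB c v)"
      and zeroB: "smooth_map (base TB) (total TB) (vzero TB)"
      using pbB[unfolded pseudo_bundle_def] by blast+
    have inD: "(n, U, p) \<in> D' \<longleftrightarrow> p ` U \<subseteq> S \<and> (n, U, fst \<circ> p) \<in> plots (base A) \<and>
        (n, U, f \<circ> p) \<in> plots (total TB)" for n U p
      by (simp add: D'_def TB)
    have inD_points: "p u \<in> S" if "(n, U, p) \<in> D'" "u \<in> U" for n U p u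
      using that unfolding inD by blast
    have dA: "diffeological_space (total TA)"
    proof (rule diffeological_spaceI; unfold TA)
      fix n U p assume p: "(n, U, p) \<in> D'"
      then have p': "p ` U \<subseteq> S" "(n, U, fst \<circ> p) \<in> plots (base A)" "(n, U, f \<circ> p) \<in> plots (total TB)"
        unfolding inD by blast+
      show U: "openin (Euclidean_space n) U" by (rule plot_openin[OF dB p'(3)])
      show "p ` U \<subseteq> S" by fact
      show "(n, U, q) \<in> D'" if q: "\<And>u. u \<in> U \<Longrightarrow> q u = p u" for q
      proof -
        have "(n, U, fst \<circ> q) \<in> plots (base A)"
          by (rule plot_cong[OF baseA p'(2)]) (simp add: q)
        moreover have "(n, U, f \<circ> q) \<in> plots (total TB)"
          by (rule plot_cong[OF dB p'(3)]) (simp add: q)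
        moreover have "q ` U = p ` U" using q by force
        ultimately show ?thesis using p'(1) unfolding inD by simp
      qed
      fix m W j assume W: "openin (Euclidean_space m) W" and j: "smooth_eucl m W n U j"
      have "(m, W, (fst \<circ> p) \<circ> j) \<in> plots (base A)" by (rule plot_comp[OF baseA p'(2) W j])
      moreover have "(m, W, (f \<circ> p) \<circ> j) \<in> plots (total TB)" by (rule plot_comp[OF dB p'(3) W j])
      moreover have "(p \<circ> j) ` W \<subseteq> S" using j p'(1) unfolding smooth_eucl_def by auto
      ultimately show "(m, W, p \<circ> j) \<in> D'" unfolding inD comp_assoc by blast
    next
      fix n U c assume U: "openin (Euclidean_space n) U" and c: "c \<in> S"
      have "(n, U, \<lambda>_. fst c) \<in> plots (base A)"
        using c by (intro plot_const[OF baseA U]) (simp add: S)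
      moreover have "(n, U, \<lambda>_. f c) \<in> plots (total TB)"
        using f_pts[OF c] by (intro plot_const[OF dB U]) (simp add: TB)
      ultimately show "(n, U, \<lambda>_. c) \<in> D'"
        using c unfolding inD o_def by blast
    next
      fix n U p assume U: "openin (Euclidean_space n) U" and
        loc: "\<And>u. u \<in> U \<Longrightarrow> \<exists>W. u \<in> W \<and> W \<subseteq> U \<and> openin (Euclidean_space n) W \<and> (n, W, p) \<in> D'"
      have "p u \<in> S" if "u \<in> U" for u
        using loc[OF that] inD_points by blast
      moreover have "(n, U, fst \<circ> p) \<in> plots (base A)"
      proof (rule plot_local[OF baseA U])
        fix u assume "u \<in> U"
        then show "\<exists>W. u \<in> W \<and> W \<subseteq> U \<and> openin (Euclidean_space n) W \<and> (n, W, fst \<circ> p) \<in> plots (base A)"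
          using loc unfolding inD by meson
      qed
      moreover have "(n, U, f \<circ> p) \<in> plots (total TB)"
      proof (rule plot_local[OF dB U])
        fix u assume "u \<in> U"
        then show "\<exists>W. u \<in> W \<and> W \<subseteq> U \<and> openin (Euclidean_space n) W \<and> (n, W, f \<circ> p) \<in> plots (total TB)"
          using loc unfolding inD by meson
      qed
      ultimately show "(n, U, p) \<in> D'" unfolding inD by blast
    qed
    have "pseudo_bundle TA"
      unfolding pseudo_bundle_def
    proof (intro conjI ballI dA)
      show "diffeological_space (base TA)" using baseA by (simp add: TA)
      show "smooth_map (total TA) (base TA) (proj TA)"
        unfolding smooth_map_def TA inD by (simp add: S image_subset_iff)
      show "proj TA ` points (total TA) = points (base TA)"
        unfolding TA
      proof (intro equalityI subsetI)
        fix x assume "x \<in> points (base A)"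
        from S_zero[OF this] show "x \<in> fst ` S" by (rule image_eqI[rotated]) simp
      qed (auto simp: S)
      show "Module.module real_ring (fibre_module TA x)" if "x \<in> points (base TA)" for x
        using that unfolding TA_def by (intro module_tensor_fibre) simp
      show "smooth_map (fibre_prod TA TA) (total TA) (\<lambda>(v, w). vadd TA v w)"
        unfolding smooth_map_def
      proof (intro conjI allI impI)
        show "(\<lambda>(v, w). vadd TA v w) ` points (fibre_prod TA TA) \<subseteq> points (total TA)"
          using S_add by (auto simp: fibre_prod_def sub_diff_def prod_diff_def TA)
        fix n U p assume "(n, U, p) \<in> plots (fibre_prod TA TA)"
        then have p1: "(n, U, fst \<circ> p) \<in> D'" and p2: "(n, U, snd \<circ> p) \<in> D'"
          and eq: "\<And>u. u \<in> U \<Longrightarrow> fst (fst (p u)) = fst (snd (p u))"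
          by (auto simp: fibre_prod_def sub_diff_def prod_diff_def TA)
        let ?a = "(\<lambda>(v, w). vadd TA v w) \<circ> p"
        let ?q = "\<lambda>u. (f (fst (p u)), f (snd (p u)))"
        have a: "?a u = (fst (fst (p u)), snd (fst (p u)) + snd (snd (p u)))" for u
          by (simp add: case_prod_unfold TA)
        have "(n, U, fst \<circ> ?q) \<in> plots (total TB)" "(n, U, snd \<circ> ?q) \<in> plots (total TB)"
          using p1 p2 unfolding inD by (simp_all add: o_def)
        then have "(n, U, ?q) \<in> plots (fibre_prod TB TB)"
          using eq by (auto simp: fibre_prod_def sub_diff_def prod_diff_def f_fst TB(4))
        then have "(n, U, (\<lambda>(v, w). vadd TB v w) \<circ> ?q) \<in> plots (total TB)"
          using addB unfolding smooth_map_def by blast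
        then have "(n, U, f \<circ> ?a) \<in> plots (total TB)"
        proof (rule plot_cong[OF dB])
          fix u assume "u \<in> U"
          then show "(f \<circ> ?a) u = ((\<lambda>(v, w). vadd TB v w) \<circ> ?q) u"
            using f_add[OF eq] by (simp add: case_prod_unfold TA TB)
        qed
        moreover have "(n, U, fst \<circ> (fst \<circ> p)) \<in> plots (base A)" using p1 unfolding inD by blast
        then have "(n, U, fst \<circ> ?a) \<in> plots (base A)"
          by (rule plot_cong[OF baseA]) (simp add: case_prod_unfold TA)
        moreover have "?a u \<in> S" if u: "u \<in> U" for u
          unfolding a using inD_points[OF p1 u] inD_points[OF p2 u] eq[OF u] by (intro S_add) simp_all
        ultimately show "(n, U, ?a) \<in> plots (total TA)" unfolding TA(2) inD by blast
      qed
      show "smooth_map (prod_diff real_diff (total TA)) (total TA) (\<lambda>(c, v). vscale TA c v)"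
        unfolding smooth_map_def
      proof (intro conjI allI impI)
        show "(\<lambda>(c, v). vscale TA c v) ` points (prod_diff real_diff (total TA)) \<subseteq> points (total TA)"
          using S_scale by (auto simp: prod_diff_def TA)
        fix n U p assume "(n, U, p) \<in> plots (prod_diff real_diff (total TA))"
        then have p1: "(n, U, fst \<circ> p) \<in> plots real_diff" and p2: "(n, U, snd \<circ> p) \<in> D'"
          by (auto simp: prod_diff_def TA)
        let ?a = "(\<lambda>(c, v). vscale TA c v) \<circ> p"
        let ?q = "\<lambda>u. (fst (p u), f (snd (p u)))"
        have a: "?a u = (fst (snd (p u)), fst (p u) *\<^sub>R snd (snd (p u)))" for u
          by (simp add: case_prod_unfold TA)
        have "(n, U, fst \<circ> ?q) \<in> plots real_diff" "(n, U, snd \<circ> ?q) \<in> plots (total TB)"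
          using p1 p2 unfolding inD by (simp_all add: o_def)
        then have "(n, U, ?q) \<in> plots (prod_diff real_diff (total TB))"
          by (simp add: prod_diff_def)
        then have "(n, U, (\<lambda>(c, v). vscale TB c v) \<circ> ?q) \<in> plots (total TB)"
          using scaleB unfolding smooth_map_def by blast
        then have "(n, U, f \<circ> ?a) \<in> plots (total TB)"
          by (rule plot_cong[OF dB]) (simp add: case_prod_unfold TA TB f_scale)
        moreover have "(n, U, fst \<circ> (snd \<circ> p)) \<in> plots (base A)" using p2 unfolding inD by blast
        then have "(n, U, fst \<circ> ?a) \<in> plots (base A)"
          by (rule plot_cong[OF baseA]) (simp add: case_prod_unfold TA)
        moreover have "?a u \<in> S" if u: "u \<in> U" for u
          unfolding a using inD_points[OF p2 u] by (intro S_scale) simp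
        ultimately show "(n, U, ?a) \<in> plots (total TA)" unfolding TA(2) inD by blast
      qed
      show "smooth_map (base TA) (total TA) (vzero TA)"
        unfolding smooth_map_def
      proof (intro conjI allI impI)
        show "vzero TA ` points (base TA) \<subseteq> points (total TA)"
          using S_zero by (auto simp: TA)
        fix n U p assume "(n, U, p) \<in> plots (base TA)"
        then have p: "(n, U, p) \<in> plots (base A)" by (simp add: TA)
        have "(n, U, \<kappa> \<circ> p) \<in> plots (base TB)" using p \<kappa> unfolding smooth_map_def TB by blast
        then have "(n, U, vzero TB \<circ> (\<kappa> \<circ> p)) \<in> plots (total TB)"
          using zeroB unfolding smooth_map_def by blast
        then have "(n, U, f \<circ> (vzero TA \<circ> p)) \<in> plots (total TB)"
          by (simp add: o_def f_zero TA TB)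
        moreover have "(vzero TA \<circ> p) u \<in> S" if "u \<in> U" for u
          using plot_points[OF baseA p] that S_zero by (auto simp: TA)
        moreover have "(n, U, fst \<circ> (vzero TA \<circ> p)) \<in> plots (base A)"
          using p by (simp add: o_def TA)
        ultimately show "(n, U, vzero TA \<circ> p) \<in> plots (total TA)" unfolding TA(2) inD by blast
      qed
    qed
    moreover have "smooth_map (fibre_prod A A) (total TA)
            (\<lambda>(v, w). (proj A v, pure_tensor A A (proj A v) v w))"
      (is "smooth_map _ _ ?pA")
      unfolding smooth_map_def
    proof (intro conjI allI impI)
      have pA: "(proj A v, pure_tensor A A (proj A v) v w) \<in> S"
        if "v \<in> points (total A)" "w \<in> points (total A)" "proj A v = proj A w" for v w
      proof -
        have "proj A v \<in> points (base A)" using that projA unfolding smooth_map_def by blast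
        moreover have "pure_tensor A A (proj A v) v w \<in> tensor_fib A A (proj A v)"
          unfolding tensor_fib_def using that by (intro span_base) (auto simp: fib_def)
        ultimately show ?thesis by (simp add: S)
      qed
      then show "?pA ` points (fibre_prod A A) \<subseteq> points (total TA)"
        by (auto simp: fibre_prod_def sub_diff_def prod_diff_def TA)
      fix n U p assume "(n, U, p) \<in> plots (fibre_prod A A)"
      then have p1: "(n, U, fst \<circ> p) \<in> plots (total A)" and p2: "(n, U, snd \<circ> p) \<in> plots (total A)"
        and eq: "\<And>u. u \<in> U \<Longrightarrow> proj A (fst (p u)) = proj A (snd (p u))"
        by (auto simp: fibre_prod_def sub_diff_def prod_diff_def)
      have pts: "fst (p u) \<in> points (total A)" "snd (p u) \<in> points (total A)" if "u \<in> U" for u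
        using ptsA[OF p1] ptsA[OF p2] that by auto
      have fibs: "proj A (fst (p u)) \<in> points (base A)" "fst (p u) \<in> fib A (proj A (fst (p u)))"
          "snd (p u) \<in> fib A (proj A (fst (p u)))" if u: "u \<in> U" for u
        using pts[OF u] eq[OF u] projA unfolding smooth_map_def by (auto simp: fib_def)
      have kfib: "k (fst (p u)) \<in> fib B (\<kappa> (proj A (fst (p u))))"
        "k (snd (p u)) \<in> fib B (\<kappa> (proj A (fst (p u))))" if u: "u \<in> U" for u
        using lin[OF fibs(1)[OF u]] fibs(2,3)[OF u] unfolding fibre_linear_def by blast+
      let ?q = "\<lambda>u. (k (fst (p u)), k (snd (p u)))"
      have "(n, U, k \<circ> (fst \<circ> p)) \<in> plots (total B)" "(n, U, k \<circ> (snd \<circ> p)) \<in> plots (total B)"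
        using k p1 p2 unfolding smooth_map_def by blast+
      then have "(n, U, ?q) \<in> plots (fibre_prod B B)"
        using kfib by (auto simp: fibre_prod_def sub_diff_def prod_diff_def o_def fib_def)
      then have q: "(n, U, (\<lambda>(v, w). (proj B v, pure_tensor B B (proj B v) v w)) \<circ> ?q) \<in> plots (total TB)"
        using pureB unfolding smooth_map_def by blast
      have "(n, U, f \<circ> (?pA \<circ> p)) \<in> plots (total TB)"
      proof (rule plot_cong[OF dB q])
        fix u assume u: "u \<in> U"
        have "proj B (k (fst (p u))) = \<kappa> (proj A (fst (p u)))" using kfib[OF u] by (simp add: fib_def)
        then show "(f \<circ> (?pA \<circ> p)) u = ((\<lambda>(v, w). (proj B v, pure_tensor B B (proj B v) v w)) \<circ> ?q) u"
          using tensor_sq_map_pure[of A "proj A (fst (p u))" B \<kappa> k, OF fibA lin] fibs[OF u]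
          by (simp add: case_prod_unfold f_def)
      qed
      moreover have "(n, U, proj A \<circ> (fst \<circ> p)) \<in> plots (base A)"
        using projA p1 unfolding smooth_map_def by blast
      then have "(n, U, fst \<circ> (?pA \<circ> p)) \<in> plots (base A)"
        by (rule plot_cong[OF baseA]) (simp add: case_prod_unfold)
      moreover have "(?pA \<circ> p) u \<in> S" if u: "u \<in> U" for u
        using pA[OF pts[OF u] eq[OF u]] by (simp add: case_prod_unfold)
      ultimately show "(n, U, ?pA \<circ> p) \<in> plots (total TA)" unfolding TA(2) inD by blast
    qed
    ultimately show ?thesis unfolding tensor_diffeologies_def TA_def D'_def by blast
  qed
  have "smooth_map (total (tensor A A)) (total (tensor B B)) f"
    unfolding smooth_map_def tensor_simps
  proof (intro conjI allI impI InterI)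
    show "f ` Sigma (points (base A)) (tensor_fib A A) \<subseteq> Sigma (points (base B)) (tensor_fib B B)"
      using f_pts unfolding S_def by blast
    fix n U p D assume "(n, U, p) \<in> \<Inter> (tensor_diffeologies A A)" "D \<in> tensor_diffeologies B B"
    then show "(n, U, f \<circ> p) \<in> D"
      using pullback[of D] by blast
  qed
  then show ?thesis unfolding f_def .
qed


section \<open>Transport of pseudo-metrics between fibres\<close>

definition fibre_metric ::
    "('v, 'x) pbundle \<Rightarrow> 'x \<Rightarrow> (('v, 'x) dual_pt, ('v, 'x) dual_pt) tens \<Rightarrow> bool" where
  "fibre_metric E x t \<longleftrightarrow> t \<in> tensor_fib (dual E) (dual E) x \<and>
     (\<forall>v\<in>fib E x. \<forall>w\<in>fib E x. form_of E (x, t) v w = form_of E (x, t) w v) \<and>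
     (\<forall>v\<in>fib E x. form_of E (x, t) v v \<ge> 0) \<and>
     form_rank (fib E x) (form_of E (x, t)) = dim (dual_fib E x)"

text \<open>
  The ambient space is a space of functions and may have infinite dimension, so finiteness has to
  come from \<open>F\<close>.
\<close>

lemma subspace_eq_if_dim_eq:
  fixes R W :: "'a::real_vector set"
  assumes "subspace R" "R \<subseteq> W" "W \<subseteq> span F" "finite F" "dim R = dim W"
  shows "R = W"
proof (rule ccontr)
  assume "R \<noteq> W"
  then obtain a where a: "a \<in> W" "a \<notin> R" using assms(2) by blast
  obtain B where B: "B \<subseteq> R" "independent B" "R \<subseteq> span B" "card B = dim R"
    by (rule basis_exists)
  have sB: "span B = R" using B assms(1) span_minimal by blast
  have ind: "independent (insert a B)" and aB: "a \<notin> B"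
    using a B sB by (auto simp: independent_insert)
  obtain C where C: "C \<subseteq> W" "independent C" "W \<subseteq> span C" "card C = dim W"
    by (rule basis_exists)
  have "finite C"
    using independent_span_bound[OF assms(4) C(2)] C(1) assms(3) by blast
  moreover have "insert a B \<subseteq> span C" using a B(1) assms(2) C(3) by blast
  ultimately have "finite (insert a B) \<and> card (insert a B) \<le> card C"
    by (intro independent_span_bound ind)
  with aB B(4) C(4) assms(5) show False by auto
qed

text \<open>
  Full rank says exactly that every smooth functional on the fibre is the pairing with a vector:
  the functionals \<open>g(v, _)\<close> form a subspace of the dual fibre of the same finite dimension.
\<close>

lemma fibre_metric_surj:
  assumes x: "x \<in> points (base E)" and op: "open_plots (total E)" and det: "finitely_determined E x"
    and cl: "closed_fibre E x" and g: "fibre_metric E x t" and l: "l \<in> dual_fib E x"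
  obtains v where "v \<in> fib E x" "\<And>w. w \<in> fib E x \<Longrightarrow> form_of E (x, t) v w = l w"
proof -
  note cld = closed_fibre_dual[OF op x]
  let ?r = "\<lambda>v w. if w \<in> fib E x then form_of E (x, t) v w else 0"
  have t: "t \<in> tensor_fib (dual E) (dual E) x" using g by (simp add: fibre_metric_def)
  have eadd: "eval_form E x (vadd E v v') w = eval_form E x v w + eval_form E x v' w"
    if "v \<in> fib E x" "v' \<in> fib E x" for v v' w
    using that by (auto simp: fun_eq_iff eval_form_def fib_dual[OF x] dual_fib_def algebra_simps)
  have escale: "eval_form E x (vscale E c v) w = c *\<^sub>R eval_form E x v w"
    if "v \<in> fib E x" for c v w
    using that by (auto simp: fun_eq_iff eval_form_def fib_dual[OF x] dual_fib_def scaleR_fun_def)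
  have add: "?r (vadd E v v') = ?r v + ?r v'" if "v \<in> fib E x" "v' \<in> fib E x" for v v'
    using that by (auto simp: fun_eq_iff form_of_eq eadd tensor_fib_add[OF t] eval_form_bilin[OF cld])
  have scale: "?r (vscale E c v) = c *\<^sub>R ?r v" if "v \<in> fib E x" for c v
    using that by (auto simp: fun_eq_iff form_of_eq escale tensor_fib_scale[OF t] eval_form_bilin[OF cld]
        scaleR_fun_def[of c "\<lambda>w. if w \<in> fib E x then _ w else 0"])
  have "subspace (?r ` fib E x)"
  proof (rule subspaceI)
    obtain v where v: "v \<in> fib E x" using cl by (auto simp: closed_fibre_def)
    then have "?r (vscale E 0 v) = 0" "vscale E 0 v \<in> fib E x"
      using scale[OF v, of 0] cl by (auto simp: closed_fibre_def)
    then show "0 \<in> ?r ` fib E x" by (intro image_eqI[of _ _ "vscale E 0 v"]) (rule sym)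
  next
    fix a b assume "a \<in> ?r ` fib E x" "b \<in> ?r ` fib E x"
    then obtain v v' where v: "v \<in> fib E x" "v' \<in> fib E x" "a = ?r v" "b = ?r v'" by blast
    have "a + b = ?r (vadd E v v')" unfolding v(3,4) by (rule add[OF v(1,2), symmetric])
    moreover have "vadd E v v' \<in> fib E x" using v cl by (simp add: closed_fibre_def)
    ultimately show "a + b \<in> ?r ` fib E x" by (rule image_eqI)
  next
    fix c :: real and a assume "a \<in> ?r ` fib E x"
    then obtain v where v: "v \<in> fib E x" "a = ?r v" by blast
    have "c *\<^sub>R a = ?r (vscale E c v)" unfolding v(2) by (rule scale[OF v(1), symmetric])
    moreover have "vscale E c v \<in> fib E x" using v cl by (simp add: closed_fibre_def)
    ultimately show "c *\<^sub>R a \<in> ?r ` fib E x" by (rule image_eqI)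
  qed
  moreover have "?r ` fib E x \<subseteq> dual_fib E x"
    using form_of_dual_fib[OF x op t] by blast
  moreover obtain B w where B: "finite B" "B \<subseteq> fib E x" "\<And>u. u \<in> B \<Longrightarrow> w u \<in> dual_fib E x"
    "\<And>l. l \<in> dual_fib E x \<Longrightarrow> l = (\<Sum>u\<in>B. l u *\<^sub>R w u)"
    by (rule dual_fib_coordinates[OF op det]) blast
  have "dual_fib E x \<subseteq> span (w ` B)"
  proof
    fix a assume "a \<in> dual_fib E x"
    then have "a = (\<Sum>u\<in>B. a u *\<^sub>R w u)" by (rule B(4))
    moreover have "(\<Sum>u\<in>B. a u *\<^sub>R w u) \<in> span (w ` B)"
      by (intro span_sum span_scale span_base imageI)
    ultimately show "a \<in> span (w ` B)" by (rule ssubst[where P = "\<lambda>a. a \<in> span (w ` B)"])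
  qed
  moreover have "finite (w ` B)" using B by simp
  moreover have "dim (?r ` fib E x) = dim (dual_fib E x)"
    using g by (simp add: fibre_metric_def form_rank_def)
  ultimately have "?r ` fib E x = dual_fib E x" by (rule subspace_eq_if_dim_eq)
  then obtain v where "v \<in> fib E x" "l = ?r v" using l by blast
  then show ?thesis using that[of v] by simp
qed

text \<open>
  The dual fibres need only be linearly isomorphic. Since a fibre maps onto the dual of its dual
  fibre, \<open>K\<close> has an adjoint \<open>v \<mapsto> v'\<close> on fibres, determined up to vectors that no functional sees,
  and the transported form is \<open>(v, w) \<mapsto> g(v', w')\<close>. Symmetry and positivity are then immediate,
  and surjectivity of \<open>v \<mapsto> g(v, _)\<close> is inherited because every vector is such an adjoint.
\<close>

lemma fibre_metric_transport:
  assumes x: "x \<in> points (base E)" and opE: "open_plots (total E)"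
    and detE: "finitely_determined E x" and clE: "closed_fibre E x"
    and x': "\<kappa> x \<in> points (base F)" and opF: "open_plots (total F)"
    and detF: "finitely_determined F (\<kappa> x)" and clF: "closed_fibre F (\<kappa> x)"
    and K: "fibre_linear (dual E) x (dual F) (\<kappa> x) K"
    and inj: "inj_on K (fib (dual E) x)" and surj: "K ` fib (dual E) x = fib (dual F) (\<kappa> x)"
    and g: "fibre_metric E x t"
  shows "fibre_metric F (\<kappa> x) (snd (tensor_sq_map (dual E) (dual F) \<kappa> K (x, t)))"
proof -
  note cldE = closed_fibre_dual[OF opE x] and cldF = closed_fibre_dual[OF opF x']
  let ?x' = "\<kappa> x"
  define t' where "t' = snd (tensor_sq_map (dual E) (dual F) \<kappa> K (x, t))"
  have t: "t \<in> tensor_fib (dual E) (dual E) x" using g by (simp add: fibre_metric_def)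
  have t': "t' \<in> tensor_fib (dual F) (dual F) ?x'"
    unfolding t'_def by (rule tensor_sq_map_tensor_fib) fact+
  define K' where "K' = inv_into (fib (dual E) x) K"
  have K'K: "K' (K a) = a" if "a \<in> fib (dual E) x" for a
    unfolding K'_def using inj that by simp
  have K': "fibre_linear (dual F) ?x' (dual E) x K'"
    by (rule fibre_linear_inverse[OF K cldE surj K'K])
  have Kfib: "K a \<in> fib (dual F) ?x'" if "a \<in> fib (dual E) x" for a
    using surj that by blast
  \<comment> \<open>the adjoint of \<open>K\<close>, and below the adjoint of its inverse\<close>
  have adj: "\<exists>u\<in>fib E x. \<forall>a\<in>fib (dual E) x. snd (K a) v = snd a u" if "v \<in> fib F ?x'" for v
  proof -
    have Ladd: "snd (K (x, a + b)) v = snd (K (x, a)) v + snd (K (x, b)) v"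
      if "a \<in> dual_fib E x" "b \<in> dual_fib E x" for a b
    proof -
      have "K (vadd (dual E) (x, a) (x, b)) = vadd (dual F) (K (x, a)) (K (x, b))"
        using K that unfolding fibre_linear_def fib_dual[OF x] by blast
      then show ?thesis by simp
    qed
    have Lscale: "snd (K (x, c *\<^sub>R a)) v = c * snd (K (x, a)) v" if "a \<in> dual_fib E x" for c a
    proof -
      have "K (vscale (dual E) c (x, a)) = vscale (dual F) c (K (x, a))"
        using K that unfolding fibre_linear_def fib_dual[OF x] by blast
      then show ?thesis by (simp add: scaleR_fun_def)
    qed
    obtain u where "u \<in> fib E x" "\<And>l. l \<in> dual_fib E x \<Longrightarrow> snd (K (x, l)) v = l u"
      using dual_functional_evaluation[OF clE opE detE, of "\<lambda>l. snd (K (x, l)) v"] Ladd Lscale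
      by blast
    then show ?thesis by (auto simp: fib_dual[OF x])
  qed
  have coadj: "\<exists>v\<in>fib F ?x'. \<forall>a\<in>fib (dual E) x. snd (K a) v = snd a u" if "u \<in> fib E x" for u
  proof -
    have Ladd: "snd (K' (?x', a + b)) u = snd (K' (?x', a)) u + snd (K' (?x', b)) u"
      if "a \<in> dual_fib F ?x'" "b \<in> dual_fib F ?x'" for a b
    proof -
      have "K' (vadd (dual F) (?x', a) (?x', b)) = vadd (dual E) (K' (?x', a)) (K' (?x', b))"
        using K' that unfolding fibre_linear_def fib_dual[OF x'] by blast
      then show ?thesis by simp
    qed
    have Lscale: "snd (K' (?x', c *\<^sub>R a)) u = c * snd (K' (?x', a)) u" if "a \<in> dual_fib F ?x'" for c a
    proof -
      have "K' (vscale (dual F) c (?x', a)) = vscale (dual E) c (K' (?x', a))"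
        using K' that unfolding fibre_linear_def fib_dual[OF x'] by blast
      then show ?thesis by (simp add: scaleR_fun_def)
    qed
    obtain v where v: "v \<in> fib F ?x'" "\<And>l. l \<in> dual_fib F ?x' \<Longrightarrow> snd (K' (?x', l)) u = l v"
      using dual_functional_evaluation[OF clF opF detF, of "\<lambda>l. snd (K' (?x', l)) u"] Ladd Lscale
      by blast
    have "snd (K a) v = snd a u" if a: "a \<in> fib (dual E) x" for a
    proof -
      obtain l where l: "l \<in> dual_fib F ?x'" "K a = (?x', l)"
        using Kfib[OF a] unfolding fib_dual[OF x'] by blast
      have "snd (K' (K a)) u = l v" unfolding l(2) by (rule v(2)[OF l(1)])
      then show ?thesis using K'K[OF a] l(2) by simp
    qed
    with v(1) show ?thesis by blast
  qed
  have form: "form_of F (?x', t') v w = form_of E (x, t) v' w'"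
    if "\<forall>a\<in>fib (dual E) x. snd (K a) v = snd a v'" "\<forall>a\<in>fib (dual E) x. snd (K a) w = snd a w'"
    for v w v' w'
  proof -
    have "form_of F (?x', t') v w = t (pullback_form (dual E) x K (eval_form F ?x' v w))"
      unfolding t'_def form_of_eq tensor_sq_map_eq by (simp add: eval_form_bilin[OF cldF])
    also have "pullback_form (dual E) x K (eval_form F ?x' v w) = eval_form E x v' w'"
      using that Kfib by (auto simp: fun_eq_iff eval_form_def)
    finally show ?thesis by (simp add: form_of_eq)
  qed
  have sym: "form_of F (?x', t') v w = form_of F (?x', t') w v"
    if vw: "v \<in> fib F ?x'" "w \<in> fib F ?x'" for v w
  proof -
    obtain v' w' where "v' \<in> fib E x" "\<forall>a\<in>fib (dual E) x. snd (K a) v = snd a v'"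
      "w' \<in> fib E x" "\<forall>a\<in>fib (dual E) x. snd (K a) w = snd a w'"
      using adj[OF vw(1)] adj[OF vw(2)] by blast
    then show ?thesis using g form[of v v' w w'] form[of w w' v v'] by (simp add: fibre_metric_def)
  qed
  have pos: "form_of F (?x', t') v v \<ge> 0" if v: "v \<in> fib F ?x'" for v
  proof -
    obtain v' where "v' \<in> fib E x" "\<forall>a\<in>fib (dual E) x. snd (K a) v = snd a v'"
      using adj[OF v] by blast
    then show ?thesis using g form[of v v' v v'] by (simp add: fibre_metric_def)
  qed
  let ?r = "\<lambda>v w. if w \<in> fib F ?x' then form_of F (?x', t') v w else 0"
  \<comment> \<open>\<open>l\<close> corresponds to a functional \<open>c = g(u, _)\<close> of the source, and \<open>v\<close> is chosen with \<open>v' = u\<close>\<close>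
  have "l \<in> ?r ` fib F ?x'" if l: "l \<in> dual_fib F ?x'" for l
  proof -
    have "(?x', l) \<in> fib (dual F) ?x'" using l by (simp add: fib_dual[OF x'])
    then obtain c where c: "c \<in> dual_fib E x" "K (x, c) = (?x', l)"
      using surj unfolding fib_dual[OF x] by force
    obtain u where u: "u \<in> fib E x" "\<And>w. w \<in> fib E x \<Longrightarrow> form_of E (x, t) u w = c w"
      by (rule fibre_metric_surj[OF x opE detE clE g c(1)]) blast
    obtain v where v: "v \<in> fib F ?x'" "\<forall>a\<in>fib (dual E) x. snd (K a) v = snd a u"
      using coadj[OF u(1)] by blast
    have "form_of F (?x', t') v w = l w" if w: "w \<in> fib F ?x'" for w
    proof -
      obtain w' where w': "w' \<in> fib E x" "\<forall>a\<in>fib (dual E) x. snd (K a) w = snd a w'"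
        using adj[OF w] by blast
      have "form_of F (?x', t') v w = c w'" using form[OF v(2) w'(2)] u(2)[OF w'(1)] by simp
      also have "\<dots> = snd (K (x, c)) w" using w'(2) c(1) by (simp add: fib_dual[OF x])
      finally show ?thesis by (simp add: c(2))
    qed
    then have "l = ?r v" using dual_fib_outside[OF l] by (auto simp: fun_eq_iff)
    with v(1) show ?thesis by blast
  qed
  then have "?r ` fib F ?x' = dual_fib F ?x'"
    using form_of_dual_fib[OF x' opF t'] by blast
  with t' sym pos show ?thesis
    unfolding t'_def[symmetric] fibre_metric_def form_rank_def by simp
qed

section \<open>Pseudo-metrics on a glued bundle\<close>

lemma smooth_map_plot: "smooth_map X Z k \<Longrightarrow> (n, U, p) \<in> plots X \<Longrightarrow> (n, U, k \<circ> p) \<in> plots Z"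
  unfolding smooth_map_def by blast

lemma smooth_map_comp:
  "smooth_map X Z k \<Longrightarrow> smooth_map Z T k' \<Longrightarrow> smooth_map X T (k' \<circ> k)"
  unfolding smooth_map_def by (auto simp: comp_assoc image_subset_iff)

lemma openin_dom_prod:
  assumes U: "openin (Euclidean_space n) U" and U': "openin (Euclidean_space m) U'"
  shows "openin (Euclidean_space (n + m)) (dom_prod n U m U')"
proof -
  have proj: "continuous_map (Euclidean_space (n + m)) euclideanreal (\<lambda>w. w i)" for i
    unfolding Euclidean_space_def
    by (intro continuous_map_from_subtopology continuous_map_product_projection) simp
  have "continuous_map (Euclidean_space (n + m)) euclideanreal (\<lambda>w. fst_part n w i)" for i
    using proj[of i] by (cases "i < n") (simp_all add: fst_part_def)
  then have "continuous_map (Euclidean_space (n + m)) (powertop_real UNIV) (fst_part n)"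
    by (subst continuous_map_componentwise_UNIV) auto
  then have 1: "continuous_map (Euclidean_space (n + m)) (Euclidean_space n) (fst_part n)"
    unfolding Euclidean_space_def[of n] by (auto simp: continuous_map_in_subtopology fst_part_def)
  have "continuous_map (Euclidean_space (n + m)) (powertop_real UNIV) (snd_part n)"
    by (subst continuous_map_componentwise_UNIV) (auto simp: snd_part_def proj)
  then have 2: "continuous_map (Euclidean_space (n + m)) (Euclidean_space m) (snd_part n)"
    unfolding Euclidean_space_def[of m]
    by (auto simp: continuous_map_in_subtopology snd_part_def topspace_Euclidean_space)
  have "dom_prod n U m U' = {w \<in> topspace (Euclidean_space (n + m)). fst_part n w \<in> U} \<inter>
      {w \<in> topspace (Euclidean_space (n + m)). snd_part n w \<in> U'}"
    by (auto simp: dom_prod_def)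
  then show ?thesis
    using openin_continuous_map_preimage[OF 1 U] openin_continuous_map_preimage[OF 2 U'] by auto
qed

lemma open_plots_diffeological: "diffeological_space X \<Longrightarrow> open_plots X"
  by (intro allI impI, erule plot_openin)

lemma pseudo_metricsD:
  assumes g: "g \<in> pseudo_metrics E" and x: "x \<in> points (base E)"
  shows "g x = (x, snd (g x))" and "fibre_metric E x (snd (g x))"
proof -
  have "fst (g x) = x" using g x by (simp add: pseudo_metrics_def)
  then show eq: "g x = (x, snd (g x))" by (simp add: prod_eq_iff)
  have "g x \<in> Sigma (points (base E)) (tensor_fib (dual E) (dual E))"
    using g x by (auto simp: pseudo_metrics_def fun_diff_def Let_def)
  then have "snd (g x) \<in> tensor_fib (dual E) (dual E) x" using eq by (metis mem_Sigma_iff)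
  moreover have "form_of E (x, snd (g x)) = form_of E (g x)" using eq by simp
  ultimately show "fibre_metric E x (snd (g x))"
    using g x unfolding fibre_metric_def pseudo_metrics_def by simp
qed

lemma pseudo_metrics_subset:
  "pseudo_metrics E \<subseteq> {g \<in> points (base E) \<rightarrow>\<^sub>E points (total (dual_sq E)).
     smooth_map (base E) (total (dual_sq E)) g}"
  by (rule subsetI) (simp add: pseudo_metrics_def fun_diff_def Let_def)

lemma pseudo_metrics_smooth:
  "g \<in> pseudo_metrics E \<Longrightarrow> smooth_map (base E) (total (dual_sq E)) g"
  by (simp add: pseudo_metrics_def fun_diff_def Let_def)

lemma pseudo_metricsI:
  assumes "g \<in> extensional (points (base E))"
    and "smooth_map (base E) (total (dual_sq E)) g"
    and "\<And>x. x \<in> points (base E) \<Longrightarrow> fst (g x) = x \<and> fibre_metric E x (snd (g x))"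
  shows "g \<in> pseudo_metrics E"
proof -
  have eq: "g x = (x, snd (g x))" if "x \<in> points (base E)" for x
    using assms(3)[OF that] by (simp add: prod_eq_iff)
  have "g x \<in> Sigma (points (base E)) (tensor_fib (dual E) (dual E))" if "x \<in> points (base E)" for x
    using assms(3)[OF that] that by (subst eq) (auto simp: fibre_metric_def)
  then have "g \<in> points (fun_diff (base E) (total (dual_sq E)))"
    using assms(1,2) by (auto simp: fun_diff_def Let_def PiE_def)
  moreover have "form_of E (g x) = form_of E (x, snd (g x))" if "x \<in> points (base E)" for x
    using eq[OF that] by simp
  ultimately show ?thesis
    using assms(3) unfolding pseudo_metrics_def fibre_metric_def by simp
qed

text \<open>
  Two gluings are in play: \<open>P\<close> glues the bundles along \<open>f\<close>, and \<open>Q\<close> glues their duals in the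
  opposite direction, along the inverse of \<open>f\<close>.
\<close>

locale dual_gluing =
  fixes E1 :: "('v1, 'x1) pbundle" and E2 :: "('v2, 'x2) pbundle"
    and Y :: "'x1 set" and f :: "'x1 \<Rightarrow> 'x2" and h :: "'v1 \<Rightarrow> 'v2"
    and \<psi> :: "(('v1 + 'v2) set, ('x1 + 'x2) set) dual_pt \<Rightarrow>
      (('v2, 'x2) dual_pt + ('v1, 'x1) dual_pt) set"
  assumes fd1: "finite_dim_pseudo_bundle E1" and fd2: "finite_dim_pseudo_bundle E2"
    and Y: "Y \<subseteq> points (base E1)"
    and f: "diffeomorphism (sub_diff (base E1) Y) (sub_diff (base E2) (f ` Y)) f"
    and h: "smooth_linear_lift E1 E2 Y f h"
    and \<psi>: "gluing_dual_commutativity E1 E2 Y f h \<psi>"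
begin

lemma bundle1: "diffeological_space (total E1)" "diffeological_space (base E1)"
    "smooth_map (total E1) (base E1) (proj E1)"
    "x \<in> points (base E1) \<Longrightarrow> Module.module real_ring (fibre_module E1 x)"
    "x \<in> points (base E1) \<Longrightarrow> finite_dim (fibre_module E1 x)"
  using fd1[unfolded finite_dim_pseudo_bundle_def pseudo_bundle_def] by blast+

lemma bundle2: "diffeological_space (total E2)" "diffeological_space (base E2)"
    "smooth_map (total E2) (base E2) (proj E2)"
    "z \<in> points (base E2) \<Longrightarrow> Module.module real_ring (fibre_module E2 z)"
    "z \<in> points (base E2) \<Longrightarrow> finite_dim (fibre_module E2 z)"
  using fd2[unfolded finite_dim_pseudo_bundle_def pseudo_bundle_def] by blast+

lemma open1: "open_plots (total E1)" "open_plots (base E1)"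
  by (rule open_plots_diffeological, rule bundle1)+

lemma open2: "open_plots (total E2)" "open_plots (base E2)"
  by (rule open_plots_diffeological, rule bundle2)+

lemma f_props: "f ` Y \<subseteq> points (base E2)" "inj_on f Y"
proof -
  have "bij_betw f (points (base E1) \<inter> Y) (points (base E2) \<inter> f ` Y)"
    using f by (simp add: diffeomorphism_def sub_diff_def)
  moreover have "points (base E1) \<inter> Y = Y" using Y by blast
  ultimately have bij: "bij_betw f Y (points (base E2) \<inter> f ` Y)" by simp
  show "f ` Y \<subseteq> points (base E2)" using bij_betw_imp_surj_on[OF bij] by blast
  show "inj_on f Y" by (rule bij_betw_imp_inj_on[OF bij])
qed

lemma h_fibre_linear: "y \<in> Y \<Longrightarrow> fibre_linear E1 y E2 (f y) h"
proof -
  assume y: "y \<in> Y"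
  have "h v \<in> fib E2 (f y)" if v: "v \<in> fib E1 y" for v
  proof -
    have ov: "v \<in> over E1 Y" "v \<in> points (total E1)" using v y by (auto simp: fib_def over_def)
    then have "h v \<in> points (total E2)"
      using h unfolding smooth_linear_lift_def smooth_map_def by (auto simp: sub_diff_def)
    moreover have "proj E2 (h v) = f y"
      using h ov v unfolding smooth_linear_lift_def by (auto simp: fib_def)
    ultimately show ?thesis by (simp add: fib_def)
  qed
  then show "fibre_linear E1 y E2 (f y) h"
    using h y unfolding smooth_linear_lift_def fibrewise_linear_def fibre_linear_def by blast
qed

sublocale P: gluing E1 E2 Y f h
proof
  show "proj E1 ` points (total E1) \<subseteq> points (base E1)"
    "proj E2 ` points (total E2) \<subseteq> points (base E2)"
    using bundle1(3) bundle2(3) by (simp_all add: smooth_map_def)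
  show "closed_fibre E1 x" if "x \<in> points (base E1)" for x
    by (rule closed_fibre_module[OF bundle1(4)[OF that]])
  show "closed_fibre E2 x" if "x \<in> points (base E2)" for x
    by (rule closed_fibre_module[OF bundle2(4)[OF that]])
qed (fact Y f_props h_fibre_linear)+

text \<open>
  The lift sends plots of the fibre over \<open>y\<close> to plots of the fibre over \<open>f y\<close>, on which \<open>l\<close> is smooth.
\<close>

lemma dual_map_in_dual_fib:
  assumes y: "y \<in> Y" and l: "l \<in> dual_fib E2 (f y)"
  shows "(\<lambda>v. if v \<in> fib E1 y then l (h v) else 0) \<in> dual_fib E1 y" (is "?l \<in> _")
proof -
  note lin = h_fibre_linear[OF y]
  have hv: "h v \<in> fib E2 (f y)" if "v \<in> fib E1 y" for v
    using lin that unfolding fibre_linear_def by blast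
  have cl: "vadd E1 v w \<in> fib E1 y" "vscale E1 c v \<in> fib E1 y"
    if "v \<in> fib E1 y" "w \<in> fib E1 y" for c v w
    using P.fibre1[of y] Y y that unfolding closed_fibre_def by blast+
  have "(n, U, ?l \<circ> p) \<in> plots real_diff" if p: "(n, U, p) \<in> plots (sub_diff (total E1) (fib E1 y))"
    for n U p
  proof -
    have p': "(n, U, p) \<in> plots (total E1)" "p ` U \<subseteq> fib E1 y"
      using p by (simp_all add: sub_diff_def)
    then have "(n, U, p) \<in> plots (sub_diff (total E1) (over E1 Y))"
      using y by (auto simp: sub_diff_def fib_def over_def)
    then have "(n, U, h \<circ> p) \<in> plots (sub_diff (total E2) (over E2 (f ` Y)))"
      using h unfolding smooth_linear_lift_def smooth_map_def by blast
    then have "(n, U, h \<circ> p) \<in> plots (sub_diff (total E2) (fib E2 (f y)))"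
      using p'(2) hv by (auto simp: sub_diff_def)
    then have "(n, U, l \<circ> (h \<circ> p)) \<in> plots real_diff"
      using l unfolding dual_fib_def smooth_map_def by blast
    then have "openin (Euclidean_space n) U \<and> smooth_real n U (l \<circ> (h \<circ> p))"
      by (simp add: real_diff_def)
    moreover have "smooth_real n U (?l \<circ> p)"
      by (rule smooth_real_cong[of n U "l \<circ> (h \<circ> p)"]) (use calculation p'(2) in auto)
    ultimately show ?thesis by (simp add: real_diff_def)
  qed
  then have "smooth_map (sub_diff (total E1) (fib E1 y)) real_diff ?l"
    by (simp add: smooth_map_def) (simp add: real_diff_def)
  moreover have "?l (vadd E1 v w) = ?l v + ?l w" if vw: "v \<in> fib E1 y" "w \<in> fib E1 y" for v w
    using vw cl[OF vw] hv lin l by (simp add: dual_fib_def fibre_linear_def)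
  moreover have "?l (vscale E1 c v) = c * ?l v" if v: "v \<in> fib E1 y" for c v
    using v cl[OF v v] hv lin l by (simp add: dual_fib_def fibre_linear_def)
  ultimately show ?thesis unfolding dual_fib_def by simp
qed

abbreviation "dm \<equiv> dual_map E1 Y f h"

lemma dual_map_f:
  "y \<in> Y \<Longrightarrow> dm (f y, l) = (y, \<lambda>v. if v \<in> fib E1 y then l (h v) else 0)"
  using f_props(2) by (simp add: dual_map_def Let_def)

lemma dual_map_fibre_linear:
  assumes y: "y \<in> Y"
  shows "fibre_linear (dual E2) (f y) (dual E1) y dm"
proof -
  have fy: "f y \<in> points (base E2)" and yb: "y \<in> points (base E1)" using y Y f_props by auto
  show ?thesis
    unfolding fibre_linear_def fib_dual[OF fy] fib_dual[OF yb]
    using dual_map_in_dual_fib[OF y]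
    by (auto simp: dual_map_f[OF y] fun_eq_iff scaleR_fun_def)
qed

sublocale Q: gluing "dual E2" "dual E1" "f ` Y" "inv_into Y f" "dual_map E1 Y f h"
proof
  show "proj (dual E2) ` points (total (dual E2)) \<subseteq> points (base (dual E2))"
    "proj (dual E1) ` points (total (dual E1)) \<subseteq> points (base (dual E1))" by auto
  show "f ` Y \<subseteq> points (base (dual E2))" using f_props by simp
  show "inv_into Y f ` f ` Y \<subseteq> points (base (dual E1))" using f_props Y by auto
  show "inj_on (inv_into Y f) (f ` Y)" by (rule inj_on_inv_into) simp
  show "closed_fibre (dual E2) x" if "x \<in> points (base (dual E2))" for x
    using that by (intro closed_fibre_dual open2) simp
  show "closed_fibre (dual E1) x" if "x \<in> points (base (dual E1))" for x
    using that by (intro closed_fibre_dual open1) simp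
  show "fibre_linear (dual E2) z (dual E1) (inv_into Y f z) (dual_map E1 Y f h)" if "z \<in> f ` Y" for z
    using that dual_map_fibre_linear f_props(2) by auto
qed

text \<open>
  \<open>i1\<close> and \<open>i2\<close> map the two duals to the glued dual \<open>Q.G\<close>, and \<open>k1\<close>, \<open>k2\<close> carry them on to the
  dual \<open>D\<close> of the glued bundle, over the inclusions \<open>\<kappa>1\<close>, \<open>\<kappa>2\<close> of the two bases.
\<close>

abbreviation "D \<equiv> dual P.G"
abbreviation "X \<equiv> glue (base E1) (base E2) Y f"
abbreviation "sw \<equiv> switch_map (base E1) (base E2) Y f"
abbreviation "clS \<equiv> glue_class (base E2) (base E1) (f ` Y) (inv_into Y f)"
abbreviation "\<psi>inv \<equiv> inv_into (points (total D)) \<psi>"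
abbreviation "i1 \<equiv> \<lambda>a. Q.clV (Inr a)"
abbreviation "i2 \<equiv> \<lambda>a. Q.clV (Inl a)"
abbreviation "\<kappa>1 \<equiv> \<lambda>x. P.clX (Inl x)"
abbreviation "\<kappa>2 \<equiv> \<lambda>x. P.clX (Inr x)"
abbreviation "k1 \<equiv> \<psi>inv \<circ> i1"
abbreviation "k2 \<equiv> \<psi>inv \<circ> i2"

lemma X_cases:
  assumes "A \<in> points X"
  obtains x where "x \<in> points (base E1)" "A = \<kappa>1 x" | x where "x \<in> points (base E2)" "A = \<kappa>2 x"
  using assms unfolding points_glue by blast

lemma \<kappa>_points:
  "x \<in> points (base E1) \<Longrightarrow> \<kappa>1 x \<in> points X" "z \<in> points (base E2) \<Longrightarrow> \<kappa>2 z \<in> points X"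
  unfolding points_glue by blast+

text \<open>
  The normal form for the switched gluing prefers the first space over \<open>Y\<close> where the original one
  prefers the second, so the two normal forms correspond bijectively. That the switch map is well
  defined and that it is injective are the two directions of this equivalence.
\<close>

lemma glue_rep_swap:
  assumes "a \<in> P.SX" "b \<in> P.SX"
  shows "glue_rep (f ` Y) (inv_into Y f) (case_sum Inr Inl a) = glue_rep (f ` Y) (inv_into Y f) (case_sum Inr Inl b)
    \<longleftrightarrow> glue_rep Y f a = glue_rep Y f b"
proof -
  have rep: "glue_rep (f ` Y) (inv_into Y f) (case_sum Inr Inl c) =
      (case glue_rep Y f c of Inl x \<Rightarrow> Inr x | Inr z \<Rightarrow> if z \<in> f ` Y then Inr (inv_into Y f z) else Inl z)"
    for c
    using f_props(2) by (cases c) (auto simp: glue_rep_def)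
  have "x \<notin> Y" if "glue_rep Y f c = Inl x" for c x
    using that by (cases c) (auto simp: glue_rep_def split: if_splits)
  moreover have "inv_into Y f z \<in> Y" if "z \<in> f ` Y" for z using that by (rule inv_into_into)
  moreover have "inv_into Y f z = inv_into Y f z' \<longleftrightarrow> z = z'" if "z \<in> f ` Y" "z' \<in> f ` Y" for z z'
    using that by (metis f_inv_into_f)
  ultimately show ?thesis
    unfolding rep by (auto split: sum.splits if_splits)
qed

lemma swap_SX: "a \<in> P.SX \<Longrightarrow> case_sum Inr Inl a \<in> points (base E2) <+> points (base E1)"
  by (erule PlusE) auto

lemma sw_clX:
  assumes a: "a \<in> P.SX"
  shows "sw (P.clX a) = clS (case_sum Inr Inl a)"
  unfolding switch_map_def
proof (rule the_elem_image_glue_class[OF a])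
  fix b assume b: "b \<in> P.SX" "glue_rep Y f b = glue_rep Y f a"
  then have "glue_rep (f ` Y) (inv_into Y f) (case_sum Inr Inl b) =
      glue_rep (f ` Y) (inv_into Y f) (case_sum Inr Inl a)"
    using glue_rep_swap[OF b(1) a] by simp
  then show "clS (case_sum Inr Inl b) = clS (case_sum Inr Inl a)"
    by (simp only: glue_class_eq_iff[OF swap_SX[OF b(1)] swap_SX[OF a]])
qed

lemma sw_\<kappa>1: "x \<in> points (base E1) \<Longrightarrow> sw (\<kappa>1 x) = clS (Inr x)"
  and sw_\<kappa>2: "z \<in> points (base E2) \<Longrightarrow> sw (\<kappa>2 z) = clS (Inl z)"
  by (simp_all add: sw_clX InlI InrI)

lemma inj_sw: "inj_on sw (points X)"
proof (rule inj_onI)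
  fix A B assume "A \<in> points X" "B \<in> points X" and eq: "sw A = sw B"
  then obtain a b where ab: "a \<in> P.SX" "A = P.clX a" "b \<in> P.SX" "B = P.clX b"
    unfolding points_glue by blast
  have "glue_rep Y f a = glue_rep Y f b"
    using eq unfolding ab(2,4) sw_clX[OF ab(1)] sw_clX[OF ab(3)]
      glue_class_eq_iff[OF swap_SX[OF ab(1)] swap_SX[OF ab(3)]] glue_rep_swap[OF ab(1,3)] .
  then show "A = B" unfolding ab(2,4) glue_class_eq_iff[OF ab(1,3)] .
qed

lemma open_G: "open_plots (total P.G)"
  by (simp add: P.total_G glue_def quot_diff_def)

lemma closed_fibre_D: "A \<in> points X \<Longrightarrow> closed_fibre D A"
  by (rule closed_fibre_dual[OF open_G]) (simp add: P.base_G)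

lemma glued_fibre:
  assumes A: "A \<in> points X"
  shows "closed_fibre P.G A" "finitely_determined P.G A"
proof -
  have 2: "closed_fibre P.G (\<kappa>2 z) \<and> finitely_determined P.G (\<kappa>2 z)" if z: "z \<in> points (base E2)" for z
    using closed_fibre_image[OF P.fibre_linear_Inr[OF z] P.fib_G_Inr[OF z, symmetric] P.fibre2[OF z]]
      finitely_determined_image[OF P.fibre_linear_Inr[OF z] P.fib_G_Inr[OF z, symmetric]
        finitely_determined_finite_dim[OF bundle2(4,5)[OF z]]] by blast
  have 1: "closed_fibre P.G (\<kappa>1 x) \<and> finitely_determined P.G (\<kappa>1 x)"
    if x: "x \<in> points (base E1)" for x
  proof (cases "x \<in> Y")
    case True
    then show ?thesis using 2[of "f x"] f_props P.clX_glue[OF True] by auto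
  next
    case False
    show ?thesis
      using closed_fibre_image[OF P.fibre_linear_Inl[OF x] P.fib_G_Inl[OF x False, symmetric] P.fibre1[OF x]]
        finitely_determined_image[OF P.fibre_linear_Inl[OF x] P.fib_G_Inl[OF x False, symmetric]
          finitely_determined_finite_dim[OF bundle1(4,5)[OF x]]] by blast
  qed
  from A show "closed_fibre P.G A" "finitely_determined P.G A"
    by (rule X_cases; use 1 2 in blast)+
qed

lemma \<psi>_props:
  "bij_betw \<psi> (points (total D)) (points (total Q.G))"
  "smooth_map (total Q.G) (total D) \<psi>inv"
  "a \<in> points (total D) \<Longrightarrow> proj Q.G (\<psi> a) = sw (proj D a)"
  "fibrewise_linear D Q.G (points (base D)) \<psi>"
  using \<psi> unfolding gluing_dual_commutativity_def diffeomorphism_def glued_duals_def Let_def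
  by blast+

text \<open>
  Since \<open>\<psi>\<close> is onto and covers the injective switch map, it maps each fibre onto a fibre.
\<close>

lemma \<psi>_fibre:
  assumes A: "A \<in> points X"
  shows "\<psi> ` fib D A = fib Q.G (sw A)" "fibre_linear D A Q.G (sw A) \<psi>"
proof -
  have D_base: "proj D a \<in> points X" if "a \<in> points (total D)" for a
    using that by (auto simp: P.base_G)
  have sub: "\<psi> ` fib D A \<subseteq> fib Q.G (sw A)"
    using \<psi>_props(1,3) unfolding fib_def bij_betw_def by blast
  have "b \<in> \<psi> ` fib D A" if b: "b \<in> fib Q.G (sw A)" for b
  proof -
    obtain a where a: "a \<in> points (total D)" "b = \<psi> a"
      using b \<psi>_props(1) unfolding fib_def bij_betw_def by blast
    then have "sw (proj D a) = sw A" using b \<psi>_props(3)[OF a(1)] by (simp add: fib_def)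
    then have "proj D a = A" using inj_sw D_base[OF a(1)] A by (auto dest: inj_onD)
    with a show ?thesis by (simp add: fib_def)
  qed
  with sub show "\<psi> ` fib D A = fib Q.G (sw A)" by blast
  show "fibre_linear D A Q.G (sw A) \<psi>"
    using sub \<psi>_props(4) A unfolding fibre_linear_def fibrewise_linear_def by (simp add: P.base_G)
qed

lemma \<psi>inv_fibre:
  assumes A: "A \<in> points X"
  shows "fibre_linear Q.G (sw A) D A \<psi>inv" "\<psi>inv ` fib Q.G (sw A) = fib D A"
    "inj_on \<psi>inv (fib Q.G (sw A))" "closed_fibre Q.G (sw A)"
proof -
  have inv: "\<psi>inv (\<psi> a) = a" if "a \<in> fib D A" for a
    using \<psi>_props(1) that by (simp add: bij_betw_def fib_def)
  show "fibre_linear Q.G (sw A) D A \<psi>inv"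
    by (rule fibre_linear_inverse[OF \<psi>_fibre(2)[OF A] closed_fibre_D[OF A] \<psi>_fibre(1)[OF A] inv])
  show "\<psi>inv ` fib Q.G (sw A) = fib D A"
    unfolding \<psi>_fibre(1)[OF A, symmetric] image_image using inv by simp
  show "inj_on \<psi>inv (fib Q.G (sw A))"
    unfolding \<psi>_fibre(1)[OF A, symmetric] using inv by (auto intro!: inj_onI)
  show "closed_fibre Q.G (sw A)"
    by (rule closed_fibre_image[OF \<psi>_fibre(2)[OF A] \<psi>_fibre(1)[OF A] closed_fibre_D[OF A]])
qed

lemmas Q_linear_Inr = Q.fibre_linear_Inr[unfolded dual_simps(2)]
lemmas Q_linear_Inl = Q.fibre_linear_Inl[unfolded dual_simps(2)]
lemmas Q_fib_Inr = Q.fib_G_Inr[unfolded dual_simps(2)]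
lemmas Q_fib_Inl = Q.fib_G_Inl[unfolded dual_simps(2)]
lemmas Q_clX_glue = Q.clX_glue[unfolded dual_simps(2)]

lemma k1_linear:
  assumes x: "x \<in> points (base E1)"
  shows "fibre_linear (dual E1) x D (\<kappa>1 x) k1"
proof (rule fibre_linear_comp)
  show "fibre_linear (dual E1) x Q.G (sw (\<kappa>1 x)) i1"
    unfolding sw_\<kappa>1[OF x] by (rule Q_linear_Inr[OF x])
  show "fibre_linear Q.G (sw (\<kappa>1 x)) D (\<kappa>1 x) \<psi>inv"
    by (rule \<psi>inv_fibre(1)[OF \<kappa>_points(1)[OF x]])
qed

lemma k2_linear:
  assumes x: "x \<in> points (base E2)"
  shows "fibre_linear (dual E2) x D (\<kappa>2 x) k2"
proof (rule fibre_linear_comp)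
  show "fibre_linear (dual E2) x Q.G (sw (\<kappa>2 x)) i2"
    unfolding sw_\<kappa>2[OF x] by (rule Q_linear_Inl[OF x])
  show "fibre_linear Q.G (sw (\<kappa>2 x)) D (\<kappa>2 x) \<psi>inv"
    by (rule \<psi>inv_fibre(1)[OF \<kappa>_points(2)[OF x]])
qed

lemma k1_bij:
  assumes x: "x \<in> points (base E1)"
  shows "inj_on k1 (fib (dual E1) x)" "k1 ` fib (dual E1) x = fib D (\<kappa>1 x)"
proof -
  have eq: "i1 ` fib (dual E1) x = fib Q.G (sw (\<kappa>1 x))" using Q_fib_Inr[OF x] sw_\<kappa>1[OF x] by simp
  have "inj_on i1 (fib (dual E1) x)"
    by (rule inj_on_subset[OF Q.inj_clV_Inr]) (auto simp: fib_def)
  then show "inj_on k1 (fib (dual E1) x)"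
    using \<psi>inv_fibre(3)[OF \<kappa>_points(1)[OF x]] by (intro comp_inj_on) (simp_all add: eq)
  show "k1 ` fib (dual E1) x = fib D (\<kappa>1 x)"
    using \<psi>inv_fibre(2)[OF \<kappa>_points(1)[OF x]] unfolding image_comp[symmetric] eq .
qed

text \<open>
  Over \<open>f ` Y\<close> the map \<open>k2\<close> factors through the dual of the lift, which may have a kernel; hence the
  restriction to points outside.
\<close>

lemma k2_bij:
  assumes x: "x \<in> points (base E2)" "x \<notin> f ` Y"
  shows "inj_on k2 (fib (dual E2) x)" "k2 ` fib (dual E2) x = fib D (\<kappa>2 x)"
proof -
  have eq: "i2 ` fib (dual E2) x = fib Q.G (sw (\<kappa>2 x))" using Q_fib_Inl[OF x] sw_\<kappa>2[OF x(1)] by simp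
  have "inj_on i2 (fib (dual E2) x)"
    using x by (intro inj_on_subset[OF Q.inj_clV_Inl]) (auto simp: fib_def over_def)
  then show "inj_on k2 (fib (dual E2) x)"
    using \<psi>inv_fibre(3)[OF \<kappa>_points(2)[OF x(1)]] by (intro comp_inj_on) (simp_all add: eq)
  show "k2 ` fib (dual E2) x = fib D (\<kappa>2 x)"
    using \<psi>inv_fibre(2)[OF \<kappa>_points(2)[OF x(1)]] unfolding image_comp[symmetric] eq .
qed

abbreviation "T1 \<equiv> tensor_sq_map (dual E1) D \<kappa>1 k1"
abbreviation "T2 \<equiv> tensor_sq_map (dual E2) D \<kappa>2 k2"

lemma smooth_T1: "smooth_map (total (dual_sq E1)) (total (dual_sq P.G)) T1"
proof (rule smooth_map_tensor_sq_map)
  have "smooth_map (total (dual E1)) (total Q.G) i1"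
    unfolding Q.total_G by (rule smooth_map_glue_Inr) (rule dual_plotD)
  then show "smooth_map (total (dual E1)) (total D) k1"
    by (rule smooth_map_comp) (rule \<psi>_props)
  show "smooth_map (base (dual E1)) (base D) \<kappa>1"
    unfolding dual_simps P.base_G by (rule smooth_map_glue_Inl) (use open1 in blast)
  show "fibre_linear (dual E1) x D (\<kappa>1 x) k1" if "x \<in> points (base (dual E1))" for x
    using that by (intro k1_linear) simp
  show "p ` U \<subseteq> points (total (dual E1))" if "(n, U, p) \<in> plots (total (dual E1))" for n U p
    using dual_plotD(2)[OF that] by simp
  show "diffeological_space (base (dual E1))" using bundle1(2) by simp
  show "smooth_map (total (dual E1)) (base (dual E1)) (proj (dual E1))"
    using smooth_map_proj_dual by simp
qed (rule Q.fibre2)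

lemma smooth_T2: "smooth_map (total (dual_sq E2)) (total (dual_sq P.G)) T2"
proof (rule smooth_map_tensor_sq_map)
  have "smooth_map (total (dual E2)) (total Q.G) i2"
    unfolding Q.total_G by (rule smooth_map_glue_Inl) (rule dual_plotD)
  then show "smooth_map (total (dual E2)) (total D) k2"
    by (rule smooth_map_comp) (rule \<psi>_props)
  show "smooth_map (base (dual E2)) (base D) \<kappa>2"
    unfolding dual_simps P.base_G by (rule smooth_map_glue_Inr) (use open2 in blast)
  show "fibre_linear (dual E2) x D (\<kappa>2 x) k2" if "x \<in> points (base (dual E2))" for x
    using that by (intro k2_linear) simp
  show "p ` U \<subseteq> points (total (dual E2))" if "(n, U, p) \<in> plots (total (dual E2))" for n U p
    using dual_plotD(2)[OF that] by simp
  show "diffeological_space (base (dual E2))" using bundle2(2) by simp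
  show "smooth_map (total (dual E2)) (base (dual E2)) (proj (dual E2))"
    using smooth_map_proj_dual by simp
qed (rule Q.fibre1)

abbreviation "clT \<equiv> glue_class (total (dual_sq E2)) (total (dual_sq E1)) (over (dual_sq E2) (f ` Y))
  (dual_map_sq E1 E2 Y f h)"
abbreviation "I1 \<equiv> tensor_sq_map (dual E1) Q.G (\<lambda>x. clS (Inr x)) i1"
abbreviation "I2 \<equiv> tensor_sq_map (dual E2) Q.G (\<lambda>x. clS (Inl x)) i2"

text \<open>
  This is what makes the identification of the glued tensor squares with the tensor square of
  the glued dual independent of representatives: \<open>i2 = i1 \<circ> dm\<close> over \<open>f ` Y\<close>.
\<close>

lemma I1_dual_map_sq:
  assumes z: "z \<in> f ` Y"
  shows "I1 (dual_map_sq E1 E2 Y f h (z, t)) = I2 (z, t)"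
proof -
  let ?y = "inv_into Y f z"
  have y: "?y \<in> Y" "f ?y = z" using z by (auto simp: inv_into_into f_inv_into_f)
  then have yb: "?y \<in> points (base E1)" using Y by blast
  have "I1 (dual_map_sq E1 E2 Y f h (z, t)) =
      tensor_sq_map (dual E2) Q.G ((\<lambda>x. clS (Inr x)) \<circ> inv_into Y f) (i1 \<circ> dm) (z, t)"
    unfolding dual_map_sq_def
  proof (rule tensor_sq_map_comp)
    show "closed_fibre (dual E1) ?y" using yb by (intro closed_fibre_dual open1)
    show "fibre_linear (dual E2) z (dual E1) ?y dm" by (rule Q.lift[OF z])
    show "fibre_linear (dual E1) ?y Q.G (clS (Inr ?y)) i1" by (rule Q_linear_Inr[OF yb])
  qed
  also have "\<dots> = I2 (z, t)"
  proof (rule tensor_sq_map_cong)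
    show "((\<lambda>x. clS (Inr x)) \<circ> inv_into Y f) z = clS (Inl z)" using Q_clX_glue[OF z] by simp
    show "(i1 \<circ> dm) v = i2 v" if "v \<in> fib (dual E2) z" for v
      using Q.clV_glue[OF z that] by simp
  qed
  finally show ?thesis .
qed

lemma glue_tensor_id_clT:
  assumes a: "a \<in> points (total (dual_sq E2)) <+> points (total (dual_sq E1))"
  shows "glue_tensor_id E1 E2 Y f h (clT a) = case_sum I2 I1 a"
proof -
  have norm: "case_sum I2 I1 (glue_rep (over (dual_sq E2) (f ` Y)) (dual_map_sq E1 E2 Y f h) b) = case_sum I2 I1 b" for b
  proof (cases b)
    case (Inl c)
    obtain z t where c: "c = (z, t)" by (cases c)
    show ?thesis
    proof (cases "c \<in> over (dual_sq E2) (f ` Y)")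
      case True
      then have "z \<in> f ` Y" by (simp add: over_def c)
      then show ?thesis using Inl True c I1_dual_map_sq by simp
    qed (simp add: Inl)
  qed simp
  have "the_elem (case_sum I2 I1 ` clT a) = case_sum I2 I1 a"
    by (rule the_elem_image_glue_class[OF a]) (metis norm)
  then show ?thesis by (simp add: glue_tensor_id_def Let_def glued_duals_def)
qed

lemma inv_sw:
  "A \<in> points X \<Longrightarrow> inv_into (points X) sw (sw A) = A"
  by (rule inv_into_f_f[OF inj_sw])

lemma Psi_I1:
  assumes x: "x \<in> points (base E1)" and t: "t \<in> tensor_fib (dual E1) (dual E1) x"
  shows "Psi_map E1 E2 Y f h \<psi> (clT (Inr (x, t))) = T1 (x, t)"
proof -
  note X = \<kappa>_points(1)[OF x]
  let ?si = "inv_into (points X) sw"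
  have si: "?si (clS (Inr x)) = \<kappa>1 x" using inv_sw[OF X] by (simp add: sw_\<kappa>1[OF x])
  have "Psi_map E1 E2 Y f h \<psi> (clT (Inr (x, t))) = tensor_sq_map Q.G D ?si \<psi>inv (I1 (x, t))"
  proof -
    have "Inr (x, t) \<in> points (total (dual_sq E2)) <+> points (total (dual_sq E1))"
      using x t by (intro InrI) simp
    from glue_tensor_id_clT[OF this] show ?thesis
      by (simp add: Psi_map_def Let_def glued_duals_def)
  qed
  also have "\<dots> = tensor_sq_map (dual E1) D (?si \<circ> (\<lambda>x. clS (Inr x))) k1 (x, t)"
  proof (rule tensor_sq_map_comp)
    show "closed_fibre Q.G (clS (Inr x))" using \<psi>inv_fibre(4)[OF X] by (simp add: sw_\<kappa>1[OF x])
    show "fibre_linear (dual E1) x Q.G (clS (Inr x)) i1" by (rule Q_linear_Inr[OF x])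
    show "fibre_linear Q.G (clS (Inr x)) D (?si (clS (Inr x))) \<psi>inv"
      using \<psi>inv_fibre(1)[OF X] unfolding si by (simp add: sw_\<kappa>1[OF x])
  qed
  also have "\<dots> = T1 (x, t)"
    by (rule tensor_sq_map_cong) (simp_all add: si)
  finally show ?thesis .
qed

lemma Psi_I2:
  assumes x: "x \<in> points (base E2)" and t: "t \<in> tensor_fib (dual E2) (dual E2) x"
  shows "Psi_map E1 E2 Y f h \<psi> (clT (Inl (x, t))) = T2 (x, t)"
proof -
  note X = \<kappa>_points(2)[OF x]
  let ?si = "inv_into (points X) sw"
  have si: "?si (clS (Inl x)) = \<kappa>2 x" using inv_sw[OF X] by (simp add: sw_\<kappa>2[OF x])
  have "Psi_map E1 E2 Y f h \<psi> (clT (Inl (x, t))) = tensor_sq_map Q.G D ?si \<psi>inv (I2 (x, t))"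
  proof -
    have "Inl (x, t) \<in> points (total (dual_sq E2)) <+> points (total (dual_sq E1))"
      using x t by (intro InlI) simp
    from glue_tensor_id_clT[OF this] show ?thesis
      by (simp add: Psi_map_def Let_def glued_duals_def)
  qed
  also have "\<dots> = tensor_sq_map (dual E2) D (?si \<circ> (\<lambda>x. clS (Inl x))) k2 (x, t)"
  proof (rule tensor_sq_map_comp)
    show "closed_fibre Q.G (clS (Inl x))" using \<psi>inv_fibre(4)[OF X] by (simp add: sw_\<kappa>2[OF x])
    show "fibre_linear (dual E2) x Q.G (clS (Inl x)) i2" by (rule Q_linear_Inl[OF x])
    show "fibre_linear Q.G (clS (Inl x)) D (?si (clS (Inl x))) \<psi>inv"
      using \<psi>inv_fibre(1)[OF X] unfolding si by (simp add: sw_\<kappa>2[OF x])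
  qed
  also have "\<dots> = T2 (x, t)"
    by (rule tensor_sq_map_cong) (simp_all add: si)
  finally show ?thesis .
qed

text \<open>
  Both sides lie in the tensor square over \<open>y\<close> and induce the same form: the form of the left side
  at \<open>v, w\<close> is that of \<open>g2 (f y)\<close> at \<open>h v, h w\<close>.
\<close>

lemma compatible_tensor:
  assumes g1: "g1 \<in> pseudo_metrics E1" and g2: "g2 \<in> pseudo_metrics E2"
    and c: "compatible E1 E2 Y f h g1 g2" and y: "y \<in> Y"
  shows "dual_map_sq E1 E2 Y f h (g2 (f y)) = g1 y"
proof -
  have yb: "y \<in> points (base E1)" and fy: "f y \<in> points (base E2)" using y Y f_props by auto
  have inv: "inv_into Y f (f y) = y" using y f_props(2) by simp
  note lin = dual_map_fibre_linear[OF y]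
  define t1 where "t1 = snd (g1 y)"
  define t2 where "t2 = snd (g2 (f y))"
  have e1: "g1 y = (y, t1)" and e2: "g2 (f y) = (f y, t2)"
    unfolding t1_def t2_def by (rule pseudo_metricsD(1)[OF g1 yb] pseudo_metricsD(1)[OF g2 fy])+
  have t1: "t1 \<in> tensor_fib (dual E1) (dual E1) y" and t2: "t2 \<in> tensor_fib (dual E2) (dual E2) (f y)"
    using pseudo_metricsD(2)[OF g1 yb] pseudo_metricsD(2)[OF g2 fy]
    unfolding t1_def t2_def fibre_metric_def by blast+
  define t where "t = snd (dual_map_sq E1 E2 Y f h (f y, t2))"
  have cl1: "closed_fibre (dual E1) y" by (rule closed_fibre_dual[OF open1(1) yb])
  have cl2: "closed_fibre (dual E2) (f y)" by (rule closed_fibre_dual[OF open2(1) fy])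
  have "t \<in> tensor_fib (dual E1) (dual E1) (inv_into Y f (f y))"
    unfolding t_def dual_map_sq_def
    by (rule tensor_sq_map_tensor_fib) (simp_all add: cl2 inv lin t2)
  then have t: "t \<in> tensor_fib (dual E1) (dual E1) y" by (simp add: inv)
  have eq: "dual_map_sq E1 E2 Y f h (f y, t2) = (y, t)"
    unfolding t_def by (simp add: prod_eq_iff) (simp add: dual_map_sq_def fst_tensor_sq_map inv)
  have "t = t1"
  proof (rule form_of_inject[OF yb open1(1) _ t t1])
    show "finitely_determined E1 y"
      by (rule finitely_determined_finite_dim[OF bundle1(4,5)[OF yb]])
    fix v w assume vw: "v \<in> fib E1 y" "w \<in> fib E1 y"
    have "form_of E1 (y, t) v w = t2 (pullback_form (dual E2) (f y) dm (eval_form E1 y v w))"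
      unfolding form_of_eq t_def dual_map_sq_def tensor_sq_map_eq
      by (simp add: inv eval_form_bilin[OF cl1])
    also have "pullback_form (dual E2) (f y) dm (eval_form E1 y v w) = eval_form E2 (f y) (h v) (h w)"
    proof -
      have "dm a \<in> fib (dual E1) y" "snd (dm a) v = snd a (h v)" "snd (dm a) w = snd a (h w)"
        if "a \<in> fib (dual E2) (f y)" for a
        using that lin vw by (auto simp: fibre_linear_def fib_dual[OF fy] dual_map_f[OF y])
      then show ?thesis by (auto simp: fun_eq_iff eval_form_def)
    qed
    also have "t2 (eval_form E2 (f y) (h v) (h w)) = form_of E2 (g2 (f y)) (h v) (h w)"
      by (simp add: e2 form_of_eq)
    also have "\<dots> = form_of E1 (g1 y) v w"
      using c y vw by (simp add: compatible_def)
    finally show "form_of E1 (y, t) v w = form_of E1 (y, t1) v w" by (simp add: e1)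
  qed
  with eq e1 e2 show ?thesis by simp
qed

abbreviation "gs \<equiv> glue_section (dual_sq E2) (dual_sq E1) (f ` Y) (dual_map_sq E1 E2 Y f h)"

lemma glue_section_Inr:
  assumes x: "x \<in> points (base E1)"
  shows "gs g2 g1 (clS (Inr x)) = clT (Inr (g1 x))"
proof -
  have "Inr x' \<in> clS (Inr x) \<longleftrightarrow> x' = x" for x'
    using x by (subst glue_class_eq) auto
  then show ?thesis by (simp add: glue_section_def)
qed

lemma glue_section_Inl:
  assumes x: "x \<in> points (base E2)" "x \<notin> f ` Y"
  shows "gs g2 g1 (clS (Inl x)) = clT (Inl (g2 x))"
proof -
  have "Inr x' \<notin> clS (Inl x)" for x'
    using x by (subst glue_class_eq) auto
  moreover have "Inl x' \<in> clS (Inl x) \<longleftrightarrow> x' = x" for x'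
    using x by (subst glue_class_eq) (auto simp: glue_rep_def)
  ultimately show ?thesis by (simp add: glue_section_def)
qed

abbreviation "PM \<equiv> P_map E1 E2 Y f h \<psi>"

lemma P_map_\<kappa>1:
  assumes g1: "g1 \<in> pseudo_metrics E1" and x: "x \<in> points (base E1)"
  shows "PM (g1, g2) (\<kappa>1 x) = T1 (g1 x)"
proof -
  have e: "g1 x = (x, snd (g1 x))" by (rule pseudo_metricsD(1)[OF g1 x])
  have t: "snd (g1 x) \<in> tensor_fib (dual E1) (dual E1) x"
    using pseudo_metricsD(2)[OF g1 x] by (simp add: fibre_metric_def)
  have "PM (g1, g2) (\<kappa>1 x) = Psi_map E1 E2 Y f h \<psi> (clT (Inr (g1 x)))"
    using \<kappa>_points(1)[OF x] by (simp add: P_map_def sw_\<kappa>1[OF x] glue_section_Inr[OF x])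
  also have "\<dots> = T1 (g1 x)" using Psi_I1[OF x t] e by simp
  finally show ?thesis .
qed

text \<open>
  Over \<open>f ` Y\<close> the value is by construction \<open>T1 (g1 y)\<close>. Compatibility replaces \<open>g1 y\<close> by the image
  of \<open>g2 (f y)\<close>, and \<open>k1 \<circ> dm = k2\<close> there. Having one formula on all of the second base is what
  allows plots that run into \<open>f ` Y\<close> to be treated uniformly.
\<close>

lemma P_map_\<kappa>2:
  assumes g1: "g1 \<in> pseudo_metrics E1" and g2: "g2 \<in> pseudo_metrics E2"
    and c: "compatible E1 E2 Y f h g1 g2" and x: "x \<in> points (base E2)"
  shows "PM (g1, g2) (\<kappa>2 x) = T2 (g2 x)"
proof (cases "x \<in> f ` Y")
  case False
  have e: "g2 x = (x, snd (g2 x))" by (rule pseudo_metricsD(1)[OF g2 x])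
  have t: "snd (g2 x) \<in> tensor_fib (dual E2) (dual E2) x"
    using pseudo_metricsD(2)[OF g2 x] by (simp add: fibre_metric_def)
  have "PM (g1, g2) (\<kappa>2 x) = Psi_map E1 E2 Y f h \<psi> (clT (Inl (g2 x)))"
    using \<kappa>_points(2)[OF x] by (simp add: P_map_def sw_\<kappa>2[OF x] glue_section_Inl[OF x False])
  also have "\<dots> = T2 (g2 x)" using Psi_I2[OF x t] e by simp
  finally show ?thesis .
next
  case True
  then obtain y where y: "y \<in> Y" "x = f y" by blast
  then have yb: "y \<in> points (base E1)" and inv: "inv_into Y f x = y" using Y f_props(2) by auto
  have e: "g2 x = (x, snd (g2 x))" by (rule pseudo_metricsD(1)[OF g2 x])
  have "PM (g1, g2) (\<kappa>2 x) = T1 (dual_map_sq E1 E2 Y f h (g2 x))"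
    using P_map_\<kappa>1[OF g1 yb, of g2] P.clX_glue[OF y(1)] compatible_tensor[OF g1 g2 c y(1)] y(2) by simp
  also have "\<dots> = T1 (dual_map_sq E1 E2 Y f h (x, snd (g2 x)))" using e by simp
  also have "\<dots> = tensor_sq_map (dual E2) D (\<kappa>1 \<circ> inv_into Y f) (k1 \<circ> dm) (x, snd (g2 x))"
    unfolding dual_map_sq_def
  proof (rule tensor_sq_map_comp; unfold inv)
    show "closed_fibre (dual E1) y" using yb by (intro closed_fibre_dual open1)
    show "fibre_linear (dual E2) x (dual E1) y dm" using dual_map_fibre_linear[OF y(1)] y(2) by simp
    show "fibre_linear (dual E1) y D (\<kappa>1 y) k1" by (rule k1_linear[OF yb])
  qed
  also have "\<dots> = T2 (x, snd (g2 x))"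
  proof (rule tensor_sq_map_cong)
    show "(\<kappa>1 \<circ> inv_into Y f) x = \<kappa>2 x" unfolding comp_def inv using P.clX_glue[OF y(1)] y(2) by simp
    show "(k1 \<circ> dm) v = k2 v" if "v \<in> fib (dual E2) x" for v
      using Q.clV_glue[OF True that] by simp
  qed
  finally show ?thesis using e by simp
qed

text \<open>
  Over \<open>Y\<close> the description through \<open>g1\<close> is used, since \<open>k1\<close> is bijective on every fibre.
\<close>

lemma P_map_fibre_metric:
  assumes g1: "g1 \<in> pseudo_metrics E1" and g2: "g2 \<in> pseudo_metrics E2"
    and c: "compatible E1 E2 Y f h g1 g2" and A: "A \<in> points X"
  shows "fst (PM (g1, g2) A) = A \<and> fibre_metric P.G A (snd (PM (g1, g2) A))"
proof -
  have 1: "fst (PM (g1, g2) (\<kappa>1 x)) = \<kappa>1 x \<and> fibre_metric P.G (\<kappa>1 x) (snd (PM (g1, g2) (\<kappa>1 x)))"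
    if x: "x \<in> points (base E1)" for x
  proof -
    note X = \<kappa>_points(1)[OF x]
    have e: "g1 x = (x, snd (g1 x))" by (rule pseudo_metricsD(1)[OF g1 x])
    have "fst (T1 (x, snd (g1 x))) = \<kappa>1 x" by (rule fst_tensor_sq_map)
    moreover have "fibre_metric P.G (\<kappa>1 x) (snd (T1 (x, snd (g1 x))))"
    proof (rule fibre_metric_transport)
      show "finitely_determined E1 x"
        by (rule finitely_determined_finite_dim[OF bundle1(4,5)[OF x]])
      show "\<kappa>1 x \<in> points (base P.G)" using X by (simp add: P.base_G)
    qed (fact x open1 open_G P.fibre1[OF x] glued_fibre[OF X] k1_linear[OF x] k1_bij[OF x]
        pseudo_metricsD(2)[OF g1 x])+
    ultimately show ?thesis using P_map_\<kappa>1[OF g1 x, of g2] e by simp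
  qed
  have 2: "fst (PM (g1, g2) (\<kappa>2 x)) = \<kappa>2 x \<and> fibre_metric P.G (\<kappa>2 x) (snd (PM (g1, g2) (\<kappa>2 x)))"
    if x: "x \<in> points (base E2)" for x
  proof (cases "x \<in> f ` Y")
    case True
    then obtain y where y: "y \<in> Y" "x = f y" by blast
    then show ?thesis using 1[of y] Y P.clX_glue[OF y(1)] by auto
  next
    case False
    note X = \<kappa>_points(2)[OF x]
    have e: "g2 x = (x, snd (g2 x))" by (rule pseudo_metricsD(1)[OF g2 x])
    have "fst (T2 (x, snd (g2 x))) = \<kappa>2 x" by (rule fst_tensor_sq_map)
    moreover have "fibre_metric P.G (\<kappa>2 x) (snd (T2 (x, snd (g2 x))))"
    proof (rule fibre_metric_transport)
      show "finitely_determined E2 x"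
        by (rule finitely_determined_finite_dim[OF bundle2(4,5)[OF x]])
      show "\<kappa>2 x \<in> points (base P.G)" using X by (simp add: P.base_G)
    qed (fact x open2 open_G P.fibre2[OF x] glued_fibre[OF X] k2_linear[OF x] k2_bij[OF x False]
        pseudo_metricsD(2)[OF g2 x])+
    ultimately show ?thesis using P_map_\<kappa>2[OF g1 g2 c x] e by simp
  qed
  from A show ?thesis by (rule X_cases) (use 1 2 in auto)
qed

text \<open>
  The tensor diffeology is an intersection of diffeologies; the sheaf condition is applied in each
  of them.
\<close>

lemma plot_of_local_lifts:
  assumes U: "openin (Euclidean_space n) U"
    and lift: "\<And>u. u \<in> U \<Longrightarrow> \<exists>W. u \<in> W \<and> W \<subseteq> U \<and> openin (Euclidean_space n) W \<and>
      ((\<exists>r. (n, W, r) \<in> plots (total (dual_sq E1)) \<and> (\<forall>w\<in>W. F w = T1 (r w))) \<or>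
       (\<exists>r. (n, W, r) \<in> plots (total (dual_sq E2)) \<and> (\<forall>w\<in>W. F w = T2 (r w))))"
  shows "(n, U, F) \<in> plots (total (dual_sq P.G))"
  unfolding tensor_simps
proof (rule InterI)
  fix \<Delta> assume \<Delta>: "\<Delta> \<in> tensor_diffeologies D D"
  note d\<Delta> = diffeological_tensor_with[OF \<Delta>]
  have "(n, U, F) \<in> plots (total (tensor_with D D \<Delta>))"
  proof (rule plot_local[OF d\<Delta> U])
    fix u assume "u \<in> U"
    from lift[OF this] obtain W where W: "u \<in> W" "W \<subseteq> U" "openin (Euclidean_space n) W"
      and lifts: "(\<exists>r. (n, W, r) \<in> plots (total (dual_sq E1)) \<and> (\<forall>w\<in>W. F w = T1 (r w))) \<or>
        (\<exists>r. (n, W, r) \<in> plots (total (dual_sq E2)) \<and> (\<forall>w\<in>W. F w = T2 (r w)))"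
      by blast
    obtain q where q: "(n, W, q) \<in> plots (total (dual_sq P.G))" "\<forall>w\<in>W. F w = q w"
      using lifts
    proof (elim disjE exE conjE)
      fix r assume "(n, W, r) \<in> plots (total (dual_sq E1))" "\<forall>w\<in>W. F w = T1 (r w)"
      then show thesis using smooth_map_plot[OF smooth_T1] by (intro that[of "T1 \<circ> r"]) simp_all
    next
      fix r assume "(n, W, r) \<in> plots (total (dual_sq E2))" "\<forall>w\<in>W. F w = T2 (r w)"
      then show thesis using smooth_map_plot[OF smooth_T2] by (intro that[of "T2 \<circ> r"]) simp_all
    qed
    have "(n, W, F) \<in> plots (total (tensor_with D D \<Delta>))"
      by (rule plot_cong[OF d\<Delta>, of n W q]) (use q \<Delta> in auto)
    with W show "\<exists>W. u \<in> W \<and> W \<subseteq> U \<and> openin (Euclidean_space n) W \<and>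
        (n, W, F) \<in> plots (total (tensor_with D D \<Delta>))" by blast
  qed
  then show "(n, U, F) \<in> \<Delta>" by simp
qed

lemma P_map_pseudo_metric:
  assumes g1: "g1 \<in> pseudo_metrics E1" and g2: "g2 \<in> pseudo_metrics E2"
    and c: "compatible E1 E2 Y f h g1 g2"
  shows "PM (g1, g2) \<in> pseudo_metrics P.G"
proof (rule pseudo_metricsI)
  show "PM (g1, g2) \<in> extensional (points (base P.G))"
    by (simp add: P_map_def P.base_G)
  show m: "fst (PM (g1, g2) A) = A \<and> fibre_metric P.G A (snd (PM (g1, g2) A))"
    if "A \<in> points (base P.G)" for A
    using that P_map_fibre_metric[OF g1 g2 c] by (simp add: P.base_G)
  show "smooth_map (base P.G) (total (dual_sq P.G)) (PM (g1, g2))"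
    unfolding smooth_map_def
  proof (intro conjI allI impI)
    have "PM (g1, g2) A \<in> points (total (dual_sq P.G))" if A: "A \<in> points (base P.G)" for A
    proof -
      have "PM (g1, g2) A = (A, snd (PM (g1, g2) A))" using m[OF A] by (simp add: prod_eq_iff)
      then show ?thesis using m[OF A] A unfolding fibre_metric_def tensor_simps
        by (metis mem_Sigma_iff dual_simps(2))
    qed
    then show "PM (g1, g2) ` points (base P.G) \<subseteq> points (total (dual_sq P.G))" by blast
    fix n U q assume q: "(n, U, q) \<in> plots (base P.G)"
    have U: "openin (Euclidean_space n) U" using q by (simp add: P.base_G glue_def quot_diff_def)
    show "(n, U, PM (g1, g2) \<circ> q) \<in> plots (total (dual_sq P.G))"
    proof (rule plot_of_local_lifts[OF U])
      fix u assume "u \<in> U"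
      with q[unfolded P.base_G]
      show "\<exists>W. u \<in> W \<and> W \<subseteq> U \<and> openin (Euclidean_space n) W \<and>
        ((\<exists>r. (n, W, r) \<in> plots (total (dual_sq E1)) \<and> (\<forall>w\<in>W. (PM (g1, g2) \<circ> q) w = T1 (r w))) \<or>
         (\<exists>r. (n, W, r) \<in> plots (total (dual_sq E2)) \<and> (\<forall>w\<in>W. (PM (g1, g2) \<circ> q) w = T2 (r w))))"
      proof (cases rule: glue_plot_lift)
        case (1 W r)
        have "(n, W, g1 \<circ> r) \<in> plots (total (dual_sq E1))"
          by (rule smooth_map_plot[OF pseudo_metrics_smooth[OF g1] 1(4)])
        moreover have "(PM (g1, g2) \<circ> q) w = T1 ((g1 \<circ> r) w)" if w: "w \<in> W" for w
        proof -
          have "r w \<in> points (base E1)" using plot_points[OF bundle1(2) 1(4)] w by blast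
          then show ?thesis using P_map_\<kappa>1[OF g1] 1(5)[OF w] by simp
        qed
        ultimately show ?thesis using 1(1-3) by blast
      next
        case (2 W r)
        have "(n, W, g2 \<circ> r) \<in> plots (total (dual_sq E2))"
          by (rule smooth_map_plot[OF pseudo_metrics_smooth[OF g2] 2(4)])
        moreover have "(PM (g1, g2) \<circ> q) w = T2 ((g2 \<circ> r) w)" if w: "w \<in> W" for w
        proof -
          have "r w \<in> points (base E2)" using plot_points[OF bundle2(2) 2(4)] w by blast
          then show ?thesis using P_map_\<kappa>2[OF g1 g2 c] 2(5)[OF w] by simp
        qed
        ultimately show ?thesis using 2(1-3) by blast
      qed
    qed
  qed
qed

text \<open>
  Over a piece \<open>W\<close> of \<open>U'\<close> on which \<open>q\<close> lifts to a plot \<open>r\<close>, the evaluation of the family at \<open>q\<close> is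
  \<open>T1\<close> or \<open>T2\<close> applied to the evaluation of the family of pseudo-metrics at \<open>r\<close>, which is smooth by
  the definition of the functional diffeology.
\<close>

lemma P_map_plot:
  assumes U: "openin (Euclidean_space n) U"
    and p1: "(n, U, fst \<circ> p) \<in> plots (fun_diff (base E1) (total (dual_sq E1)))"
    and p2: "(n, U, snd \<circ> p) \<in> plots (fun_diff (base E2) (total (dual_sq E2)))"
    and m1: "\<And>u. u \<in> U \<Longrightarrow> fst (p u) \<in> pseudo_metrics E1"
    and m2: "\<And>u. u \<in> U \<Longrightarrow> snd (p u) \<in> pseudo_metrics E2"
    and c: "\<And>u. u \<in> U \<Longrightarrow> compatible E1 E2 Y f h (fst (p u)) (snd (p u))"
    and q: "(m, U', q) \<in> plots X"
  shows "(n + m, dom_prod n U m U', \<lambda>w. PM (p (fst_part n w)) (q (snd_part n w)))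
    \<in> plots (total (dual_sq P.G))" (is "(_, _, ?F) \<in> _")
proof (rule plot_of_local_lifts)
  show "openin (Euclidean_space (n + m)) (dom_prod n U m U')"
    using q by (intro openin_dom_prod U) (simp add: glue_def quot_diff_def)
  fix w0 assume w0: "w0 \<in> dom_prod n U m U'"
  then have "snd_part n w0 \<in> U'" by (simp add: dom_prod_def)
  with q show "\<exists>W. w0 \<in> W \<and> W \<subseteq> dom_prod n U m U' \<and> openin (Euclidean_space (n + m)) W \<and>
      ((\<exists>r. (n + m, W, r) \<in> plots (total (dual_sq E1)) \<and> (\<forall>w\<in>W. ?F w = T1 (r w))) \<or>
       (\<exists>r. (n + m, W, r) \<in> plots (total (dual_sq E2)) \<and> (\<forall>w\<in>W. ?F w = T2 (r w))))"
  proof (cases rule: glue_plot_lift)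
    case (1 W r)
    let ?r = "\<lambda>w. fst (p (fst_part n w)) (r (snd_part n w))"
    have "(n + m, dom_prod n U m W, ?r) \<in> plots (total (dual_sq E1))"
      using p1 1(4) unfolding fun_diff_def Let_def by auto
    moreover have "?F w = T1 (?r w)" if w: "w \<in> dom_prod n U m W" for w
    proof -
      have u: "fst_part n w \<in> U" and s: "snd_part n w \<in> W" using w by (simp_all add: dom_prod_def)
      have "r (snd_part n w) \<in> points (base E1)" using plot_points[OF bundle1(2) 1(4)] s by blast
      from P_map_\<kappa>1[OF m1[OF u] this, of "snd (p (fst_part n w))"]
      show ?thesis using 1(5)[OF s] by simp
    qed
    moreover have "w0 \<in> dom_prod n U m W" "dom_prod n U m W \<subseteq> dom_prod n U m U'"
      using w0 1(1,2) by (auto simp: dom_prod_def)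
    ultimately show ?thesis using openin_dom_prod[OF U 1(3)] by blast
  next
    case (2 W r)
    let ?r = "\<lambda>w. snd (p (fst_part n w)) (r (snd_part n w))"
    have "(n + m, dom_prod n U m W, ?r) \<in> plots (total (dual_sq E2))"
      using p2 2(4) unfolding fun_diff_def Let_def by auto
    moreover have "?F w = T2 (?r w)" if w: "w \<in> dom_prod n U m W" for w
    proof -
      have u: "fst_part n w \<in> U" and s: "snd_part n w \<in> W" using w by (simp_all add: dom_prod_def)
      have "r (snd_part n w) \<in> points (base E2)" using plot_points[OF bundle2(2) 2(4)] s by blast
      from P_map_\<kappa>2[OF m1[OF u] m2[OF u] c[OF u] this]
      show ?thesis using 2(5)[OF s] by simp
    qed
    moreover have "w0 \<in> dom_prod n U m W" "dom_prod n U m W \<subseteq> dom_prod n U m U'"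
      using w0 2(1,2) by (auto simp: dom_prod_def)
    ultimately show ?thesis using openin_dom_prod[OF U 2(3)] by blast
  qed
qed

lemma smooth_P_map:
  "smooth_map (comp_metric_diff E1 E2 Y f h) (metric_diff P.G) PM"
  unfolding smooth_map_def
proof (intro conjI allI impI)
  have C: "PM g \<in> pseudo_metrics P.G"
    if "fst g \<in> pseudo_metrics E1" "snd g \<in> pseudo_metrics E2" "compatible E1 E2 Y f h (fst g) (snd g)"
    for g
    using P_map_pseudo_metric[OF that] by simp
  have pm: "points (metric_diff P.G) = pseudo_metrics P.G"
    by (auto simp: metric_diff_def sub_diff_def pseudo_metrics_def)
  show "PM ` points (comp_metric_diff E1 E2 Y f h) \<subseteq> points (metric_diff P.G)"
    unfolding pm using C
    by (auto simp: comp_metric_diff_def metric_diff_def sub_diff_def prod_diff_def)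
  fix n U p assume "(n, U, p) \<in> plots (comp_metric_diff E1 E2 Y f h)"
  then have p1: "(n, U, fst \<circ> p) \<in> plots (fun_diff (base E1) (total (dual_sq E1)))"
    and p2: "(n, U, snd \<circ> p) \<in> plots (fun_diff (base E2) (total (dual_sq E2)))"
    and m1: "\<And>u. u \<in> U \<Longrightarrow> fst (p u) \<in> pseudo_metrics E1"
    and m2: "\<And>u. u \<in> U \<Longrightarrow> snd (p u) \<in> pseudo_metrics E2"
    and c: "\<And>u. u \<in> U \<Longrightarrow> compatible E1 E2 Y f h (fst (p u)) (snd (p u))"
    by (auto simp: comp_metric_diff_def metric_diff_def sub_diff_def prod_diff_def)
  have U: "openin (Euclidean_space n) U" using p1 by (simp add: fun_diff_def Let_def)
  have mets: "(PM \<circ> p) u \<in> pseudo_metrics P.G" if "u \<in> U" for u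
    using C[OF m1 m2 c] that by simp
  have "(n, U, PM \<circ> p) \<in> plots (fun_diff (base P.G) (total (dual_sq P.G)))"
  proof -
    have "(PM \<circ> p) ` U \<subseteq> {h \<in> points (base P.G) \<rightarrow>\<^sub>E points (total (dual_sq P.G)).
        smooth_map (base P.G) (total (dual_sq P.G)) h}"
      using mets pseudo_metrics_subset by blast
    moreover have "(n + m, dom_prod n U m U', \<lambda>w. (PM \<circ> p) (fst_part n w) (q (snd_part n w)))
        \<in> plots (total (dual_sq P.G))" if "(m, U', q) \<in> plots (base P.G)" for m U' q
      using P_map_plot[OF U p1 p2 m1 m2 c] that by (simp add: P.base_G o_def)
    ultimately show ?thesis using U by (simp only: fun_diff_def Let_def diff_space.simps mem_Collect_eq prod.case) blast
  qed
  with mets show "(n, U, PM \<circ> p) \<in> plots (metric_diff P.G)"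
    by (auto simp: metric_diff_def sub_diff_def)
qed

end

theorem theorem7p1:
  fixes E1 :: "('v1, 'x1) pbundle" and E2 :: "('v2, 'x2) pbundle"
    and Y :: "'x1 set" and f :: "'x1 \<Rightarrow> 'x2" and h :: "'v1 \<Rightarrow> 'v2"
    and \<psi> :: "(('v1 + 'v2) set, ('x1 + 'x2) set) dual_pt \<Rightarrow>
      (('v2, 'x2) dual_pt + ('v1, 'x1) dual_pt) set"
  assumes "finite_dim_pseudo_bundle E1" and "finite_dim_pseudo_bundle E2"
    and "Y \<subseteq> points (base E1)"
    and "diffeomorphism (sub_diff (base E1) Y) (sub_diff (base E2) (f ` Y)) f"
    and "smooth_linear_lift E1 E2 Y f h"
    and "\<exists>g1\<in>pseudo_metrics E1. \<exists>g2\<in>pseudo_metrics E2. compatible E1 E2 Y f h g1 g2"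
    and "gluing_dual_commutativity E1 E2 Y f h \<psi>"
  shows "smooth_map (comp_metric_diff E1 E2 Y f h) (metric_diff (glue_bundle E1 E2 Y f h))
           (P_map E1 E2 Y f h \<psi>)"
proof -
  interpret dual_gluing E1 E2 Y f h \<psi>
    using assms by unfold_locales
  show ?thesis by (rule smooth_P_map)
qed

end
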